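(* Let $p\ge 2$ and let ${\bf u}\in W^{1,p}_{\rm loc}(\Omega)\cap C(\Omega)$ be a positive solution of $-\mathrm{div}(|\nabla u|^{p-2}\nabla u)+V|u|^{p-2}u=0$ in $\Omega$. For some $\alpha\in[1,N/p]$, $\beta\in[1,\infty]$ and $r>1$, suppose that there exists $C_r>0$ such that $$|A|^{\frac1N+\frac1{\alpha'p}-\frac1p}\left[\frac1{|A|}\int_A{\bf u}^{\frac{\alpha'pr}{\beta'}}dx\right]^{\frac1{\alpha'pr}}\left[\frac1{|A|}\int_A{\bf u}^{-p'r}dx\right]^{\frac1{p'r}}<C_r$$ for any measurable set $A$ in $\Omega$. Then $L^\alpha(\Omega,{\bf u}^{\frac{\alpha}{\beta}p})\subset\mathcal H_p(\Omega,V)$.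
   Context: Setting: $\Omega\subset\mathbb R^N$ is a domain, $V\in\mathcal M^q_{\rm loc}(p;\Omega)$ is a real valued potential, and $Q_{p,I,V}(\phi):=\int_\Omega[|\nabla\phi|^p+V|\phi|^p]dx$ (the case of the identity coefficient matrix), with the standing assumption $Q_{p,I,V}\ge0$ on $W^{1,p}(\Omega)\cap C_c(\Omega)$. Solutions are weak solutions. In the claim, $A$ denotes a measurable subset of $\Omega$ and $|A|$ its Lebesgue measure. Morrey spaces: $\mathcal M^q_{\rm loc}(\Omega)$ ($q\in[1,\infty]$) is the set of measurable real valued $f$ with $\sup\{r^{-N/q'}\int_{\omega\cap B_r(y)}|f|dx: y\in\omega,\ 0<r<\mathrm{diam}(\omega)\}<\infty$ for every open $\omega\Subset\Omega$. Then $\mathcal M^q_{\rm loc}(p;\Omega)$ is: $\mathcal M^q_{\rm loc}(\Omega)$ with $q>N/p$ if $p<N$; $L^1_{\rm loc}(\Omega)$ if $p>N$; and, if $p=N$, the set of $f$ such that for some $q>N$ and every open $\omega\Subset\Omega$, $\sup\{[\log(\mathrm{diam}(\omega)/r)]^{q/N'}\int_{\omega\cap B_r(y)}|f|dx: y\in\omega,\ 0<r<\mathrm{diam}(\omega)\}<\infty$. For $s\in[1,\infty]$, $s'=s/(s-1)$ is the Hölder conjugate exponent (with $1'=\infty$, $\infty'=1$). $L^\alpha(\Omega,w)$ is the weighted Lebesgue space of measurable $g$ with $\int_\Omega|g|^\alpha w\,dx<\infty$. $\mathcal H_p(\Omega,V)$ is the space of Hardy-weights: the set of $g\in L^1_{\rm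 loc}(\Omega)$ for which there is $C>0$ with $\int_\Omega|g||\phi|^pdx\le C\,Q_{p,I,V}(\phi)$ for all $\phi\in W^{1,p}(\Omega)\cap C_c(\Omega)$.
   Formalization: The case p = N (where α = 1, α' = ∞) is excluded: there the claim is false, e.g. N = p = 2, Ω the unit disc, V = 0, u = 1, since L¹(Ω) is not contained in H_2(Ω,0). For p > N the range of α is empty. *)

theory Defs
  imports "HOL-Analysis.Analysis" "HOL-Probability.Essential_Supremum"
begin

section \<open>Exponents\<close>

definition hoelder_conj :: "ereal \<Rightarrow> ereal" where
  "hoelder_conj s = (if s = 1 then \<infinity> else if s = \<infinity> then 1 else s / (s - 1))"

(* 1 / s as a real number, with 1 / \<infinity> = 0 *)
definition recip :: "ereal \<Rightarrow> real" where
  "recip s = real_of_ereal (1 / s)"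

(* Power of an extended nonnegative number; only used with exponents a > 0. *)
definition ennpow :: "ennreal \<Rightarrow> real \<Rightarrow> ennreal" where
  "ennpow x a = (if x = top then top else ennreal (enn2real x powr a))"


section \<open>Lebesgue and Morrey spaces\<close>

(* Elements of the function spaces are total functions, but only their restrictions to
   \<Omega> matter: no condition below depends on values outside \<Omega>. *)

definition Lp :: "real \<Rightarrow> 'a::euclidean_space set \<Rightarrow> ('a \<Rightarrow> 'b::euclidean_space) set" where
  "Lp p \<Omega> = {f. f \<in> borel_measurable (lebesgue_on \<Omega>) \<and>
               integrable (lebesgue_on \<Omega>) (\<lambda>x. norm (f x) powr p)}"

definition Lp_loc :: "real \<Rightarrow> 'a::euclidean_space set \<Rightarrow> ('a \<Rightarrow> 'b::euclidean_space) set" where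
  "Lp_loc p \<Omega> = {f. f \<in> borel_measurable (lebesgue_on \<Omega>) \<and>
                   (\<forall>K. compact K \<and> K \<subseteq> \<Omega> \<longrightarrow> f \<in> Lp p K)}"

definition weighted_Lp :: "real \<Rightarrow> 'a::euclidean_space set \<Rightarrow> ('a \<Rightarrow> real) \<Rightarrow> ('a \<Rightarrow> real) set" where
  "weighted_Lp \<alpha> \<Omega> w = {g. g \<in> borel_measurable (lebesgue_on \<Omega>) \<and>
     (\<integral>\<^sup>+x. ennreal (\<bar>g x\<bar> powr \<alpha> * w x) \<partial>lebesgue_on \<Omega>) < \<infinity>}"

definition compactly_in :: "'a::euclidean_space set \<Rightarrow> 'a set \<Rightarrow> bool" where
  "compactly_in \<omega> \<Omega> \<longleftrightarrow> open \<omega> \<and> compact (closure \<omega>) \<and> closure \<omega> \<subseteq> \<Omega>"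

definition Morrey_loc :: "ereal \<Rightarrow> 'a::euclidean_space set \<Rightarrow> ('a \<Rightarrow> real) set" where
  "Morrey_loc q \<Omega> = {f. f \<in> borel_measurable (lebesgue_on \<Omega>) \<and>
     (\<forall>\<omega>. compactly_in \<omega> \<Omega> \<longrightarrow>
       (SUP y\<in>\<omega>. SUP r\<in>{0<..<diameter \<omega>}.
          ennreal (r powr (- (real DIM('a) * recip (hoelder_conj q)))) *
          (\<integral>\<^sup>+x. ennreal \<bar>f x\<bar> \<partial>lebesgue_on (\<omega> \<inter> ball y r))) < \<infinity>)}"

(* The parameter q is relevant only for p < N; for p = N the exponent s is bound inside. *)
definition Morrey_p_loc :: "ereal \<Rightarrow> real \<Rightarrow> 'a::euclidean_space set \<Rightarrow> ('a \<Rightarrow> real) set" where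
  "Morrey_p_loc q p \<Omega> =
     (if p < real DIM('a) then {f \<in> Morrey_loc q \<Omega>. q > ereal (real DIM('a) / p)}
      else if p > real DIM('a) then Lp_loc 1 \<Omega>
      else {f. f \<in> borel_measurable (lebesgue_on \<Omega>) \<and>
        (\<exists>s > real DIM('a). \<forall>\<omega>. compactly_in \<omega> \<Omega> \<longrightarrow>
          (SUP y\<in>\<omega>. SUP r\<in>{0<..<diameter \<omega>}.
             ennreal (ln (diameter \<omega> / r) powr (s * recip (hoelder_conj (ereal (real DIM('a)))))) *
             (\<integral>\<^sup>+x. ennreal \<bar>f x\<bar> \<partial>lebesgue_on (\<omega> \<inter> ball y r))) < \<infinity>)})"


section \<open>Sobolev spaces\<close>

(* k times continuously differentiable on the whole space, via iterated partial derivatives *)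
primrec Ck :: "nat \<Rightarrow> ('a::euclidean_space \<Rightarrow> real) \<Rightarrow> bool" where
  "Ck 0 f \<longleftrightarrow> continuous_on UNIV f"
| "Ck (Suc k) f \<longleftrightarrow> (\<forall>x. f differentiable at x) \<and>
     (\<forall>b\<in>Basis. Ck k (\<lambda>x. frechet_derivative f (at x) b))"

definition test_functions :: "'a::euclidean_space set \<Rightarrow> ('a \<Rightarrow> real) set" where
  "test_functions \<Omega> = {\<psi>. (\<forall>k. Ck k \<psi>) \<and> compact (closure {x. \<psi> x \<noteq> 0}) \<and>
                           closure {x. \<psi> x \<noteq> 0} \<subseteq> \<Omega>}"

definition grad :: "('a::euclidean_space \<Rightarrow> real) \<Rightarrow> 'a \<Rightarrow> 'a" where
  "grad \<psi> x = (\<Sum>b\<in>Basis. frechet_derivative \<psi> (at x) b *\<^sub>R b)"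

definition is_weak_grad ::
    "'a::euclidean_space set \<Rightarrow> ('a \<Rightarrow> real) \<Rightarrow> ('a \<Rightarrow> 'a) \<Rightarrow> bool" where
  "is_weak_grad \<Omega> u G \<longleftrightarrow> u \<in> Lp_loc 1 \<Omega> \<and> G \<in> Lp_loc 1 \<Omega> \<and>
     (\<forall>\<psi>\<in>test_functions \<Omega>. \<forall>b\<in>Basis.
        (\<integral>x. u x * (grad \<psi> x \<bullet> b) \<partial>lebesgue_on \<Omega>) = - (\<integral>x. (G x \<bullet> b) * \<psi> x \<partial>lebesgue_on \<Omega>))"

(* For open \<Omega> the weak gradient is unique up to null sets, so the choice is immaterial. *)
definition wgrad :: "'a::euclidean_space set \<Rightarrow> ('a \<Rightarrow> real) \<Rightarrow> 'a \<Rightarrow> 'a" where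
  "wgrad \<Omega> u = (SOME G. is_weak_grad \<Omega> u G)"

definition W1p :: "real \<Rightarrow> 'a::euclidean_space set \<Rightarrow> ('a \<Rightarrow> real) set" where
  "W1p p \<Omega> = {u. u \<in> Lp p \<Omega> \<and> (\<exists>G. is_weak_grad \<Omega> u G) \<and> wgrad \<Omega> u \<in> Lp p \<Omega>}"

definition W1p_loc :: "real \<Rightarrow> 'a::euclidean_space set \<Rightarrow> ('a \<Rightarrow> real) set" where
  "W1p_loc p \<Omega> = {u. u \<in> Lp_loc p \<Omega> \<and> (\<exists>G. is_weak_grad \<Omega> u G) \<and> wgrad \<Omega> u \<in> Lp_loc p \<Omega>}"

definition Cc :: "'a::euclidean_space set \<Rightarrow> ('a \<Rightarrow> real) set" where
  "Cc \<Omega> = {\<phi>. continuous_on \<Omega> \<phi> \<and> (\<exists>K. compact K \<and> K \<subseteq> \<Omega> \<and> (\<forall>x\<in>\<Omega> - K. \<phi> x = 0))}"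


section \<open>The energy functional, weak solutions and Hardy-weights\<close>

definition Q_energy ::
    "real \<Rightarrow> ('a::euclidean_space \<Rightarrow> real) \<Rightarrow> 'a set \<Rightarrow> ('a \<Rightarrow> real) \<Rightarrow> real" where
  "Q_energy p V \<Omega> \<phi> =
     (\<integral>x. norm (wgrad \<Omega> \<phi> x) powr p + V x * \<bar>\<phi> x\<bar> powr p \<partial>lebesgue_on \<Omega>)"

definition weak_solution ::
    "real \<Rightarrow> ('a::euclidean_space \<Rightarrow> real) \<Rightarrow> 'a set \<Rightarrow> ('a \<Rightarrow> real) \<Rightarrow> bool" where
  "weak_solution p V \<Omega> u \<longleftrightarrow> u \<in> W1p_loc p \<Omega> \<and>
     (\<forall>\<psi>\<in>test_functions \<Omega>.
        (\<integral>x. norm (wgrad \<Omega> u x) powr (p - 2) * (wgrad \<Omega> u x \<bullet> grad \<psi> x)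
             + V x * \<bar>u x\<bar> powr (p - 2) * u x * \<psi> x \<partial>lebesgue_on \<Omega>) = 0)"

definition Hardy_weights ::
    "real \<Rightarrow> 'a::euclidean_space set \<Rightarrow> ('a \<Rightarrow> real) \<Rightarrow> ('a \<Rightarrow> real) set" where
  "Hardy_weights p \<Omega> V = {g. g \<in> Lp_loc 1 \<Omega> \<and>
     (\<exists>C>0. \<forall>\<phi>\<in>W1p p \<Omega> \<inter> Cc \<Omega>.
        (\<integral>x. \<bar>g x\<bar> * \<bar>\<phi> x\<bar> powr p \<partial>lebesgue_on \<Omega>) \<le> C * Q_energy p V \<Omega> \<phi>)}"


section \<open>Averages\<close>

definition average :: "'a::euclidean_space set \<Rightarrow> ('a \<Rightarrow> real) \<Rightarrow> ennreal" where
  "average A f = (\<integral>\<^sup>+x. ennreal (f x) \<partial>lebesgue_on A) / emeasure lebesgue A"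

(* [ 1/|A| \<integral>_A u^(\<alpha>' p r / \<beta>') ]^(1/(\<alpha>' p r)), the normalised L^(\<alpha>' p r)-norm of u^(1/\<beta>')
   over A. For \<alpha> = 1 we have \<alpha>' = \<infinity>, and it is the L^\<infinity>-norm of u^(1/\<beta>') over A. *)
definition upper_mean ::
    "real \<Rightarrow> ereal \<Rightarrow> real \<Rightarrow> real \<Rightarrow> ('a::euclidean_space \<Rightarrow> real) \<Rightarrow> 'a set \<Rightarrow> ennreal" where
  "upper_mean \<alpha> \<beta> p r u A =
     (if \<alpha> = 1 then esssup (lebesgue_on A) (\<lambda>x. ennreal (u x powr recip (hoelder_conj \<beta>)))
      else let \<alpha>' = real_of_ereal (hoelder_conj (ereal \<alpha>)) in
        ennpow (average A (\<lambda>x. u x powr (\<alpha>' * p * r * recip (hoelder_conj \<beta>)))) (1 / (\<alpha>' * p * r)))"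

definition lower_mean ::
    "real \<Rightarrow> real \<Rightarrow> ('a::euclidean_space \<Rightarrow> real) \<Rightarrow> 'a set \<Rightarrow> ennreal" where
  "lower_mean p r u A =
     (let p' = real_of_ereal (hoelder_conj (ereal p)) in
        ennpow (average A (\<lambda>x. u x powr (- (p' * r)))) (1 / (p' * r)))"

end

theory Submission
  imports Defs
begin

text \<open>
Since the mean value condition is assumed for all measurable sets, testing it on small balls
shows that the exponent of \<open>|A|\<close>, which is never positive, must vanish, so that \<open>\<alpha> = N/p\<close> and
\<open>\<alpha>' p\<close> is the Sobolev exponent \<open>p* = N p / (N - p)\<close>. Testing it on the union of two small balls of equal
radius around \<open>x\<close> and \<open>y\<close> gives \<open>u(x) powr (1/\<beta>') \<le> C u(y)\<close>; hence \<open>m = inf u\<close> is positive and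
\<open>u powr (1/\<beta>') \<le> C m\<close>. The weights therefore disappear and only the unweighted Sobolev inequality is needed.

Put \<open>v = \<phi>/u\<close>. Testing the equation for \<open>u\<close> with \<open>|v|^p u\<close> and using, for \<open>p \<ge> 2\<close>,
\<open>|a|^p \<ge> |b|^p + p |b|^(p-2) b.(a - b) + 2^(1-p) |a - b|^p\<close> with \<open>a = grad \<phi>\<close> and \<open>b = v grad u\<close>
gives \<open>Q(\<phi>) \<ge> 2^(1-p) \<integral> u^p |grad v|^p \<ge> 2^(1-p) m^p \<integral> |grad v|^p\<close>. Hoelder's inequality with exponents \<open>\<alpha>\<close>
and \<open>\<alpha>'\<close> and the Sobolev inequality for \<open>v\<close> then yield
\<open>\<integral> |g| |\<phi>|^p \<le> (C m)^p (\<integral> |g|^\<alpha> u^(\<alpha>p/\<beta>))^(1/\<alpha>) (\<integral> |v|^p*)^(p/p*) \<le> C' Q(\<phi>)\<close>.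
All of this is carried out for mollified \<open>u\<close> and \<open>\<phi>\<close>, followed by a passage to the limit.
\<close>

text \<open>The exponent of \<open>|A|\<close> is \<open>1/N - 1/(\<alpha> p)\<close>; its sign is
  that of \<open>\<alpha> p - N\<close>, which \<open>\<alpha> \<le> N/p\<close> makes nonpositive.
  The obstacle in the ground state argument is that \<open>|v|^p u\<close> is not smooth, as test
  functions have to be, and that \<open>V\<close> is merely locally integrable. The equation is
  therefore extended to C^1 test functions and tested with \<open>|v_n|^p u_n\<close>, where
  \<open>v_n = \<phi>_n / u_n\<close> is a quotient of mollifications. The field
  \<open>|grad u|^(p-2) grad u\<close> and the factor \<open>V u^(p-1)\<close> are never mollified,
  so the tested equation is exact for every n and only the test function varies. Its limit rests on
  dominated convergence: since \<open>u\<close> and \<open>\<phi>\<close> are continuous, the values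
  converge pointwise near the support of \<open>\<phi>\<close> with uniform bounds, which is what an
  integrable \<open>V\<close> requires; the gradients converge fast enough in L^p to have an
  integrable majorant. The Sobolev inequality is applied to the C^1 functions \<open>v_n\<close>
  only, and Fatou's lemma carries it over to \<open>v\<close>. The bound \<open>m \<le> u\<close>
  acts twice: it keeps the denominators \<open>u_n\<close> away from 0, and it strips the weight
  \<open>u^p\<close> from the energy.\<close>

section \<open>Smooth functions and mollifiers\<close>

text \<open>This family is closed under differentiation, whence the smoothness of \<open>flat 1\<close>.\<close>
definition flat :: "real poly \<Rightarrow> real \<Rightarrow> real" where
  "flat q t = (if t \<le> 0 then 0 else poly q (1 / t) * exp (- (1 / t)))"

text \<open>From the right, \<open>y = 1 / t\<close> turns this into the decay of
  \<open>poly q y * exp (- y)\<close> at infinity, term by term in the coefficients; from the left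
  the function is zero.\<close>

lemma flat_tendsto_0: "(flat q \<longlongrightarrow> 0) (at 0)"
proof -
  have "((\<lambda>y::real. \<Sum>i\<le>degree q. coeff q i * (y ^ i / exp y)) \<longlongrightarrow> (\<Sum>i\<le>degree q. coeff q i * 0)) at_top"
    by (intro tendsto_intros tendsto_power_div_exp_0)
  then have "((\<lambda>y::real. poly q y * exp (- y)) \<longlongrightarrow> 0) at_top"
    by (simp add: poly_altdef sum_distrib_right exp_minus divide_inverse mult.assoc)
  then have "((\<lambda>t::real. poly q (inverse t) * exp (- (inverse t))) \<longlongrightarrow> 0) (at_right 0)"
    by (rule filterlim_compose[OF _ filterlim_inverse_at_top_right])
  then have "(flat q \<longlongrightarrow> 0) (at_right 0)"
    by (rule Lim_transform_eventually)
       (auto simp: flat_def eventually_at_right_field inverse_eq_divide intro!: exI[of _ 1])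
  moreover have "(flat q \<longlongrightarrow> 0) (at_left 0)"
    by (rule Lim_transform_eventually[OF tendsto_const])
       (auto simp: flat_def eventually_at_left_field intro!: exI[of _ "-1"])
  ultimately show ?thesis by (simp add: filterlim_split_at)
qed

text \<open>With \<open>y = 1 / t\<close> one has \<open>dy/dt = - y^2\<close>, so
  \<open>poly q y * exp (- y)\<close> differentiates to
  \<open>y^2 * (q - q') (y) * exp (- y)\<close>; this is the origin of the new polynomial.\<close>

lemma flat_has_derivative:
  "(flat q has_real_derivative flat ([:0, 0, 1:] * (q - pderiv q)) t) (at t)"
proof -
  consider "t < 0" | "t = 0" | "t > 0" by linarith
  then show ?thesis
  proof cases
    case 1
    have "((\<lambda>t. 0) has_real_derivative 0) (at t)" by simp
    then have "(flat q has_real_derivative 0) (at t)"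
      by (rule has_field_derivative_transform_within_open[where S="{..<0}"])
         (use 1 in \<open>auto simp: flat_def\<close>)
    then show ?thesis using 1 by (simp add: flat_def)
  next
    case 2
    \<comment> \<open>Dividing by the argument \<open>t\<close> is multiplication by
      \<open>1 / t\<close>, i.e. passage from \<open>q\<close> to \<open>pCons 0 q\<close>, so the
      difference quotient at 0 is again a function of the family.\<close>
    have "((\<lambda>y. (flat q y - flat q 0) / (y - 0)) \<longlongrightarrow> 0) (at 0)"
      by (rule Lim_transform_eventually[OF flat_tendsto_0[of "pCons 0 q"]])
         (auto simp: flat_def eventually_at_filter)
    then show ?thesis using 2 by (simp add: has_field_derivative_iff flat_def)
  next
    case 3
    have inv: "((\<lambda>t. 1 / t) has_real_derivative - (1 / t\<^sup>2)) (at t)"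
      using 3 by (auto intro!: derivative_eq_intros simp: power2_eq_square)
    have "((\<lambda>t. poly q (1 / t)) has_real_derivative poly (pderiv q) (1 / t) * - (1 / t\<^sup>2)) (at t)"
      by (rule DERIV_chain2[OF poly_DERIV inv])
    moreover have "((\<lambda>t. exp (- (1 / t))) has_real_derivative exp (- (1 / t)) * (1 / t\<^sup>2)) (at t)"
      using DERIV_chain2[OF DERIV_exp DERIV_minus[OF inv]] by simp
    ultimately have "((\<lambda>t. poly q (1 / t) * exp (- (1 / t))) has_real_derivative
        flat ([:0, 0, 1:] * (q - pderiv q)) t) (at t)"
      by (rule DERIV_cong[OF DERIV_mult])
         (use 3 in \<open>simp add: flat_def power2_eq_square algebra_simps\<close>)
    then show ?thesis
      by (rule has_field_derivative_transform_within_open[where S="{0<..}"])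
         (use 3 in \<open>auto simp: flat_def\<close>)
  qed
qed

lemma Ck_continuous: "Ck k f \<Longrightarrow> continuous_on UNIV f"
proof (cases k)
  case (Suc n)
  then show "Ck k f \<Longrightarrow> continuous_on UNIV f"
    by (simp add: continuous_at_imp_continuous_on differentiable_imp_continuous_within)
qed simp

lemma Ck_Suc_D: "Ck (Suc k) f \<Longrightarrow> Ck k f"
proof (induction k arbitrary: f)
  case 0
  show ?case using Ck_continuous[OF 0] by simp
next
  case (Suc k)
  show ?case unfolding Ck.simps(2)[of k f]
    using Suc.prems[unfolded Ck.simps(2)[of "Suc k" f]] Suc.IH by blast
qed

lemma Ck_const: "Ck k (\<lambda>x::'a::euclidean_space. c)"
  by (induction k arbitrary: c) auto

lemma differentiable_has_frechet_derivative:
  "f differentiable at x \<Longrightarrow> (f has_derivative frechet_derivative f (at x)) (at x)"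
  by (simp add: frechet_derivative_works[symmetric])

lemma Ck_add: "Ck k f \<Longrightarrow> Ck k g \<Longrightarrow> Ck k (\<lambda>x. f x + g x)"
proof (induction k arbitrary: f g)
  case (Suc k)
  then have "((\<lambda>x. f x + g x) has_derivative
      (\<lambda>h. frechet_derivative f (at x) h + frechet_derivative g (at x) h)) (at x)" for x
    by (intro has_derivative_add differentiable_has_frechet_derivative) auto
  then have "frechet_derivative (\<lambda>x. f x + g x) (at x) =
      (\<lambda>h. frechet_derivative f (at x) h + frechet_derivative g (at x) h)" for x
    by (rule frechet_derivative_at[symmetric])
  with Suc show ?case by auto
qed (auto intro: continuous_intros)

lemma Ck_mult: "Ck k f \<Longrightarrow> Ck k g \<Longrightarrow> Ck k (\<lambda>x. f x * g x)"
proof (induction k arbitrary: f g)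
  case (Suc k)
  then have "((\<lambda>x. f x * g x) has_derivative
      (\<lambda>h. f x * frechet_derivative g (at x) h + frechet_derivative f (at x) h * g x)) (at x)" for x
    by (intro has_derivative_mult differentiable_has_frechet_derivative) auto
  then have "frechet_derivative (\<lambda>x. f x * g x) (at x) =
      (\<lambda>h. f x * frechet_derivative g (at x) h + frechet_derivative f (at x) h * g x)" for x
    by (rule frechet_derivative_at[symmetric])
  with Suc show ?case
    using Ck_Suc_D[OF Suc.prems(1)] Ck_Suc_D[OF Suc.prems(2)]
    by (auto intro!: Ck_add)
qed (auto intro: continuous_intros)

lemma Ck_inner_const: "Ck k (\<lambda>x::'a::euclidean_space. x \<bullet> b)"
proof (cases k)
  case (Suc n)
  have "((\<lambda>x. x \<bullet> b) has_derivative (\<lambda>h. h \<bullet> b)) (at x)" for x :: 'a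
    by (auto intro!: derivative_eq_intros)
  then have "frechet_derivative (\<lambda>x. x \<bullet> b) (at x) = (\<lambda>h. h \<bullet> b)" for x :: 'a
    by (rule frechet_derivative_at[symmetric])
  then show ?thesis using Suc by (auto simp: Ck_const)
qed (auto intro: continuous_intros)

text \<open>A partial derivative is \<open>flat\<close> of another polynomial times
  \<open>-2 * (x \<bullet> b)\<close>, so the induction on \<open>k\<close> has to run over all
  \<open>q\<close> at once.\<close>

lemma Ck_flat: "Ck k (\<lambda>x::'a::euclidean_space. flat q (c - x \<bullet> x))"
proof (induction k arbitrary: q)
  case 0
  have "continuous_on UNIV (flat q)"
    by (meson DERIV_continuous_on DERIV_subset flat_has_derivative subset_UNIV)
  then have "continuous_on UNIV (\<lambda>x::'a. flat q (c - x \<bullet> x))"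
    by (rule continuous_on_compose2) (auto intro!: continuous_intros)
  then show ?case by simp
next
  case (Suc k)
  let ?q = "[:0, 0, 1:] * (q - pderiv q)"
  have "((\<lambda>x. flat q (c - x \<bullet> x)) has_derivative
      (\<lambda>h. flat ?q (c - x \<bullet> x) * (- (h \<bullet> x + x \<bullet> h)))) (at x)" for x :: 'a
    by (rule has_derivative_compose[where g="flat q" and f="\<lambda>x. c - x \<bullet> x"
          and g'="(*) (flat ?q (c - x \<bullet> x))"])
       (auto intro!: derivative_eq_intros simp: inner_commute
         flat_has_derivative[unfolded has_field_derivative_def] simp del: mult_pCons_left)
  then have *: "((\<lambda>x. flat q (c - x \<bullet> x)) has_derivative
      (\<lambda>h. flat ?q (c - x \<bullet> x) * (-2 * (x \<bullet> h)))) (at x)" for x :: 'a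
    by (rule has_derivative_eq_rhs) (auto simp: inner_commute fun_eq_iff)
  then have "frechet_derivative (\<lambda>x. flat q (c - x \<bullet> x)) (at x) =
      (\<lambda>h. flat ?q (c - x \<bullet> x) * (-2 * (x \<bullet> h)))" for x :: 'a
    by (rule frechet_derivative_at[symmetric])
  moreover have "(\<lambda>x. flat q (c - x \<bullet> x)) differentiable at x" for x :: 'a
    using * differentiable_def by blast
  moreover have "Ck k (\<lambda>x::'a. flat ?q (c - x \<bullet> x) * (-2 * (x \<bullet> b)))" for b
    by (intro Ck_mult Ck_const Ck_inner_const Suc)
  ultimately show ?case by (simp only: Ck.simps) blast
qed

text \<open>The gradient is carried as an argument, so that products, quotients and convolutions can
  state theirs by a formula; \<open>C1_grad_grad\<close> identifies it with
  \<open>grad\<close>.\<close>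

definition C1_grad :: "('a::euclidean_space \<Rightarrow> real) \<Rightarrow> ('a \<Rightarrow> 'a) \<Rightarrow> bool" where
  "C1_grad f f' \<longleftrightarrow> continuous_on UNIV f' \<and> (\<forall>x. (f has_derivative (\<lambda>h. f' x \<bullet> h)) (at x))"

lemma C1_grad_D:
  assumes "C1_grad f f'"
  shows "continuous_on UNIV f'" "(f has_derivative (\<lambda>h. f' x \<bullet> h)) (at x)"
    "continuous_on UNIV f"
proof -
  show "continuous_on UNIV f'" and D: "(f has_derivative (\<lambda>h. f' x \<bullet> h)) (at x)" for x
    using assms unfolding C1_grad_def by auto
  show "continuous_on UNIV f"
    using D has_derivative_continuous continuous_at_imp_continuous_on by blast
qed

lemma C1_grad_grad: "C1_grad f f' \<Longrightarrow> grad f = f'"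
proof
  fix x assume "C1_grad f f'"
  then have "frechet_derivative f (at x) = (\<lambda>h. f' x \<bullet> h)"
    by (intro frechet_derivative_at[symmetric] C1_grad_D(2))
  then show "grad f x = f' x"
    by (simp add: grad_def euclidean_representation)
qed

lemma Ck_C1_grad: "Ck (Suc k) f \<Longrightarrow> C1_grad f (grad f)"
  unfolding C1_grad_def
proof (intro conjI allI)
  assume f: "Ck (Suc k) f"
  show "continuous_on UNIV (grad f)"
    unfolding grad_def using f by (intro continuous_intros) (auto intro: Ck_continuous)
  fix x
  have D: "(f has_derivative frechet_derivative f (at x)) (at x)"
    using f by (intro differentiable_has_frechet_derivative) simp
  interpret bounded_linear "frechet_derivative f (at x)" using D by (rule has_derivative_bounded_linear)
  have "frechet_derivative f (at x) h = grad f x \<bullet> h" for h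
  proof -
    have "frechet_derivative f (at x) h = frechet_derivative f (at x) (\<Sum>b\<in>Basis. (h \<bullet> b) *\<^sub>R b)"
      by (simp add: euclidean_representation)
    also have "\<dots> = (\<Sum>b\<in>Basis. (h \<bullet> b) * frechet_derivative f (at x) b)"
      by (simp only: sum scaleR real_scaleR_def)
    finally show ?thesis by (simp add: grad_def inner_sum_left inner_commute[of h] mult.commute)
  qed
  then show "(f has_derivative (\<lambda>h. grad f x \<bullet> h)) (at x)"
    using D by (metis (no_types, lifting) ext)
qed

lemma mollifier_exists:
  assumes "\<epsilon> > 0"
  obtains k :: "'a::euclidean_space \<Rightarrow> real" where "\<And>n. Ck n k" "\<And>x. 0 \<le> k x"
    "\<And>x. norm x \<ge> \<epsilon> \<Longrightarrow> k x = 0" "integrable lborel k" "(\<integral>x. k x \<partial>lborel) = 1"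
proof -
  define h :: "'a \<Rightarrow> real" where "h = (\<lambda>x. flat 1 (\<epsilon>\<^sup>2 - x \<bullet> x))"
  have Ch: "Ck n h" for n unfolding h_def by (rule Ck_flat)
  have cont: "continuous_on UNIV h" using Ch[of 0] by simp
  have h0: "h x \<ge> 0" for x by (simp add: h_def flat_def)
  have hz: "h x = 0" if "norm x \<ge> \<epsilon>" for x
  proof -
    have "\<epsilon>\<^sup>2 \<le> x \<bullet> x"
      using that assms by (simp add: dot_square_norm power_mono)
    then show ?thesis by (simp add: h_def flat_def)
  qed
  have hp: "h x > 0" if "norm x < \<epsilon>" for x
  proof -
    have "x \<bullet> x < \<epsilon>\<^sup>2"
      using that by (simp add: dot_square_norm power_strict_mono)
    then show ?thesis by (simp add: h_def flat_def)
  qed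
  have int: "integrable lborel h"
  proof -
    have "integrable lborel (\<lambda>x. indicator (cball 0 \<epsilon>) x *\<^sub>R h x)"
      by (rule borel_integrable_compact) (use cont in \<open>auto intro: continuous_on_subset\<close>)
    also have "(\<lambda>x. indicator (cball 0 \<epsilon>) x *\<^sub>R h x) = h"
      using hz by (auto simp: indicator_def fun_eq_iff)
    finally show ?thesis .
  qed
  define c where "c = (\<integral>x. h x \<partial>lborel)"
  \<comment> \<open>A vanishing integral would force \<open>h = 0\<close> almost everywhere, but
    \<open>h\<close> is positive on a ball of positive measure.\<close>
  have "c > 0"
  proof -
    have "c \<noteq> 0"
    proof
      assume "c = 0"
      then have "AE x in lborel. h x = 0"
        using integral_nonneg_eq_0_iff_AE[OF int] h0 by (simp add: c_def)
      then have "AE x in lborel. x \<in> - ball (0::'a) \<epsilon>"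
      proof eventually_elim
        fix x :: 'a assume "h x = 0"
        then show "x \<in> - ball 0 \<epsilon>" using hp[of x] by auto
      qed
      then have "measure lborel (ball (0::'a) \<epsilon>) = 0"
        using AE_iff_null_sets[of "ball (0::'a) \<epsilon>" lborel] by (simp add: null_sets_def measure_def)
      then show False using content_ball_pos[OF assms, of "0::'a"] by simp
    qed
    moreover have "c \<ge> 0" unfolding c_def using h0 by simp
    ultimately show ?thesis by simp
  qed
  show ?thesis
  proof (rule that[of "\<lambda>x. (1 / c) * h x"])
    show "Ck n (\<lambda>x. 1 / c * h x)" for n by (intro Ck_mult Ck_const Ch)
  qed (use \<open>c > 0\<close> h0 hz int in \<open>auto simp: c_def\<close>)
qed

section \<open>The Gagliardo-Nirenberg-Sobolev inequality\<close>

text \<open>Unlike \<open>ennpow\<close>, and unlike \<open>powr\<close>, this satisfies \<open>0^0 = 1\<close>; vanishing exponents occur at the start of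
the induction in \<open>gagliardo_step\<close>.\<close>
definition epow :: "ennreal \<Rightarrow> real \<Rightarrow> ennreal" where
  "epow x a = (if a = 0 then 1 else ennpow x a)"

lemma epow_ennreal: "0 \<le> x \<Longrightarrow> a \<noteq> 0 \<Longrightarrow> epow (ennreal x) a = ennreal (x powr a)"
  by (simp add: epow_def ennpow_def)

lemma epow_top: "a \<noteq> 0 \<Longrightarrow> epow top a = top"
  by (simp add: epow_def ennpow_def)

lemma epow_0[simp]: "epow x 0 = 1"
  by (simp add: epow_def)

lemma epow_1[simp]: "epow x 1 = x"
  by (cases x) (auto simp: epow_ennreal epow_top)

lemma epow_zero: "a \<noteq> 0 \<Longrightarrow> epow 0 a = 0"
  using epow_ennreal[of 0 a] by simp

lemma epow_one: "epow 1 a = 1"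
  using epow_ennreal[of 1 a] by (cases "a = 0") auto

lemma epow_eq_0_iff: "epow x a = 0 \<longleftrightarrow> x = 0 \<and> a \<noteq> 0"
  by (cases x; cases "a = 0") (auto simp: epow_ennreal epow_top)

lemma epow_mono: "x \<le> y \<Longrightarrow> 0 \<le> a \<Longrightarrow> epow x a \<le> epow y a"
  by (cases x; cases y; cases "a = 0")
     (auto simp: epow_ennreal epow_top powr_mono2 top_unique intro!: ennreal_leI)

lemma epow_mult: "epow (x * y) a = epow x a * epow y a"
proof (cases "a = 0")
  case False
  then show ?thesis
    by (cases x; cases y)
       (auto simp: epow_ennreal epow_top ennreal_mult[symmetric] powr_mult ennreal_mult_top
          ennreal_top_mult epow_zero)
qed simp

lemma epow_add: "0 \<le> a \<Longrightarrow> 0 \<le> b \<Longrightarrow> epow x (a + b) = epow x a * epow x b"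
  by (cases x; cases "a = 0"; cases "b = 0")
     (auto simp: epow_ennreal epow_top ennreal_mult[symmetric] powr_add add_nonneg_eq_0_iff)

lemma epow_epow: "epow (epow x a) b = epow x (a * b)"
  by (cases x; cases "a = 0"; cases "b = 0")
     (auto simp: epow_ennreal epow_top epow_one powr_powr)

lemma epow_power: "0 \<le> a \<Longrightarrow> epow x a ^ n = epow x (real n * a)"
  by (induction n) (auto simp: epow_add algebra_simps)

lemma epow_measurable[measurable]:
  assumes [measurable]: "f \<in> borel_measurable M"
  shows "(\<lambda>x. epow (f x) a) \<in> borel_measurable M"
  unfolding epow_def ennpow_def by measurable

text \<open>Concavity of the logarithm, after zero weights have been discarded. A factor
  \<open>top\<close> makes the right-hand side \<open>top\<close>, a factor 0 makes the left-hand
  side 0, so only positive reals remain.\<close>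

lemma ennreal_weighted_am_gm:
  fixes x :: "'i \<Rightarrow> ennreal"
  assumes I: "finite I" and w: "\<And>i. i \<in> I \<Longrightarrow> 0 \<le> w i" "(\<Sum>i\<in>I. w i) = 1"
  shows "(\<Prod>i\<in>I. epow (x i) (w i)) \<le> (\<Sum>i\<in>I. ennreal (w i) * x i)"
proof -
  define J where "J = {i\<in>I. w i \<noteq> 0}"
  have J: "finite J" "J \<subseteq> I" using I by (auto simp: J_def)
  have Jw: "0 < w i" if "i \<in> J" for i using w(1)[of i] that by (auto simp: J_def less_le)
  have "(\<Sum>i\<in>J. w i) = (\<Sum>i\<in>I. w i)"
    using I by (intro sum.mono_neutral_left) (auto simp: J_def)
  note J = J Jw this[unfolded w(2)]
  have "(\<Prod>i\<in>I. epow (x i) (w i)) = (\<Prod>i\<in>J. epow (x i) (w i))"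
    using I by (intro prod.mono_neutral_right) (auto simp: J_def)
  moreover have "(\<Sum>i\<in>I. ennreal (w i) * x i) = (\<Sum>i\<in>J. ennreal (w i) * x i)"
    using I by (intro sum.mono_neutral_right) (auto simp: J_def)
  moreover have "(\<Prod>i\<in>J. epow (x i) (w i)) \<le> (\<Sum>i\<in>J. ennreal (w i) * x i)"
  proof (cases "\<exists>i\<in>J. x i = top")
    case True
    then obtain i where i: "i \<in> J" "x i = top" by auto
    then have "ennreal (w i) * x i = top" using J(3)[of i] by (simp add: ennreal_mult_top)
    then have "(\<Sum>i\<in>J. ennreal (w i) * x i) = top"
      using i J(1) by (auto simp: sum.remove[of J i])
    then show ?thesis by simp
  next
    case False
    define y where "y i = enn2real (x i)" for i
    have xy: "x i = ennreal (y i)" if "i \<in> J" for i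
      using False that by (simp add: y_def less_top)
    have y0: "0 \<le> y i" for i by (simp add: y_def)
    show ?thesis
    proof (cases "\<exists>i\<in>J. y i = 0")
      case True
      then obtain i where i: "i \<in> J" "y i = 0" by auto
      then have "epow (x i) (w i) = 0" using J(3)[of i] xy[of i] by (simp add: epow_zero)
      then show ?thesis using i J(1) by (auto simp: prod.remove[of J i])
    next
      case False
      then have yp: "0 < y i" if "i \<in> J" for i using that y0[of i] by (auto simp: less_le)
      have pos: "0 < (\<Sum>i\<in>J. w i * y i)"
      proof (rule sum_pos)
        show "J \<noteq> {}" using J(4) by auto
      qed (use J yp in auto)
      have "(\<Sum>i\<in>J. w i * ln (y i)) \<le> ln (\<Sum>i\<in>J. w i *\<^sub>R y i)"
        by (rule concave_on_sum[OF J(1) _ ln_concave]) (use J yp in \<open>auto intro: less_imp_le\<close>)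
      then have "exp (\<Sum>i\<in>J. w i * ln (y i)) \<le> (\<Sum>i\<in>J. w i * y i)"
        using pos by (simp add: ln_ge_iff)
      also have "exp (\<Sum>i\<in>J. w i * ln (y i)) = (\<Prod>i\<in>J. y i powr w i)"
        unfolding exp_sum[OF J(1)] by (intro prod.cong refl) (use yp in \<open>force simp: powr_def\<close>)
      finally have *: "(\<Prod>i\<in>J. y i powr w i) \<le> (\<Sum>i\<in>J. w i * y i)" .
      have "(\<Prod>i\<in>J. epow (x i) (w i)) = (\<Prod>i\<in>J. ennreal (y i powr w i))"
      proof (rule prod.cong)
        fix i assume "i \<in> J"
        then show "epow (x i) (w i) = ennreal (y i powr w i)"
          using J(3)[of i] y0 by (simp add: xy epow_ennreal)
      qed simp
      also have "\<dots> = ennreal (\<Prod>i\<in>J. y i powr w i)" by (simp add: prod_ennreal)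
      also have "\<dots> \<le> ennreal (\<Sum>i\<in>J. w i * y i)" using * by (rule ennreal_leI)
      also have "\<dots> = (\<Sum>i\<in>J. ennreal (w i * y i))"
        using J(3) y0 by (intro sum_ennreal[symmetric]) (simp add: less_imp_le)
      also have "\<dots> = (\<Sum>i\<in>J. ennreal (w i) * x i)"
        using J(3) y0 by (intro sum.cong) (auto simp: xy ennreal_mult less_imp_le)
      finally show ?thesis .
    qed
  qed
  ultimately show ?thesis by simp
qed

text \<open>Each \<open>F i\<close> is scaled to integral 1; the weighted arithmetic-geometric mean
  inequality, applied pointwise and integrated, then gives the bound 1. Zero and infinite integrals
  admit no scaling and are settled beforehand, zero first, because
  \<open>0 * top = 0\<close>.\<close>

lemma nn_integral_Hoelder_prod:
  fixes F :: "'i \<Rightarrow> 'x \<Rightarrow> ennreal"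
  assumes I: "finite I" and w: "\<And>i. i \<in> I \<Longrightarrow> 0 \<le> w i" "(\<Sum>i\<in>I. w i) = 1"
    and F[measurable]: "\<And>i. i \<in> I \<Longrightarrow> F i \<in> borel_measurable M"
  shows "(\<integral>\<^sup>+x. (\<Prod>i\<in>I. epow (F i x) (w i)) \<partial>M) \<le> (\<Prod>i\<in>I. epow (\<integral>\<^sup>+x. F i x \<partial>M) (w i))"
proof (cases "\<exists>i\<in>I. w i \<noteq> 0 \<and> (\<integral>\<^sup>+x. F i x \<partial>M) = 0")
  case True
  then obtain i where i: "i \<in> I" "w i \<noteq> 0" "(\<integral>\<^sup>+x. F i x \<partial>M) = 0" by auto
  then have "AE x in M. F i x = 0" by (simp add: nn_integral_0_iff_AE F)
  then have "AE x in M. (\<Prod>i\<in>I. epow (F i x) (w i)) = 0"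
    by eventually_elim (use i I in \<open>auto simp: prod.remove[of I i] epow_zero\<close>)
  then have "(\<integral>\<^sup>+x. (\<Prod>i\<in>I. epow (F i x) (w i)) \<partial>M) = 0"
    by (simp add: nn_integral_0_iff_AE)
  then show ?thesis by simp
next
  case n0: False
  show ?thesis
  proof (cases "\<exists>i\<in>I. w i \<noteq> 0 \<and> (\<integral>\<^sup>+x. F i x \<partial>M) = top")
    case True
    then obtain i where i: "i \<in> I" "w i \<noteq> 0" "(\<integral>\<^sup>+x. F i x \<partial>M) = top" by auto
    have "(\<Prod>j\<in>I - {i}. epow (\<integral>\<^sup>+x. F j x \<partial>M) (w j)) \<noteq> 0"
      using n0 I by (auto simp: epow_eq_0_iff)
    then have "(\<Prod>i\<in>I. epow (\<integral>\<^sup>+x. F i x \<partial>M) (w i)) = top"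
      using i I by (simp add: prod.remove[of I i] epow_top ennreal_top_mult)
    then show ?thesis by simp
  next
    case nt: False
    \<comment> \<open>Where the weight is 0 the factor is 1 whatever the integral is, so the scaling
      constant 1 is harmless there even if the integral is 0 or \<open>top\<close>.\<close>
    define A where "A i = (if w i = 0 then 1 else \<integral>\<^sup>+x. F i x \<partial>M)" for i
    have A: "A i \<noteq> 0" "A i \<noteq> top" if "i \<in> I" for i
      using n0 nt that by (auto simp: A_def)
    have AF: "epow (F i x) (w i) = epow (A i) (w i) * epow (F i x / A i) (w i)" if "i \<in> I" for i x
    proof -
      have "F i x = A i * (F i x / A i)"
        using A[OF that] by (simp add: ennreal_times_divide mult.commute[of "A i"] ennreal_mult_divide_eq)
      then show ?thesis by (metis epow_mult)
    qed
    have "(\<integral>\<^sup>+x. (\<Prod>i\<in>I. epow (F i x) (w i)) \<partial>M)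
        = (\<integral>\<^sup>+x. (\<Prod>i\<in>I. epow (A i) (w i)) * (\<Prod>i\<in>I. epow (F i x / A i) (w i)) \<partial>M)"
      by (intro nn_integral_cong) (simp add: AF prod.distrib)
    also have "\<dots> = (\<Prod>i\<in>I. epow (A i) (w i)) * (\<integral>\<^sup>+x. (\<Prod>i\<in>I. epow (F i x / A i) (w i)) \<partial>M)"
      by (intro nn_integral_cmult) measurable
    also have "(\<integral>\<^sup>+x. (\<Prod>i\<in>I. epow (F i x / A i) (w i)) \<partial>M)
        \<le> (\<integral>\<^sup>+x. (\<Sum>i\<in>I. ennreal (w i) * (F i x / A i)) \<partial>M)"
      by (intro nn_integral_mono ennreal_weighted_am_gm I w)
    also have "\<dots> = (\<Sum>i\<in>I. ennreal (w i) * ((\<integral>\<^sup>+x. F i x \<partial>M) / A i))"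
      by (simp add: nn_integral_sum nn_integral_cmult nn_integral_divide)
    also have "\<dots> = (\<Sum>i\<in>I. ennreal (w i))"
    proof (rule sum.cong)
      fix i assume i: "i \<in> I"
      show "ennreal (w i) * ((\<integral>\<^sup>+x. F i x \<partial>M) / A i) = ennreal (w i)"
      proof (cases "w i = 0")
        case False
        then have "(\<integral>\<^sup>+x. F i x \<partial>M) / A i = 1"
          using n0 nt i unfolding A_def by (simp del: ennreal_divide_self) (intro ennreal_divide_self; auto simp: less_top)
        then show ?thesis by simp
      qed simp
    qed simp
    also have "\<dots> = 1" using w by (simp add: sum_ennreal)
    also have "(\<Prod>i\<in>I. epow (A i) (w i)) * 1 = (\<Prod>i\<in>I. epow (\<integral>\<^sup>+x. F i x \<partial>M) (w i))"
      by (auto simp: A_def intro!: prod.cong)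
    finally show ?thesis by (simp add: mult_left_mono)
  qed
qed

lemma nn_integral_Hoelder:
  assumes "F \<in> borel_measurable M" "G \<in> borel_measurable M" "0 \<le> a" "0 \<le> b" "a + b = 1"
  shows "(\<integral>\<^sup>+x. epow (F x) a * epow (G x) b \<partial>M) \<le> epow (\<integral>\<^sup>+x. F x \<partial>M) a * epow (\<integral>\<^sup>+x. G x \<partial>M) b"
proof -
  define H where "H i = (if i then F else G)" for i
  define w where "w i = (if i then a else b)" for i
  have "(\<integral>\<^sup>+x. (\<Prod>i\<in>UNIV. epow (H i x) (w i)) \<partial>M) \<le> (\<Prod>i\<in>UNIV. epow (\<integral>\<^sup>+x. H i x \<partial>M) (w i))"
    by (rule nn_integral_Hoelder_prod) (use assms in \<open>auto simp: H_def w_def UNIV_bool\<close>)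
  then show ?thesis by (simp add: UNIV_bool H_def w_def mult.commute)
qed

text \<open>The integral over the coordinates in \<open>S\<close>, kept as a function on the whole
  space that is constant along \<open>S\<close>; coordinates can thus be integrated out one by one
  without splitting the space.\<close>

definition marg :: "'a set \<Rightarrow> ('a::euclidean_space \<Rightarrow> ennreal) \<Rightarrow> 'a \<Rightarrow> ennreal" where
  "marg S f x = (\<integral>\<^sup>+z. f (x + (\<Sum>b\<in>S. z b *\<^sub>R b)) \<partial>(\<Pi>\<^sub>M b\<in>S. lborel))"

interpretation lborel_product: product_sigma_finite "\<lambda>b::'a::euclidean_space. lborel :: real measure"
  by standard

lemma marg_empty: "marg {} f x = f x"
  by (simp add: marg_def PiM_empty nn_integral_count_space_finite)

lemma marg_insert:
  assumes S: "finite S" "b \<notin> S" and [measurable]: "f \<in> borel_measurable borel"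
  shows "marg (insert b S) f x = (\<integral>\<^sup>+t. marg S f (x + t *\<^sub>R b) \<partial>lborel)"
proof -
  have eq: "(\<Sum>c\<in>insert b S. (z(b := t)) c *\<^sub>R c) = t *\<^sub>R b + (\<Sum>c\<in>S. z c *\<^sub>R c)" for z t
  proof -
    have "(\<Sum>c\<in>S. (z(b := t)) c *\<^sub>R c) = (\<Sum>c\<in>S. z c *\<^sub>R c)"
      using S by (intro sum.cong) auto
    then show ?thesis using S by simp
  qed
  have "marg (insert b S) f x = (\<integral>\<^sup>+t. (\<integral>\<^sup>+z. f (x + (\<Sum>c\<in>insert b S. (z(b := t)) c *\<^sub>R c))
      \<partial>(\<Pi>\<^sub>M b\<in>S. lborel)) \<partial>lborel)"
    unfolding marg_def by (rule lborel_product.product_nn_integral_insert_rev[OF S]) measurable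
  then show ?thesis unfolding eq marg_def by (simp add: add.assoc)
qed

lemma marg_measurable[measurable]:
  assumes [measurable]: "f \<in> borel_measurable borel" and "finite S"
  shows "marg S f \<in> borel_measurable borel"
  using \<open>finite S\<close>
proof (induction S)
  case empty
  have "marg {} f = f" by (simp add: marg_empty fun_eq_iff)
  then show ?case by simp
next
  case (insert b S)
  note [measurable] = insert(3)
  have "marg (insert b S) f = (\<lambda>x. \<integral>\<^sup>+t. marg S f (x + t *\<^sub>R b) \<partial>lborel)"
    using insert by (simp add: marg_insert fun_eq_iff)
  then show ?case by simp
qed

text \<open>Translation invariance of Lebesgue measure in the coordinate \<open>b\<close>, which is
  taken as the outermost integral.\<close>

lemma marg_translate:
  assumes S: "finite S" "b \<in> S" and f[measurable]: "f \<in> borel_measurable borel"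
  shows "marg S f (x + s *\<^sub>R b) = marg S f x"
proof -
  have [measurable]: "marg (S - {b}) f \<in> borel_measurable borel" using S by simp
  have *: "marg S f y = (\<integral>\<^sup>+t. marg (S - {b}) f (y + t *\<^sub>R b) \<partial>lborel)" for y
    using marg_insert[of "S - {b}" b f y] S by (simp add: insert_absorb)
  have "marg S f x = (\<integral>\<^sup>+t. marg (S - {b}) f (x + (s + 1 * t) *\<^sub>R b) \<partial>lborel)"
    unfolding *[of x] by (subst nn_integral_real_affine[where c=1 and t=s]) simp_all
  then show ?thesis unfolding * by (simp add: algebra_simps)
qed

lemma marg_Basis:
  assumes [measurable]: "f \<in> borel_measurable borel"
  shows "marg Basis f 0 = (\<integral>\<^sup>+x. f x \<partial>lborel)"
  unfolding marg_def by (subst (2) lborel_eq) (simp add: nn_integral_distr)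

text \<open>The coordinates in \<open>S\<close> have been integrated out one after the other. Of the factors on the right, one does
not depend on the next coordinate; the exponents of the others add up to 1, so that Hoelder's inequality applies.\<close>
lemma gagliardo_step:
  fixes f :: "'a::euclidean_space \<Rightarrow> ennreal"
  assumes f[measurable]: "f \<in> borel_measurable borel" and N: "2 \<le> DIM('a)"
    and p: "p = 1 / (real DIM('a) - 1)" and S: "S \<subseteq> Basis"
  shows "marg S (\<lambda>x. \<Prod>c\<in>Basis. epow (marg {c} f x) p) x
    \<le> epow (marg S f x) (real (card S) * p) * (\<Prod>c\<in>Basis - S. epow (marg (insert c S) f x) p)"
  using finite_subset[OF S finite_Basis] S
proof (induction S arbitrary: x)
  case empty
  then show ?case by (simp add: marg_empty)
next
  case (insert b S)
  let ?P = "\<lambda>x. \<Prod>c\<in>Basis. epow (marg {c} f x) p"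
  have p0: "0 < p" using N p by simp
  have [measurable]: "?P \<in> borel_measurable borel" "finite S" by (auto intro: insert)
  let ?J = "Basis - insert b S"
  have bJ: "Basis - S = insert b ?J" using insert.prems insert.hyps by auto
  \<comment> \<open>The factor of index \<open>b\<close> does not depend on \<open>t\<close> and
    leaves the integral as \<open>epow ?X p\<close>. The index \<open>b\<close> thus becomes free
    and is given to \<open>marg S f\<close>, so that Hoelder's inequality sees one family over
    \<open>Basis - S\<close>.\<close>
  define F where "F c y = (if c = b then marg S f y else marg (insert c S) f y)" for c y
  define w where "w c = (if c = b then real (card S) * p else p)" for c
  let ?X = "marg (insert b S) f x"
  have Fm[measurable]: "F c \<in> borel_measurable borel" for c
    unfolding F_def using insert.hyps by (cases "c = b") auto
  have "marg (insert b S) ?P x = (\<integral>\<^sup>+t. marg S ?P (x + t *\<^sub>R b) \<partial>lborel)"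
    using insert by (intro marg_insert) auto
  also have "\<dots> \<le> (\<integral>\<^sup>+t. epow (marg S f (x + t *\<^sub>R b)) (real (card S) * p) *
      (\<Prod>c\<in>Basis - S. epow (marg (insert c S) f (x + t *\<^sub>R b)) p) \<partial>lborel)"
    using insert.prems by (intro nn_integral_mono insert.IH) auto
  also have "\<dots> = (\<integral>\<^sup>+t. epow ?X p * (\<Prod>c\<in>Basis - S. epow (F c (x + t *\<^sub>R b)) (w c)) \<partial>lborel)"
  proof (rule nn_integral_cong)
    fix t
    have 1: "(\<Prod>c\<in>Basis - S. epow (marg (insert c S) f (x + t *\<^sub>R b)) p) =
        epow ?X p * (\<Prod>c\<in>?J. epow (marg (insert c S) f (x + t *\<^sub>R b)) p)"
      unfolding bJ using insert.hyps by (simp add: marg_translate)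
    have "(\<Prod>c\<in>?J. epow (marg (insert c S) f (x + t *\<^sub>R b)) p) = (\<Prod>c\<in>?J. epow (F c (x + t *\<^sub>R b)) (w c))"
      by (intro prod.cong) (auto simp: F_def w_def)
    then have 2: "(\<Prod>c\<in>Basis - S. epow (F c (x + t *\<^sub>R b)) (w c)) =
        epow (marg S f (x + t *\<^sub>R b)) (real (card S) * p) *
        (\<Prod>c\<in>?J. epow (marg (insert c S) f (x + t *\<^sub>R b)) p)"
      unfolding bJ by (simp add: F_def w_def)
    show "epow (marg S f (x + t *\<^sub>R b)) (real (card S) * p) *
      (\<Prod>c\<in>Basis - S. epow (marg (insert c S) f (x + t *\<^sub>R b)) p) =
      epow ?X p * (\<Prod>c\<in>Basis - S. epow (F c (x + t *\<^sub>R b)) (w c))"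
      unfolding 1 2 by (simp add: mult_ac)
  qed
  also have "\<dots> = epow ?X p * (\<integral>\<^sup>+t. (\<Prod>c\<in>Basis - S. epow (F c (x + t *\<^sub>R b)) (w c)) \<partial>lborel)"
    by (rule nn_integral_cmult) measurable
  also have "(\<integral>\<^sup>+t. (\<Prod>c\<in>Basis - S. epow (F c (x + t *\<^sub>R b)) (w c)) \<partial>lborel)
      \<le> (\<Prod>c\<in>Basis - S. epow (\<integral>\<^sup>+t. F c (x + t *\<^sub>R b) \<partial>lborel) (w c))"
  proof (rule nn_integral_Hoelder_prod)
    \<comment> \<open>The exponents are \<open>card S * p\<close> for \<open>b\<close> and
      \<open>p\<close> for each of the \<open>DIM('a) - 1 - card S\<close> other coordinates, in
      total \<open>(DIM('a) - 1) * p = 1\<close>.\<close>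
    have "(\<Sum>c\<in>Basis - S. w c) = real (card S) * p + (\<Sum>c\<in>?J. p)"
      unfolding bJ by (subst sum.insert) (auto simp: w_def intro!: sum.cong)
    also have "(\<Sum>c\<in>?J. p) = real (card ?J) * p" by simp
    also have "card ?J = DIM('a) - Suc (card S)"
      using insert by (subst card_Diff_subset) auto
    also have "real (DIM('a) - Suc (card S)) = real DIM('a) - 1 - real (card S)"
    proof -
      have "card (insert b S) \<le> DIM('a)" using insert.prems by (intro card_mono) auto
      then show ?thesis using insert.hyps by simp
    qed
    also have "real (card S) * p + (real DIM('a) - 1 - real (card S)) * p = (real DIM('a) - 1) * p"
      by (simp add: algebra_simps)
    also have "\<dots> = 1" using N by (simp add: p)
    finally show "(\<Sum>c\<in>Basis - S. w c) = 1" .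
  qed (use p0 in \<open>auto simp: w_def\<close>)
  also have "(\<Prod>c\<in>Basis - S. epow (\<integral>\<^sup>+t. F c (x + t *\<^sub>R b) \<partial>lborel) (w c)) =
      epow ?X (real (card S) * p) * (\<Prod>c\<in>?J. epow (marg (insert c (insert b S)) f x) p)"
  proof -
    have "(\<Prod>c\<in>?J. epow (\<integral>\<^sup>+t. F c (x + t *\<^sub>R b) \<partial>lborel) (w c)) =
        (\<Prod>c\<in>?J. epow (marg (insert c (insert b S)) f x) p)"
    proof (rule prod.cong)
      fix c assume c: "c \<in> ?J"
      then have "marg (insert b (insert c S)) f x = (\<integral>\<^sup>+t. F c (x + t *\<^sub>R b) \<partial>lborel)"
        using insert.hyps by (subst marg_insert) (auto simp: F_def)
      then show "epow (\<integral>\<^sup>+t. F c (x + t *\<^sub>R b) \<partial>lborel) (w c) = epow (marg (insert c (insert b S)) f x) p"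
        using c by (auto simp: w_def insert_commute)
    qed simp
    moreover have "?X = (\<integral>\<^sup>+t. F b (x + t *\<^sub>R b) \<partial>lborel)"
      using insert.hyps by (subst marg_insert) (auto simp: F_def)
    ultimately show ?thesis unfolding bJ by (simp add: w_def)
  qed
  also have "epow ?X p * (epow ?X (real (card S) * p) * (\<Prod>c\<in>?J. epow (marg (insert c (insert b S)) f x) p))
     = epow ?X (real (card (insert b S)) * p) * (\<Prod>c\<in>?J. epow (marg (insert c (insert b S)) f x) p)"
  proof -
    have "epow ?X (real (card (insert b S)) * p) = epow ?X (p + real (card S) * p)"
      using insert.hyps by (simp add: algebra_simps)
    also have "\<dots> = epow ?X p * epow ?X (real (card S) * p)"
      using p0 by (intro epow_add) auto
    finally show ?thesis by (simp add: mult_ac)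
  qed
  finally show ?case by (simp add: mult_left_mono)
qed

text \<open>The case \<open>S = Basis\<close> of \<open>gagliardo_step\<close>: no factor is left in
  the product, and both sides are constant in the base point, here taken to be 0.\<close>

lemma gagliardo:
  fixes f :: "'a::euclidean_space \<Rightarrow> ennreal"
  assumes f[measurable]: "f \<in> borel_measurable borel" and N: "2 \<le> DIM('a)"
  shows "(\<integral>\<^sup>+x. (\<Prod>c\<in>Basis. epow (\<integral>\<^sup>+t. f (x + t *\<^sub>R c) \<partial>lborel) (1 / (real DIM('a) - 1))) \<partial>lborel)
    \<le> epow (\<integral>\<^sup>+x. f x \<partial>lborel) (real DIM('a) / (real DIM('a) - 1))"
proof -
  have "marg {c} f x = (\<integral>\<^sup>+t. f (x + t *\<^sub>R c) \<partial>lborel)" for c x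
    by (subst marg_insert) (auto simp: marg_empty)
  moreover have "marg Basis (\<lambda>x. \<Prod>c\<in>Basis. epow (marg {c} f x) (1 / (real DIM('a) - 1))) 0 =
    (\<integral>\<^sup>+x. (\<Prod>c\<in>Basis. epow (marg {c} f x) (1 / (real DIM('a) - 1))) \<partial>lborel)"
    by (intro marg_Basis) measurable
  ultimately show ?thesis
    using gagliardo_step[OF f N refl order.refl, of 0] by (simp add: marg_Basis)
qed

section \<open>The Sobolev inequality for C^1 functions of compact support\<close>

lemma abs_powr_has_derivative:
  fixes s g :: real
  assumes "1 < g"
  shows "((\<lambda>s. \<bar>s\<bar> powr g) has_real_derivative g * \<bar>s\<bar> powr (g - 1) * sgn s) (at s)"
proof -
  consider "s < 0" | "s = 0" | "s > 0" by linarith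
  then show ?thesis
  proof cases
    case 1
    then have "((\<lambda>s. (- s) powr g) has_real_derivative g * \<bar>s\<bar> powr (g - 1) * sgn s) (at s)"
      by (auto intro!: derivative_eq_intros)
    then show ?thesis
      by (rule has_field_derivative_transform_within_open[where S="{..<0}"]) (use 1 in auto)
  next
    case 2
    have "((\<lambda>h::real. \<bar>h\<bar> powr (g - 1)) \<longlongrightarrow> \<bar>0\<bar> powr (g - 1)) (at 0)"
      using assms by (intro tendsto_powr' tendsto_intros) auto
    then have "((\<lambda>h::real. \<bar>h\<bar> powr (g - 1)) \<longlongrightarrow> 0) (at 0)" using assms by simp
    then have "((\<lambda>h::real. \<bar>h\<bar> powr (g - 1) * sgn h) \<longlongrightarrow> 0) (at 0)"
      by (rule Lim_null_comparison[rotated]) (auto simp: abs_mult sgn_if)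
    moreover have "\<bar>h\<bar> powr (g - 1) * sgn h = (\<bar>h\<bar> powr g - \<bar>0\<bar> powr g) / (h - 0)" if "h \<noteq> 0" for h :: real
      using that by (auto simp: powr_diff sgn_if field_simps)
    ultimately have "((\<lambda>h::real. (\<bar>h\<bar> powr g - \<bar>0\<bar> powr g) / (h - 0)) \<longlongrightarrow> 0) (at 0)"
      by (metis (no_types, lifting) Lim_cong_within)
    then show ?thesis using 2 by (simp add: has_field_derivative_iff)
  next
    case 3
    then have "((\<lambda>s. s powr g) has_real_derivative g * \<bar>s\<bar> powr (g - 1) * sgn s) (at s)"
      by (auto intro!: derivative_eq_intros)
    then show ?thesis
      by (rule has_field_derivative_transform_within_open[where S="{0<..}"]) (use 3 in auto)
  qed
qed

lemma continuous_abs_powr_sgn: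
  assumes "1 < g"
  shows "continuous_on UNIV (\<lambda>s::real. \<bar>s\<bar> powr (g - 1) * sgn s)"
proof -
  have "isCont (\<lambda>s::real. \<bar>s\<bar> powr (g - 1) * sgn s) s" for s
  proof (cases "s = 0")
    case True
    have "((\<lambda>h::real. \<bar>h\<bar> powr (g - 1)) \<longlongrightarrow> \<bar>0\<bar> powr (g - 1)) (at 0)"
      using assms by (intro tendsto_powr' tendsto_intros) auto
    then have "((\<lambda>h::real. \<bar>h\<bar> powr (g - 1)) \<longlongrightarrow> 0) (at 0)" using assms by simp
    then have "((\<lambda>h::real. \<bar>h\<bar> powr (g - 1) * sgn h) \<longlongrightarrow> 0) (at 0)"
      by (rule Lim_null_comparison[rotated]) (auto simp: abs_mult sgn_if)
    then show ?thesis using True by (simp add: isCont_def)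
  next
    case False
    then show ?thesis by (intro continuous_intros) auto
  qed
  then show ?thesis by (simp add: continuous_at_imp_continuous_on)
qed

text \<open>Fundamental theorem of calculus for \<open>\<bar>v\<bar> powr g\<close> on the line
  through \<open>x\<close> in direction \<open>b\<close>, started at a point outside the support;
  the integral is then enlarged to the whole line.\<close>

lemma line_bound:
  fixes v :: "'a::euclidean_space \<Rightarrow> real"
  assumes v: "C1_grad v v'" and supp: "\<And>x. norm x > R \<Longrightarrow> v x = 0"
    and g: "1 < g" and b: "b \<in> Basis"
  shows "ennreal (\<bar>v x\<bar> powr g)
    \<le> (\<integral>\<^sup>+t. ennreal (g * \<bar>v (x + t *\<^sub>R b)\<bar> powr (g - 1) * norm (v' (x + t *\<^sub>R b))) \<partial>lborel)"
proof -
  \<comment> \<open>At parameter \<open>- T\<close> the point has norm at least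
    \<open>T - norm x = \<bar>R\<bar> + 1\<close>, which exceeds \<open>R\<close> also when
    \<open>R\<close> is negative.\<close>
  define T where "T = norm x + \<bar>R\<bar> + 1"
  define w where "w t = \<bar>v (x + t *\<^sub>R b)\<bar> powr g" for t
  define w' where "w' t = g * (\<bar>v (x + t *\<^sub>R b)\<bar> powr (g - 1) * sgn (v (x + t *\<^sub>R b))) * (v' (x + t *\<^sub>R b) \<bullet> b)" for t
  have T: "0 \<le> T" by (simp add: T_def)
  have dv: "((\<lambda>t. v (x + t *\<^sub>R b)) has_real_derivative v' (x + t *\<^sub>R b) \<bullet> b) (at t)" for t
  proof -
    have "((\<lambda>t. v (x + t *\<^sub>R b)) has_derivative (\<lambda>h. v' (x + t *\<^sub>R b) \<bullet> (h *\<^sub>R b))) (at t)"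
      by (rule has_derivative_compose[where f="\<lambda>t. x + t *\<^sub>R b" and g=v])
         (auto intro!: derivative_eq_intros C1_grad_D(2)[OF v])
    then show ?thesis by (simp add: has_field_derivative_def mult_commute_abs)
  qed
  have dw: "(w has_real_derivative w' t) (at t)" for t
    using DERIV_chain2[OF abs_powr_has_derivative[OF g] dv, of t]
    by (simp add: w_def[abs_def] w'_def mult.assoc)
  have cw': "continuous_on UNIV w'"
    unfolding w'_def
    by (intro continuous_intros continuous_on_compose2[OF continuous_abs_powr_sgn[OF g]]
        continuous_on_compose2[OF C1_grad_D(1)[OF v]] continuous_on_compose2[OF C1_grad_D(3)[OF v]]) auto
  have nb: "norm b = 1" using b by simp
  have "norm (x + (- T) *\<^sub>R b) \<ge> norm ((- T) *\<^sub>R b) - norm x"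
    using norm_triangle_ineq4[of "x + (- T) *\<^sub>R b" x] by (simp add: norm_minus_commute)
  then have "norm (x + (- T) *\<^sub>R b) > R" using T nb by (simp add: T_def)
  then have w0: "w (- T) = 0" using supp by (simp add: w_def)
  have "has_bochner_integral lborel (\<lambda>t. w' t * indicator {- T..0} t) (w 0 - w (- T))"
    using T by (intro has_bochner_integral_FTC_Icc_real dw)
      (auto intro!: continuous_on_interior[THEN continuous_at_imp_continuous_at_within] cw' simp: cw'[unfolded continuous_on_eq_continuous_at[OF open_UNIV]])
  then have I: "integrable lborel (\<lambda>t. w' t * indicator {- T..0} t)"
    "(\<integral>t. w' t * indicator {- T..0} t \<partial>lborel) = w 0"
    using w0 by (auto simp: has_bochner_integral_iff)
  have "ennreal (w 0) \<le> ennreal (norm (\<integral>t. w' t * indicator {- T..0} t \<partial>lborel))"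
    unfolding I(2) by (simp add: ennreal_leI)
  also have "\<dots> \<le> (\<integral>\<^sup>+t. ennreal (norm (w' t * indicator {- T..0} t)) \<partial>lborel)"
    by (rule integral_norm_bound_ennreal[OF I(1)])
  also have "\<dots> \<le> (\<integral>\<^sup>+t. ennreal (g * \<bar>v (x + t *\<^sub>R b)\<bar> powr (g - 1) * norm (v' (x + t *\<^sub>R b))) \<partial>lborel)"
  proof (intro nn_integral_mono ennreal_leI)
    fix t
    have "\<bar>v' (x + t *\<^sub>R b) \<bullet> b\<bar> \<le> norm (v' (x + t *\<^sub>R b))"
      using Cauchy_Schwarz_ineq2[of "v' (x + t *\<^sub>R b)" b] nb by simp
    moreover have "\<bar>sgn (v (x + t *\<^sub>R b))\<bar> \<le> 1" by (simp add: sgn_if)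
    ultimately have "\<bar>w' t\<bar> \<le> g * (\<bar>v (x + t *\<^sub>R b)\<bar> powr (g - 1) * 1) * norm (v' (x + t *\<^sub>R b))"
      unfolding w'_def abs_mult using g by (intro mult_mono) (auto intro!: mult_nonneg_nonneg)
    then show "norm (w' t * indicator {- T..0} t) \<le> g * \<bar>v (x + t *\<^sub>R b)\<bar> powr (g - 1) * norm (v' (x + t *\<^sub>R b))"
      using g by (auto simp: indicator_def)
  qed
  finally show ?thesis by (simp add: w_def)
qed

text \<open>Gagliardo's inequality with the bound of \<open>line_bound\<close> for
  \<open>\<bar>v\<bar> powr g\<close>. Exactly for \<open>g = p (n - 1) / (n - p)\<close> the power
  on the left, \<open>g n / (n - 1)\<close>, agrees with the power
  \<open>(g - 1) p / (p - 1)\<close> that Hoelder's inequality produces; the common value is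
  \<open>q\<close>.\<close>

lemma sobolev_C1:
  fixes v :: "'a::euclidean_space \<Rightarrow> real"
  assumes v: "C1_grad v v'" and supp: "\<And>x. norm x > R \<Longrightarrow> v x = 0"
    and p: "1 < p" "p < real DIM('a)" and N: "2 \<le> DIM('a)"
  shows "epow (\<integral>\<^sup>+x. ennreal (\<bar>v x\<bar> powr (real DIM('a) * p / (real DIM('a) - p))) \<partial>lborel) (1 - p / real DIM('a))
    \<le> ennreal ((p * (real DIM('a) - 1) / (real DIM('a) - p)) powr p) * (\<integral>\<^sup>+x. ennreal (norm (v' x) powr p) \<partial>lborel)"
proof -
  define n where "n = real DIM('a)"
  define q where "q = n * p / (n - p)"
  define g where "g = p * (n - 1) / (n - p)"
  have n: "2 \<le> n" "p < n" using N p by (auto simp: n_def)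
  have g1: "1 < g"
  proof -
    have "n * 1 < n * p" using n p by (intro mult_strict_left_mono) auto
    then show ?thesis using n by (simp add: g_def field_simps)
  qed
  have gq: "g * (n / (n - 1)) = q" using n by (simp add: g_def q_def)
  have gq': "g - 1 = q * (1 - 1 / p)" using n p by (simp add: g_def q_def field_simps)
  have q0: "0 < q" using n p by (simp add: q_def)
  note [measurable] = borel_measurable_continuous_onI[OF C1_grad_D(1)[OF v]]
    borel_measurable_continuous_onI[OF C1_grad_D(3)[OF v]]
  define X where "X = (\<integral>\<^sup>+x. ennreal (\<bar>v x\<bar> powr q) \<partial>lborel)"
  define Y where "Y = (\<integral>\<^sup>+x. ennreal (norm (v' x) powr p) \<partial>lborel)"
  define f where "f y = ennreal (g * \<bar>v y\<bar> powr (g - 1) * norm (v' y))" for y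
  have [measurable]: "f \<in> borel_measurable borel" unfolding f_def by measurable
  have "X = (\<integral>\<^sup>+x. (\<Prod>b\<in>(Basis::'a set). epow (ennreal (\<bar>v x\<bar> powr g)) (1 / (n - 1))) \<partial>lborel)"
    unfolding X_def
  proof (rule nn_integral_cong)
    fix x
    have "(\<Prod>b\<in>(Basis::'a set). epow (ennreal (\<bar>v x\<bar> powr g)) (1 / (n - 1)))
        = epow (ennreal (\<bar>v x\<bar> powr g)) (n / (n - 1))"
      using n by (simp add: epow_power n_def)
    also have "\<dots> = ennreal (\<bar>v x\<bar> powr q)"
      using n by (simp add: epow_ennreal powr_powr flip: gq)
    finally show "ennreal (\<bar>v x\<bar> powr q) = (\<Prod>b\<in>(Basis::'a set). epow (ennreal (\<bar>v x\<bar> powr g)) (1 / (n - 1)))"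
      by simp
  qed
  also have "\<dots> \<le> (\<integral>\<^sup>+x. (\<Prod>b\<in>Basis. epow (\<integral>\<^sup>+t. f (x + t *\<^sub>R b) \<partial>lborel) (1 / (n - 1))) \<partial>lborel)"
    unfolding f_def using n
    by (intro nn_integral_mono prod_mono_ennreal epow_mono line_bound[OF v supp g1]) auto
  also have "\<dots> \<le> epow (\<integral>\<^sup>+x. f x \<partial>lborel) (n / (n - 1))"
    unfolding n_def by (rule gagliardo[OF _ N]) measurable
  finally have 1: "X \<le> epow (\<integral>\<^sup>+x. f x \<partial>lborel) (n / (n - 1))" .
  have "(\<integral>\<^sup>+x. f x \<partial>lborel) = (\<integral>\<^sup>+x. ennreal g * (epow (ennreal (\<bar>v x\<bar> powr q)) (1 - 1 / p) *
      epow (ennreal (norm (v' x) powr p)) (1 / p)) \<partial>lborel)"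
  proof (rule nn_integral_cong)
    fix x
    have "epow (ennreal (\<bar>v x\<bar> powr q)) (1 - 1 / p) = ennreal (\<bar>v x\<bar> powr (g - 1))"
      using p by (simp add: epow_ennreal powr_powr gq')
    moreover have "epow (ennreal (norm (v' x) powr p)) (1 / p) = ennreal (norm (v' x))"
      using p by (simp add: epow_ennreal powr_powr)
    ultimately show "f x = ennreal g * (epow (ennreal (\<bar>v x\<bar> powr q)) (1 - 1 / p) *
      epow (ennreal (norm (v' x) powr p)) (1 / p))"
      using g1 by (simp add: f_def ennreal_mult mult.assoc)
  qed
  also have "\<dots> = ennreal g * (\<integral>\<^sup>+x. epow (ennreal (\<bar>v x\<bar> powr q)) (1 - 1 / p) *
      epow (ennreal (norm (v' x) powr p)) (1 / p) \<partial>lborel)"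
    by (rule nn_integral_cmult) measurable
  also have "\<dots> \<le> ennreal g * (epow X (1 - 1 / p) * epow Y (1 / p))"
    unfolding X_def Y_def using p by (intro mult_left_mono nn_integral_Hoelder) (auto simp: field_simps)
  finally have "epow (\<integral>\<^sup>+x. f x \<partial>lborel) (n / (n - 1)) \<le> epow (ennreal g * (epow X (1 - 1 / p) * epow Y (1 / p))) (n / (n - 1))"
    using n by (intro epow_mono) auto
  with 1 have 2: "X \<le> epow (ennreal g * (epow X (1 - 1 / p) * epow Y (1 / p))) (n / (n - 1))"
    by (rule order.trans)
  \<comment> \<open>In the inequality just obtained \<open>X\<close> stands on both sides and is to
    be absorbed by a division. This needs \<open>X\<close> finite, which the compact support
    provides.\<close>
  have Xfin: "X < top"
  proof -
    have "integrable lborel (\<lambda>x. indicator (cball 0 R) x *\<^sub>R (\<bar>v x\<bar> powr q))"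
      using q0 by (intro borel_integrable_compact continuous_on_powr' continuous_intros
          continuous_on_subset[OF C1_grad_D(3)[OF v]]) auto
    also have "(\<lambda>x. indicator (cball 0 R) x *\<^sub>R (\<bar>v x\<bar> powr q)) = (\<lambda>x. \<bar>v x\<bar> powr q)"
      using supp by (auto simp: indicator_def fun_eq_iff not_le)
    finally show ?thesis
      unfolding X_def by (simp add: integrable_iff_bounded)
  qed
  have "epow X (1 - p / n) \<le> ennreal (g powr p) * Y"
  proof (cases "Y = top")
    case True
    have "ennreal (g powr p) * Y = top" using True g1 by (simp add: ennreal_mult_top)
    then show ?thesis by simp
  next
    case False
    define x where "x = enn2real X"
    define y where "y = enn2real Y"
    have X: "X = ennreal x" and Y: "Y = ennreal y" and xy0: "0 \<le> x" "0 \<le> y"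
      using Xfin False by (auto simp: x_def y_def less_top)
    show ?thesis
    proof (cases "x = 0")
      case True
      then show ?thesis using n by (simp add: X epow_zero)
    next
      case False
      then have x: "0 < x" using xy0 by simp
      have e0: "1 - 1 / p \<noteq> 0" "1 / p \<noteq> 0" "n / (n - 1) \<noteq> 0" using p n by auto
      have "ennreal x \<le> ennreal ((g * (x powr (1 - 1 / p) * y powr (1 / p))) powr (n / (n - 1)))"
        using 2 g1 unfolding X Y
        by (simp add: epow_ennreal[OF xy0(1) e0(1)] epow_ennreal[OF xy0(2) e0(2)] epow_ennreal[OF _ e0(3)]
            flip: ennreal_mult)
      then have "x \<le> (g * (x powr (1 - 1 / p) * y powr (1 / p))) powr (n / (n - 1))"
        by simp
      then have "x powr ((n - 1) / n) \<le> ((g * (x powr (1 - 1 / p) * y powr (1 / p))) powr (n / (n - 1))) powr ((n - 1) / n)"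
        using n x by (intro powr_mono2) auto
      also have "\<dots> = x powr (1 - 1 / p) * (g * y powr (1 / p))"
        using n g1 x by (simp add: powr_powr mult_ac)
      finally have "x powr ((n - 1) / n) / x powr (1 - 1 / p) \<le> g * y powr (1 / p)"
        using x by (simp add: field_simps)
      \<comment> \<open>The difference of the exponents is \<open>1 / p - 1 / n\<close>; raising to
        the power \<open>p\<close> turns it into \<open>1 - p / n\<close>.\<close>
      then have "x powr ((n - 1) / n - (1 - 1 / p)) \<le> g * y powr (1 / p)"
        by (simp add: powr_diff)
      then have "(x powr ((n - 1) / n - (1 - 1 / p))) powr p \<le> (g * y powr (1 / p)) powr p"
        using p by (intro powr_mono2) auto
      moreover have "((n - 1) / n - (1 - 1 / p)) * p = 1 - p / n"
        using n p by (simp add: field_simps)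
      moreover have "(g * y powr (1 / p)) powr p = g powr p * y"
        using p g1 xy0 by (simp add: powr_mult powr_powr)
      ultimately have "x powr (1 - p / n) \<le> g powr p * y"
        by (simp add: powr_powr)
      moreover have "1 - p / n \<noteq> 0" using n by simp
      ultimately show ?thesis
        unfolding X Y using xy0 by (simp add: epow_ennreal flip: ennreal_mult)
    qed
  qed
  then show ?thesis by (simp add: X_def Y_def q_def g_def n_def)
qed

section \<open>Convolution\<close>

text \<open>The scalar factor comes first. The mollification of a vector field \<open>G\<close> is
  therefore \<open>conv k G\<close>, whereas differentiation under the integral gives
  \<open>conv f (grad k)\<close>, with the kernel second; for scalar functions
  \<open>conv_commute\<close> exchanges the two forms.\<close>

definition conv :: "('a::euclidean_space \<Rightarrow> real) \<Rightarrow> ('a \<Rightarrow> 'b::euclidean_space) \<Rightarrow> 'a \<Rightarrow> 'b" where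
  "conv f g x = (\<integral>y. f y *\<^sub>R g (x - y) \<partial>lborel)"

lemma lborel_distr_reflect: "distr lborel borel (\<lambda>y::'a::euclidean_space. x - y) = lborel"
  using lborel_affine[of "-1::real" x] by (simp add: density_1)

lemma nn_integral_shift:
  fixes f :: "'a::euclidean_space \<Rightarrow> ennreal"
  assumes [measurable]: "f \<in> borel_measurable borel"
  shows "(\<integral>\<^sup>+y. f (y - x) \<partial>lborel) = (\<integral>\<^sup>+y. f y \<partial>lborel)"
proof -
  have "(\<integral>\<^sup>+y. f (y - x) \<partial>lborel) = (\<integral>\<^sup>+y. f (- x + y) \<partial>lborel)" by simp
  also have "\<dots> = (\<integral>\<^sup>+y. f y \<partial>distr lborel borel ((+) (- x)))"
    by (subst nn_integral_distr) auto
  finally show ?thesis by (simp only: lborel_distr_plus)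
qed

lemma integral_reflect:
  fixes f :: "'a::euclidean_space \<Rightarrow> 'b::euclidean_space"
  assumes [measurable]: "f \<in> borel_measurable borel"
  shows "(\<integral>y. f (x - y) \<partial>lborel) = (\<integral>y. f y \<partial>lborel)"
  by (subst (2) lborel_distr_reflect[of x, symmetric]) (simp add: integral_distr)

lemma conv_commute:
  fixes f g :: "'a::euclidean_space \<Rightarrow> real"
  assumes [measurable]: "f \<in> borel_measurable borel" "g \<in> borel_measurable borel"
  shows "conv f g = conv g f"
proof
  fix x
  show "conv f g x = conv g f x"
    unfolding conv_def
    using integral_reflect[of "\<lambda>y. f (x - y) *\<^sub>R g y" x] by (simp add: mult.commute)
qed

text \<open>Of two points at distance below 1, either both lie in the ball of radius
  \<open>R + 1\<close>, or both lie outside the ball of radius \<open>R\<close>, where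
  \<open>k\<close> is zero. Uniform continuity on the compact ball thus extends to the whole
  space.\<close>

lemma compact_support_uniform:
  fixes k :: "'a::euclidean_space \<Rightarrow> 'b::euclidean_space"
  assumes k: "continuous_on UNIV k" and supp: "\<And>x. norm x > R \<Longrightarrow> k x = 0" and e: "e > 0"
  obtains d where "d > 0" "\<And>x y. dist x y < d \<Longrightarrow> dist (k x) (k y) < e"
proof -
  have "uniformly_continuous_on (cball 0 (R + 1)) k"
    using k by (intro compact_uniformly_continuous) (auto intro: continuous_on_subset)
  then obtain d where d: "d > 0"
    "\<And>x y. x \<in> cball 0 (R + 1) \<Longrightarrow> y \<in> cball 0 (R + 1) \<Longrightarrow> dist x y < d \<Longrightarrow> dist (k x) (k y) < e"
    using e unfolding uniformly_continuous_on_def by (metis dist_commute)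
  show ?thesis
  proof (rule that[of "min d 1"])
    fix x y :: 'a assume xy: "dist x y < min d 1"
    show "dist (k x) (k y) < e"
    proof (cases "norm x \<le> R \<or> norm y \<le> R")
      case True
      have "norm x \<le> norm y + dist x y" "norm y \<le> norm x + dist x y"
        by (metis dist_norm norm_triangle_sub, metis dist_commute dist_norm norm_triangle_sub)
      then show ?thesis using True xy by (intro d) auto
    next
      case False
      then show ?thesis using supp[of x] supp[of y] e by simp
    qed
  qed (use d in auto)
qed

lemma compact_support_bounded:
  fixes k :: "'a::euclidean_space \<Rightarrow> 'b::euclidean_space"
  assumes k: "continuous_on UNIV k" and supp: "\<And>x. norm x > R \<Longrightarrow> k x = 0"
  obtains B where "B > 0" "\<And>x. norm (k x) \<le> B"
proof -
  have "bounded (k ` cball 0 R)"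
    using k by (intro compact_imp_bounded compact_continuous_image) (auto intro: continuous_on_subset)
  then obtain B where B: "B > 0" "\<And>x. x \<in> cball 0 R \<Longrightarrow> norm (k x) \<le> B"
    unfolding bounded_pos by auto
  show ?thesis
  proof (rule that[OF B(1)])
    fix x show "norm (k x) \<le> B" using B supp[of x] by (cases "norm x \<le> R") auto
  qed
qed

lemma compact_support_integrable:
  fixes k :: "'a::euclidean_space \<Rightarrow> 'b::euclidean_space"
  assumes k: "continuous_on UNIV k" and supp: "\<And>x. norm x > R \<Longrightarrow> k x = 0"
  shows "integrable lborel k"
proof -
  have "integrable lborel (\<lambda>x. indicator (cball 0 R) x *\<^sub>R k x)"
    by (rule borel_integrable_compact) (use k in \<open>auto intro: continuous_on_subset\<close>)
  also have "(\<lambda>x. indicator (cball 0 R) x *\<^sub>R k x) = k"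
    using supp by (auto simp: indicator_def fun_eq_iff not_le)
  finally show ?thesis .
qed

lemma integrable_conv:
  fixes k :: "'a::euclidean_space \<Rightarrow> 'b::euclidean_space"
  assumes f: "integrable lborel f" and k: "continuous_on UNIV k" and supp: "\<And>x. norm x > R \<Longrightarrow> k x = 0"
  shows "integrable lborel (\<lambda>y. f y *\<^sub>R k (x - y))"
proof -
  obtain B where B: "B > 0" "\<And>x. norm (k x) \<le> B" using compact_support_bounded[OF k, of R] supp by auto
  have [measurable]: "k \<in> borel_measurable borel" using k by (rule borel_measurable_continuous_onI)
  have [measurable]: "f \<in> borel_measurable borel" using f by simp
  show ?thesis
  proof (rule Bochner_Integration.integrable_bound[where f="\<lambda>y. B * f y"])
    show "AE y in lborel. norm (f y *\<^sub>R k (x - y)) \<le> norm (B * f y)"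
      using B by (auto simp: abs_mult mult.commute[of B] intro!: mult_left_mono)
  qed (use f in auto)
qed

lemma conv_continuous:
  fixes k :: "'a::euclidean_space \<Rightarrow> 'b::euclidean_space"
  assumes f: "integrable lborel f" and k: "continuous_on UNIV k" and supp: "\<And>x. norm x > R \<Longrightarrow> k x = 0"
  shows "continuous_on UNIV (conv f k)"
proof -
  have I: "integrable lborel (\<lambda>y. f y *\<^sub>R k (x - y))" for x
    by (rule integrable_conv[OF f k supp])
  \<comment> \<open>The L^1-norm of \<open>f\<close>, increased by 1 so that \<open>e / A\<close> is
    meaningful also for \<open>f = 0\<close>.\<close>
  define A where "A = (\<integral>y. \<bar>f y\<bar> \<partial>lborel) + 1"
  have A: "A > 0" unfolding A_def by (intro add_nonneg_pos) auto
  have fa: "integrable lborel (\<lambda>y. \<bar>f y\<bar>)" using f by simp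
  show ?thesis
    unfolding continuous_on_iff
  proof (intro ballI allI impI)
    fix x :: 'a and e :: real assume e: "e > 0"
    obtain d where d: "d > 0" "\<And>x y. dist x y < d \<Longrightarrow> dist (k x) (k y) < e / A"
      using compact_support_uniform[OF k, of R "e / A"] supp e A by auto
    show "\<exists>d>0. \<forall>x'\<in>UNIV. dist x' x < d \<longrightarrow> dist (conv f k x') (conv f k x) < e"
    proof (intro exI[of _ d] conjI ballI impI)
      fix x' assume x': "dist x' x < d"
      have "conv f k x' - conv f k x = (\<integral>y. f y *\<^sub>R k (x' - y) - f y *\<^sub>R k (x - y) \<partial>lborel)"
        unfolding conv_def by (intro Bochner_Integration.integral_diff[symmetric] I)
      also have "norm \<dots> \<le> (\<integral>y. (e / A) * \<bar>f y\<bar> \<partial>lborel)"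
      proof (rule Bochner_Integration.integral_norm_bound_integral)
        fix y
        have "dist (x' - y) (x - y) < d" using x' by (simp add: dist_norm)
        from d(2)[OF this] have "norm (k (x' - y) - k (x - y)) \<le> e / A" by (simp add: dist_norm)
        then have "\<bar>f y\<bar> * norm (k (x' - y) - k (x - y)) \<le> \<bar>f y\<bar> * (e / A)"
          by (intro mult_left_mono) auto
        then show "norm (f y *\<^sub>R k (x' - y) - f y *\<^sub>R k (x - y)) \<le> e / A * \<bar>f y\<bar>"
          by (simp add: scaleR_diff_right[symmetric] mult.commute)
      qed (use I fa in auto)
      also have "\<dots> = e * ((A - 1) / A)" by (simp add: A_def)
      also have "\<dots> < e * 1" using A e by (intro mult_strict_left_mono) auto
      finally show "dist (conv f k x') (conv f k x) < e" by (simp add: dist_norm)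
    qed (use d in auto)
  qed
qed

lemma conv_C1:
  fixes k :: "'a::euclidean_space \<Rightarrow> real"
  assumes f: "integrable lborel f" and k: "C1_grad k k'" and supp: "\<And>x. norm x > R \<Longrightarrow> k x = 0"
    and supp': "\<And>x. norm x > R \<Longrightarrow> k' x = 0"
  shows "C1_grad (conv f k) (conv f k')"
proof -
  have I: "integrable lborel (\<lambda>y. f y *\<^sub>R k (x - y))" for x
    by (rule integrable_conv[OF f C1_grad_D(3)[OF k] supp])
  have I': "integrable lborel (\<lambda>y. f y *\<^sub>R k' (x - y))" for x
    by (rule integrable_conv[OF f C1_grad_D(1)[OF k] supp'])
  define A where "A = (\<integral>y. \<bar>f y\<bar> \<partial>lborel) + 1"
  have A: "A > 0" unfolding A_def by (intro add_nonneg_pos) auto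
  have fa: "integrable lborel (\<lambda>y. \<bar>f y\<bar>)" using f by simp
  have "(conv f k has_derivative (\<lambda>h. conv f k' x \<bullet> h)) (at x)" for x
    unfolding has_derivative_at_alt
  proof (intro conjI allI impI)
    show "bounded_linear (\<lambda>h. conv f k' x \<bullet> h)" by (rule bounded_linear_inner_right)
    fix e :: real assume e: "e > 0"
    obtain d where d: "d > 0" "\<And>x y. dist x y < d \<Longrightarrow> dist (k' x) (k' y) < e / A"
      using compact_support_uniform[OF C1_grad_D(1)[OF k], of R "e / A"] supp' e A by auto
    \<comment> \<open>Mean value estimate for \<open>w \<mapsto> k w - k' z \<bullet> w\<close>,
      whose gradient is at most \<open>e / A\<close> on the ball around \<open>z\<close>. Since
      \<open>d\<close> does not depend on \<open>z\<close>, the estimate can be integrated against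
      \<open>\<bar>f y\<bar>\<close>.\<close>
    have est: "\<bar>k z' - k z - k' z \<bullet> (z' - z)\<bar> \<le> (e / A) * norm (z' - z)" if zz: "dist z' z < d" for z z'
    proof -
      have "norm ((k z' - k' z \<bullet> z') - (k z - k' z \<bullet> z)) \<le> (e / A) * norm (z' - z)"
      proof (rule differentiable_bound[where S="ball z d" and f'="\<lambda>w h. (k' w - k' z) \<bullet> h"])
        fix w assume w: "w \<in> ball z d"
        have "((\<lambda>w. k w - k' z \<bullet> w) has_derivative (\<lambda>h. k' w \<bullet> h - k' z \<bullet> h)) (at w)"
          by (intro has_derivative_diff C1_grad_D(2)[OF k] bounded_linear_imp_has_derivative
              bounded_linear_inner_right)
        then show "((\<lambda>w. k w - k' z \<bullet> w) has_derivative (\<lambda>h. (k' w - k' z) \<bullet> h)) (at w within ball z d)"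
          by (simp add: inner_diff_left has_derivative_at_withinI)
        have "norm (k' w - k' z) \<le> e / A"
          using d(2)[of w z] w by (simp add: dist_norm norm_minus_commute)
        then have "norm ((k' w - k' z) \<bullet> h) \<le> (e / A) * norm h" for h
          using Cauchy_Schwarz_ineq2[of "k' w - k' z" h] mult_right_mono[of "norm (k' w - k' z)" "e / A" "norm h"]
          by (metis norm_ge_zero order_trans real_norm_def)
        then show "onorm (\<lambda>h. (k' w - k' z) \<bullet> h) \<le> e / A"
          using e A by (intro onorm_bound) auto
      qed (use zz d in \<open>auto simp: dist_commute\<close>)
      then show ?thesis by (simp add: inner_diff_right algebra_simps)
    qed
    show "\<exists>d>0. \<forall>x'. norm (x' - x) < d \<longrightarrow>
        norm (conv f k x' - conv f k x - conv f k' x \<bullet> (x' - x)) \<le> e * norm (x' - x)"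
    proof (intro exI[of _ d] conjI allI impI)
      fix x' assume x': "norm (x' - x) < d"
      have J: "integrable lborel (\<lambda>y. (f y *\<^sub>R k' (x - y)) \<bullet> (x' - x))"
        using I'[of x] by (intro integrable_inner_left) auto
      have "conv f k' x \<bullet> (x' - x) = (\<integral>y. (f y *\<^sub>R k' (x - y)) \<bullet> (x' - x) \<partial>lborel)"
        unfolding conv_def by (rule integral_inner_left[symmetric]) (use I' in auto)
      then have "conv f k x' - conv f k x - conv f k' x \<bullet> (x' - x)
          = (\<integral>y. f y *\<^sub>R k (x' - y) - f y *\<^sub>R k (x - y) - (f y *\<^sub>R k' (x - y)) \<bullet> (x' - x) \<partial>lborel)"
        using I[of x] I[of x'] J unfolding conv_def by (simp del: real_scaleR_def inner_scaleR_left)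
      also have "norm \<dots> \<le> (\<integral>y. (e / A * norm (x' - x)) * \<bar>f y\<bar> \<partial>lborel)"
      proof (rule Bochner_Integration.integral_norm_bound_integral)
        fix y
        have "\<bar>k (x' - y) - k (x - y) - k' (x - y) \<bullet> ((x' - y) - (x - y))\<bar> \<le> (e / A) * norm ((x' - y) - (x - y))"
          using x' by (intro est) (simp add: dist_norm)
        then have "\<bar>f y\<bar> * \<bar>k (x' - y) - k (x - y) - k' (x - y) \<bullet> (x' - x)\<bar> \<le> \<bar>f y\<bar> * (e / A * norm (x' - x))"
          by (intro mult_left_mono) auto
        then show "norm (f y *\<^sub>R k (x' - y) - f y *\<^sub>R k (x - y) - (f y *\<^sub>R k' (x - y)) \<bullet> (x' - x))
            \<le> e / A * norm (x' - x) * \<bar>f y\<bar>"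
          by (simp add: abs_mult[symmetric] algebra_simps)
      qed (use I[of x] I[of x'] J fa in \<open>auto simp del: real_scaleR_def inner_scaleR_left\<close>)
      also have "\<dots> = (e * norm (x' - x)) * ((A - 1) / A)" by (simp add: A_def)
      also have "\<dots> \<le> (e * norm (x' - x)) * 1" using A e by (intro mult_left_mono) auto
      finally show "norm (conv f k x' - conv f k x - conv f k' x \<bullet> (x' - x)) \<le> e * norm (x' - x)"
        by simp
    qed (use d in auto)
  qed
  then show ?thesis
    unfolding C1_grad_def using conv_continuous[OF f C1_grad_D(1)[OF k] supp'] by auto
qed

lemma frechet_derivative_support:
  fixes k :: "'a::euclidean_space \<Rightarrow> real"
  assumes supp: "\<And>x. norm x > R \<Longrightarrow> k x = 0" and x: "norm x > R"
  shows "frechet_derivative k (at x) = (\<lambda>h. 0)"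
proof -
  have "(k has_derivative (\<lambda>h. 0)) (at x)"
    by (rule has_derivative_transform_within_open[OF has_derivative_const, where s="- cball 0 R"])
       (use supp x in auto)
  then show ?thesis by (rule frechet_derivative_at[symmetric])
qed

lemma grad_support:
  fixes k :: "'a::euclidean_space \<Rightarrow> real"
  assumes supp: "\<And>x. norm x > R \<Longrightarrow> k x = 0" and x: "norm x > R"
  shows "grad k x = 0"
  using frechet_derivative_support[OF supp x] by (simp add: grad_def)

text \<open>All derivatives fall on the kernel, so integrability of \<open>f\<close> suffices; the
  induction replaces \<open>k\<close> by its partial derivatives, which vanish outside the same
  ball.\<close>

lemma conv_Ck:
  fixes k :: "'a::euclidean_space \<Rightarrow> real"
  assumes f: "integrable lborel f" and k: "\<And>n. Ck n k" and supp: "\<And>x. norm x > R \<Longrightarrow> k x = 0"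
  shows "Ck n (conv f k)"
  using k supp
proof (induction n arbitrary: k)
  case 0
  show ?case using conv_continuous[OF f, of k R] 0(1)[of 0] 0(2) by simp
next
  case (Suc n)
  have C: "C1_grad k (grad k)" using Suc.prems(1) by (intro Ck_C1_grad[of 0]) blast
  have D: "C1_grad (conv f k) (conv f (grad k))"
    by (rule conv_C1[OF f C Suc.prems(2) grad_support[OF Suc.prems(2)]])
  have fd: "frechet_derivative (conv f k) (at x) b = conv f (\<lambda>x. frechet_derivative k (at x) b) x" for x b
  proof -
    have eq: "grad k x \<bullet> b = frechet_derivative k (at x) b" for x
      using frechet_derivative_at[OF C1_grad_D(2)[OF C], of x] by metis
    have "frechet_derivative (conv f k) (at x) b = conv f (grad k) x \<bullet> b"
      using frechet_derivative_at[OF C1_grad_D(2)[OF D], of x] by metis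
    also have "\<dots> = (\<integral>y. (f y *\<^sub>R grad k (x - y)) \<bullet> b \<partial>lborel)"
      unfolding conv_def
      by (rule integral_inner_left[symmetric]) (use integrable_conv[OF f C1_grad_D(1)[OF C] grad_support[OF Suc.prems(2)]] in auto)
    finally show ?thesis by (simp add: conv_def eq)
  qed
  have "Ck n (conv f (\<lambda>x. frechet_derivative k (at x) b))" if b: "b \<in> Basis" for b
  proof (rule Suc.IH)
    show "Ck m (\<lambda>x. frechet_derivative k (at x) b)" for m
      using Suc.prems(1)[of "Suc m"] b by simp
    show "norm x > R \<Longrightarrow> frechet_derivative k (at x) b = 0" for x
      using frechet_derivative_support[of R k x] Suc.prems(2) by simp
  qed
  moreover have "conv f k differentiable at x" for x
    using C1_grad_D(2)[OF D] differentiable_def by blast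
  ultimately show ?case by (simp add: fd)
qed

text \<open>A predicate instead of rescalings of one fixed kernel: the estimates hold for every
  kernel supported in a small ball, and a kernel is chosen once the admissible scale is
  known.\<close>

definition mollifier :: "real \<Rightarrow> ('a::euclidean_space \<Rightarrow> real) \<Rightarrow> bool" where
  "mollifier d k \<longleftrightarrow> (\<forall>n. Ck n k) \<and> (\<forall>x. 0 \<le> k x) \<and> (\<forall>x. norm x \<ge> d \<longrightarrow> k x = 0)
     \<and> integrable lborel k \<and> (\<integral>x. k x \<partial>lborel) = 1"

lemma mollifierD:
  assumes "mollifier d k"
  shows "Ck n k" "0 \<le> k x" "norm x \<ge> d \<Longrightarrow> k x = 0" "norm x > d \<Longrightarrow> k x = 0" "integrable lborel k"
    "(\<integral>x. k x \<partial>lborel) = 1" "continuous_on UNIV k" "k \<in> borel_measurable borel"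
    "(\<integral>\<^sup>+x. ennreal (k x) \<partial>lborel) = 1" "C1_grad k (grad k)" "norm x > d \<Longrightarrow> grad k x = 0"
proof -
  show *: "Ck n k" "0 \<le> k x" "norm x \<ge> d \<Longrightarrow> k x = 0" "norm x > d \<Longrightarrow> k x = 0" "integrable lborel k"
    "(\<integral>x. k x \<partial>lborel) = 1" for n x using assms by (auto simp: mollifier_def)
  show c: "continuous_on UNIV k" using *(1)[of 0] by simp
  show "k \<in> borel_measurable borel" by (rule borel_measurable_continuous_onI[OF c])
  show "(\<integral>\<^sup>+x. ennreal (k x) \<partial>lborel) = 1"
    using * by (subst nn_integral_eq_integral) auto
  show "C1_grad k (grad k)" using *(1) by (intro Ck_C1_grad[of 0])
  show "norm x > d \<Longrightarrow> grad k x = 0" using *(4) by (intro grad_support[of d]) auto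
qed

lemma mollifier_ex:
  assumes "d > 0" obtains k :: "'a::euclidean_space \<Rightarrow> real" where "mollifier d k"
  using mollifier_exists[OF assms] unfolding mollifier_def by metis

section \<open>Approximation, translation and mollification in L^p\<close>

lemma powr_add3_le:
  fixes a b c :: real
  assumes "0 \<le> a" "0 \<le> b" "0 \<le> c" "0 \<le> p"
  shows "(a + b + c) powr p \<le> 3 powr p * (a powr p + b powr p + c powr p)"
proof -
  define m where "m = max a (max b c)"
  have "(a + b + c) powr p \<le> (3 * m) powr p"
    using assms by (intro powr_mono2) (auto simp: m_def)
  also have "\<dots> = 3 powr p * m powr p" using assms by (simp add: powr_mult m_def)
  also have "m powr p \<le> a powr p + b powr p + c powr p"
    by (auto simp: m_def max_def)
  finally show ?thesis by (simp add: mult_left_mono)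
qed

text \<open>Two approximations: \<open>F n\<close> truncates \<open>f\<close> in space and in size;
  then continuous functions converging almost everywhere to \<open>f\<close>, truncated in the same
  way, have a common bounded majorant of compact support, so that dominated convergence applies
  again.\<close>

lemma Lp_dense_continuous:
  fixes f :: "'a::euclidean_space \<Rightarrow> 'b::euclidean_space"
  assumes f[measurable]: "f \<in> borel_measurable borel" and p: "1 \<le> p"
    and fin: "(\<integral>\<^sup>+x. ennreal (norm (f x) powr p) \<partial>lborel) < \<infinity>" and e: "0 < e"
  obtains g R where "continuous_on UNIV g" "\<And>x. norm x > R \<Longrightarrow> g x = 0"
    "(\<integral>\<^sup>+x. ennreal (norm (f x - g x) powr p) \<partial>lborel) \<le> ennreal e"
proof -
  \<comment> \<open>\<open>chi n\<close> is 1 for \<open>norm x \<le> n\<close> and 0 for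
    \<open>norm x \<ge> n + 1\<close>; \<open>clip n\<close> is the radial projection onto the ball
    of radius \<open>Suc n\<close>.\<close>
  define chi :: "nat \<Rightarrow> 'a \<Rightarrow> real" where "chi n x = max 0 (min 1 (real n + 1 - norm x))" for n x
  define clip :: "nat \<Rightarrow> 'b \<Rightarrow> 'b" where "clip n y = (real (Suc n) / max (real (Suc n)) (norm y)) *\<^sub>R y" for n y
  have chi_cont: "continuous_on UNIV (chi n)" for n
    unfolding chi_def by (intro continuous_intros)
  have clip_cont: "continuous_on UNIV (clip n)" for n
    unfolding clip_def by (intro continuous_intros) auto
  note [measurable] = borel_measurable_continuous_onI[OF chi_cont] borel_measurable_continuous_onI[OF clip_cont]
  have chi01: "0 \<le> chi n x" "chi n x \<le> 1" for n x by (auto simp: chi_def)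
  have clipn: "norm (clip n y) \<le> Suc n" for n y
  proof -
    have "real (Suc n) * norm y / max (real (Suc n)) (norm y) \<le> real (Suc n)"
      by (subst pos_divide_le_eq) (auto intro!: mult_left_mono simp del: of_nat_Suc)
    then show ?thesis by (simp add: clip_def del: of_nat_Suc)
  qed
  define F where "F n x = chi n x *\<^sub>R clip n (f x)" for n x
  have Fm[measurable]: "F n \<in> borel_measurable borel" for n unfolding F_def by measurable
  define e' where "e' = e / (2 * 3 powr p)"
  have e': "0 < e'" using e by (simp add: e'_def)
  have "(\<lambda>n. \<integral>\<^sup>+x. ennreal (norm (f x - F n x) powr p) \<partial>lborel) \<longlonglongrightarrow> (\<integral>\<^sup>+(x::'a). 0 \<partial>lborel)"
  proof (rule nn_integral_dominated_convergence[where w="\<lambda>x. ennreal (norm (f x) powr p)"])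
    show "AE x in lborel. ennreal (norm (f x - F j x) powr p) \<le> ennreal (norm (f x) powr p)" for j
    proof (rule AE_I2, rule ennreal_leI, rule powr_mono2)
      fix x
      define s where "s = chi j x * (real (Suc j) / max (real (Suc j)) (norm (f x)))"
      have "0 \<le> s" using chi01[of j x] by (simp add: s_def)
      moreover have "s \<le> 1"
        unfolding s_def using chi01[of j x] by (intro mult_le_one) (auto simp: divide_le_eq)
      moreover have "f x - F j x = (1 - s) *\<^sub>R f x"
        by (simp add: F_def clip_def s_def algebra_simps)
      ultimately show "norm (f x - F j x) \<le> norm (f x)" by (simp add: mult_left_le_one_le)
    qed (use p in auto)
    show "AE x in lborel. (\<lambda>n. ennreal (norm (f x - F n x) powr p)) \<longlonglongrightarrow> 0"
    proof (rule AE_I2)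
      fix x
      obtain n0 :: nat where n0: "norm x + norm (f x) \<le> real n0" using real_arch_simple by blast
      have "F n x = f x" if "n \<ge> n0" for n
      proof -
        have "real n \<ge> norm x + norm (f x)" using n0 that by linarith
        then have "norm x \<le> real n" "norm (f x) \<le> real (Suc n)"
          using norm_ge_zero[of x] norm_ge_zero[of "f x"] by (auto simp del: norm_ge_zero)
        then show ?thesis by (simp add: F_def chi_def clip_def max_absorb1)
      qed
      then have "\<forall>\<^sub>F n in sequentially. ennreal (norm (f x - F n x) powr p) = 0"
        unfolding eventually_sequentially by (intro exI[of _ n0]) simp
      then show "(\<lambda>n. ennreal (norm (f x - F n x) powr p)) \<longlonglongrightarrow> 0"
        by (rule tendsto_eventually)
    qed
  qed (use fin in auto)
  then have "\<forall>\<^sub>F n in sequentially. (\<integral>\<^sup>+x. ennreal (norm (f x - F n x) powr p) \<partial>lborel) < ennreal e'"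
    by (rule order_tendstoD(2)) (use e' in simp)
  then obtain n where n: "(\<integral>\<^sup>+x. ennreal (norm (f x - F n x) powr p) \<partial>lborel) < ennreal e'"
    by (auto simp: eventually_sequentially)
  have "f \<in> borel_measurable lebesgue" by (intro measurable_completion) simp
  \<comment> \<open>This form of measurability is, by definition, the existence of continuous
    functions converging outside a negligible set.\<close>
  then have "f measurable_on UNIV" by (intro lebesgue_measurable_imp_measurable_on) auto
  then obtain N h where N: "negligible N" and h: "\<And>m. continuous_on UNIV (h m)"
    and lim: "\<And>x. x \<notin> N \<Longrightarrow> (\<lambda>m. h m x) \<longlonglongrightarrow> f x"
    unfolding measurable_on_def by auto
  have "AE x in lebesgue. x \<notin> N" using N by (intro AE_not_in) (simp add: negligible_iff_null_sets)
  then have AEN: "AE x in lborel. x \<notin> N" by (simp add: AE_completion_iff)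
  define G where "G m x = chi n x *\<^sub>R clip n (h m x)" for m x
  have Gc: "continuous_on UNIV (G m)" for m
    unfolding G_def by (intro continuous_intros chi_cont continuous_on_compose2[OF clip_cont h]) auto
  have Gm[measurable]: "G m \<in> borel_measurable borel" for m
    by (rule borel_measurable_continuous_onI[OF Gc])
  have "(\<lambda>m. \<integral>\<^sup>+x. ennreal (norm (F n x - G m x) powr p) \<partial>lborel) \<longlonglongrightarrow> (\<integral>\<^sup>+(x::'a). 0 \<partial>lborel)"
  proof (rule nn_integral_dominated_convergence[where
        w="\<lambda>x. ennreal ((2 * real (Suc n)) powr p) * indicator (cball 0 (real n + 1)) x"])
    show "AE x in lborel. ennreal (norm (F n x - G m x) powr p)
        \<le> ennreal ((2 * real (Suc n)) powr p) * indicator (cball 0 (real n + 1)) x" for m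
    proof (rule AE_I2)
      fix x
      show "ennreal (norm (F n x - G m x) powr p)
        \<le> ennreal ((2 * real (Suc n)) powr p) * indicator (cball 0 (real n + 1)) x"
      proof (cases "norm x \<le> real n + 1")
        case True
        have "norm (F n x - G m x) \<le> norm (F n x) + norm (G m x)" by (rule norm_triangle_ineq4)
        also have "\<dots> \<le> 1 * real (Suc n) + 1 * real (Suc n)"
          unfolding F_def G_def norm_scaleR using chi01[of n x]
          by (intro add_mono mult_mono clipn) auto
        finally show ?thesis using True p by (auto intro!: ennreal_leI powr_mono2)
      next
        case False
        then show ?thesis by (simp add: F_def G_def chi_def)
      qed
    qed
    show "AE x in lborel. (\<lambda>m. ennreal (norm (F n x - G m x) powr p)) \<longlonglongrightarrow> 0"
      using AEN
    proof eventually_elim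
      fix x assume "x \<notin> N"
      have "(\<lambda>m. clip n (h m x)) \<longlonglongrightarrow> clip n (f x)"
        using continuous_on_tendsto_compose[OF clip_cont lim[OF \<open>x \<notin> N\<close>]] by simp
      then have "(\<lambda>m. norm (F n x - G m x)) \<longlonglongrightarrow> norm (F n x - F n x)"
        unfolding F_def G_def by (intro tendsto_intros)
      then have "(\<lambda>m. norm (F n x - G m x) powr p) \<longlonglongrightarrow> norm (F n x - F n x) powr p"
        using p by (intro tendsto_powr') auto
      then show "(\<lambda>m. ennreal (norm (F n x - G m x) powr p)) \<longlonglongrightarrow> 0"
        using p by (intro tendsto_ennrealI[where x=0, simplified]) simp
    qed
    show "(\<integral>\<^sup>+(x::'a). ennreal ((2 * real (Suc n)) powr p) * indicator (cball 0 (real n + 1)) x \<partial>lborel) < \<infinity>"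
      using emeasure_lborel_cball_finite[of "0::'a" "real n + 1"]
      by (simp add: nn_integral_cmult_indicator ennreal_mult_less_top less_top)
    show "(\<lambda>x. ennreal (norm (F n x - G m x) powr p)) \<in> borel_measurable lborel" for m
      by measurable
    show "(\<lambda>x::'a. 0::ennreal) \<in> borel_measurable lborel"
      by (rule measurable_const) simp
    show "(\<lambda>x::'a. ennreal ((2 * real (Suc n)) powr p) * indicator (cball 0 (real n + 1)) x) \<in> borel_measurable lborel"
      by (intro borel_measurable_times_ennreal borel_measurable_indicator measurable_const) simp_all
  qed
  then have "\<forall>\<^sub>F m in sequentially. (\<integral>\<^sup>+x. ennreal (norm (F n x - G m x) powr p) \<partial>lborel) < ennreal e'"
    by (rule order_tendstoD(2)) (use e' in simp)
  then obtain m where m: "(\<integral>\<^sup>+x. ennreal (norm (F n x - G m x) powr p) \<partial>lborel) < ennreal e'"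
    by (auto simp: eventually_sequentially)
  show ?thesis
  proof (rule that[OF Gc[of m], of "real n + 1"])
    show "norm x > real n + 1 \<Longrightarrow> G m x = 0" for x by (simp add: G_def chi_def)
    have "(\<integral>\<^sup>+x. ennreal (norm (f x - G m x) powr p) \<partial>lborel)
      \<le> (\<integral>\<^sup>+x. ennreal (3 powr p) * (ennreal (norm (f x - F n x) powr p) + ennreal (norm (F n x - G m x) powr p)) \<partial>lborel)"
    proof (rule nn_integral_mono)
      fix x
      have "norm (f x - G m x) \<le> norm (f x - F n x) + norm (F n x - G m x) + 0"
        using norm_triangle_ineq[of "f x - F n x" "F n x - G m x"] by simp
      then have "norm (f x - G m x) powr p \<le> (norm (f x - F n x) + norm (F n x - G m x) + 0) powr p"
        using p by (intro powr_mono2) auto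
      also have "\<dots> \<le> 3 powr p * (norm (f x - F n x) powr p + norm (F n x - G m x) powr p + 0 powr p)"
        using p by (intro powr_add3_le) auto
      finally have "ennreal (norm (f x - G m x) powr p) \<le>
          ennreal (3 powr p * (norm (f x - F n x) powr p + norm (F n x - G m x) powr p))"
        by (intro ennreal_leI) simp
      then show "ennreal (norm (f x - G m x) powr p) \<le>
          ennreal (3 powr p) * (ennreal (norm (f x - F n x) powr p) + ennreal (norm (F n x - G m x) powr p))"
        by (simp add: ennreal_mult ennreal_plus[symmetric] del: ennreal_plus)
    qed
    also have "\<dots> = ennreal (3 powr p) * ((\<integral>\<^sup>+x. ennreal (norm (f x - F n x) powr p) \<partial>lborel) +
        (\<integral>\<^sup>+x. ennreal (norm (F n x - G m x) powr p) \<partial>lborel))"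
      by (simp add: nn_integral_cmult nn_integral_add)
    also have "\<dots> \<le> ennreal (3 powr p) * (ennreal e' + ennreal e')"
      using n m by (intro mult_left_mono add_mono) auto
    also have "\<dots> = ennreal e"
      using e' by (simp add: ennreal_plus[symmetric] ennreal_mult[symmetric] e'_def del: ennreal_plus)
    finally show "(\<integral>\<^sup>+x. ennreal (norm (f x - G m x) powr p) \<partial>lborel) \<le> ennreal e" .
  qed
qed

lemma powr_norm_add3_le:
  fixes a b c :: "'b::real_normed_vector"
  assumes p: "0 \<le> p"
  shows "ennreal (norm (a + b + c) powr p)
    \<le> ennreal (3 powr p) * (ennreal (norm a powr p) + ennreal (norm b powr p) + ennreal (norm c powr p))"
proof -
  have "norm (a + b + c) \<le> norm a + norm b + norm c"
    by (rule order.trans[OF norm_triangle_ineq add_right_mono[OF norm_triangle_ineq]])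
  then have "norm (a + b + c) powr p \<le> (norm a + norm b + norm c) powr p"
    using p by (intro powr_mono2) auto
  also have "\<dots> \<le> 3 powr p * (norm a powr p + norm b powr p + norm c powr p)"
    using p by (intro powr_add3_le) auto
  finally have "ennreal (norm (a + b + c) powr p) \<le> ennreal (3 powr p * (norm a powr p + norm b powr p + norm c powr p))"
    by (rule ennreal_leI)
  also have "\<dots> = ennreal (3 powr p) * (ennreal (norm a powr p) + ennreal (norm b powr p) + ennreal (norm c powr p))"
    by (simp add: ennreal_mult)
  finally show ?thesis .
qed

text \<open>A continuous \<open>g\<close> of compact support replaces \<open>f\<close> at both
  points, at a cost that translation invariance makes independent of \<open>h\<close>;
  \<open>g\<close> itself is uniformly continuous.\<close>

lemma Lp_translation_continuous:
  fixes f :: "'a::euclidean_space \<Rightarrow> 'b::euclidean_space"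
  assumes f[measurable]: "f \<in> borel_measurable borel" and p: "1 \<le> p"
    and fin: "(\<integral>\<^sup>+x. ennreal (norm (f x) powr p) \<partial>lborel) < \<infinity>" and e: "0 < e"
  obtains d where "0 < d"
    "\<And>h. norm h < d \<Longrightarrow> (\<integral>\<^sup>+x. ennreal (norm (f (x - h) - f x) powr p) \<partial>lborel) \<le> ennreal e"
proof -
  define e' where "e' = e / (3 * 3 powr p)"
  have e': "0 < e'" using e by (simp add: e'_def)
  obtain g R where gc: "continuous_on UNIV g" and gR: "\<And>x. norm x > R \<Longrightarrow> g x = 0"
    and fg: "(\<integral>\<^sup>+x. ennreal (norm (f x - g x) powr p) \<partial>lborel) \<le> ennreal e'"
    by (rule Lp_dense_continuous[OF f p fin e']) blast
  have [measurable]: "g \<in> borel_measurable borel" using gc by (rule borel_measurable_continuous_onI)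
  define V where "V = measure lborel (cball (0::'a) (R + 1)) + 1"
  have V: "0 < V" unfolding V_def by (intro add_nonneg_pos) auto
  have "emeasure lborel (cball (0::'a) (R + 1)) = ennreal (measure lborel (cball (0::'a) (R + 1)))"
    using emeasure_lborel_cball_finite[of "0::'a" "R + 1"] by (intro emeasure_eq_ennreal_measure) auto
  then have eV: "emeasure lborel (cball (0::'a) (R + 1)) \<le> ennreal V"
    by (simp add: V_def ennreal_leI)
  \<comment> \<open>The ball of radius \<open>R + 1\<close> contains the supports of
    \<open>g\<close> and of its translates by less than 1; \<open>s\<close> is chosen so that
    \<open>s powr p\<close> times the volume bound \<open>V\<close> of that ball is
    \<open>e'\<close>.\<close>
  define s where "s = (e' / V) powr (1 / p)"
  have s: "0 < s" "s powr p = e' / V" using e' V p by (auto simp: s_def powr_powr)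
  obtain d where d: "0 < d" "\<And>x y. dist x y < d \<Longrightarrow> dist (g x) (g y) < s"
    using compact_support_uniform[OF gc, of R s] gR s by auto
  show ?thesis
  proof (rule that[of "min d 1"])
    fix h :: 'a assume h: "norm h < min d 1"
    have 1: "(\<integral>\<^sup>+x. ennreal (norm (f (x - h) - g (x - h)) powr p) \<partial>lborel) \<le> ennreal e'"
      using nn_integral_shift[of "\<lambda>x. ennreal (norm (f x - g x) powr p)" h] fg by simp
    have 3: "(\<integral>\<^sup>+x. ennreal (norm (g x - f x) powr p) \<partial>lborel) \<le> ennreal e'"
      using fg by (simp add: norm_minus_commute)
    have "(\<integral>\<^sup>+x. ennreal (norm (g (x - h) - g x) powr p) \<partial>lborel)
        \<le> (\<integral>\<^sup>+(x::'a). ennreal (e' / V) * indicator (cball 0 (R + 1)) x \<partial>lborel)"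
    proof (rule nn_integral_mono)
      fix x
      show "ennreal (norm (g (x - h) - g x) powr p) \<le> ennreal (e' / V) * indicator (cball 0 (R + 1)) x"
      proof (cases "norm x \<le> R + 1")
        case True
        have "norm (g (x - h) - g x) \<le> s"
          using d(2)[of "x - h" x] h by (simp add: dist_norm)
        then have "norm (g (x - h) - g x) powr p \<le> s powr p"
          using p by (intro powr_mono2) auto
        then show ?thesis using True by (simp add: s ennreal_leI)
      next
        case False
        have "norm x \<le> norm (x - h) + norm h" by (metis diff_add_cancel norm_triangle_ineq)
        then show ?thesis using False h gR[of x] gR[of "x - h"] by simp
      qed
    qed
    also have "\<dots> = ennreal (e' / V) * emeasure lborel (cball (0::'a) (R + 1))"
      by (simp add: nn_integral_cmult_indicator)
    also have "\<dots> \<le> ennreal (e' / V) * ennreal V" using eV by (intro mult_left_mono) auto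
    also have "\<dots> = ennreal e'" using V e' by (simp flip: ennreal_mult)
    finally have 2: "(\<integral>\<^sup>+x. ennreal (norm (g (x - h) - g x) powr p) \<partial>lborel) \<le> ennreal e'" .
    have "(\<integral>\<^sup>+x. ennreal (norm (f (x - h) - f x) powr p) \<partial>lborel) \<le>
      (\<integral>\<^sup>+x. ennreal (3 powr p) * (ennreal (norm (f (x - h) - g (x - h)) powr p) +
        ennreal (norm (g (x - h) - g x) powr p) + ennreal (norm (g x - f x) powr p)) \<partial>lborel)"
    proof (rule nn_integral_mono)
      fix x
      show "ennreal (norm (f (x - h) - f x) powr p) \<le> ennreal (3 powr p) * (ennreal (norm (f (x - h) - g (x - h)) powr p) +
        ennreal (norm (g (x - h) - g x) powr p) + ennreal (norm (g x - f x) powr p))"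
        using powr_norm_add3_le[of p "f (x - h) - g (x - h)" "g (x - h) - g x" "g x - f x"] p by simp
    qed
    also have "\<dots> = ennreal (3 powr p) * ((\<integral>\<^sup>+x. ennreal (norm (f (x - h) - g (x - h)) powr p) \<partial>lborel) +
        (\<integral>\<^sup>+x. ennreal (norm (g (x - h) - g x) powr p) \<partial>lborel) + (\<integral>\<^sup>+x. ennreal (norm (g x - f x) powr p) \<partial>lborel))"
      by (simp add: nn_integral_cmult nn_integral_add)
    also have "\<dots> \<le> ennreal (3 powr p) * (ennreal e' + ennreal e' + ennreal e')"
      by (intro mult_left_mono add_mono 1 2 3) auto
    also have "\<dots> = ennreal e"
      using e' by (simp add: ennreal_plus[symmetric] ennreal_mult[symmetric] e'_def del: ennreal_plus)
    finally show "(\<integral>\<^sup>+x. ennreal (norm (f (x - h) - f x) powr p) \<partial>lborel) \<le> ennreal e" .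
  qed (use d in auto)
qed

lemma integrable_mollifier_scaleR:
  fixes f :: "'a::euclidean_space \<Rightarrow> 'b::euclidean_space"
  assumes f: "integrable lborel f" and k: "mollifier d k"
  shows "integrable lborel (\<lambda>y. k y *\<^sub>R f (x - y))"
proof -
  have [measurable]: "f \<in> borel_measurable borel" using f by simp
  note [measurable] = mollifierD(8)[OF k]
  obtain B where B: "B > 0" "\<And>x. norm (k x) \<le> B"
    using compact_support_bounded[OF mollifierD(7)[OF k], of d] mollifierD(4)[OF k] by auto
  have "integrable (distr lborel borel (\<lambda>y. x - y)) f"
    using f by (simp add: lborel_distr_reflect)
  then have "integrable lborel (\<lambda>y. f (x - y))"
    by (subst (asm) integrable_distr_eq) auto
  then have "integrable lborel (\<lambda>y. B *\<^sub>R f (x - y))" by simp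
  then show ?thesis
    by (rule Bochner_Integration.integrable_bound)
       (use B in \<open>auto intro!: mult_right_mono simp: abs_le_iff\<close>)
qed

lemma conv_mollifier_diff:
  fixes f :: "'a::euclidean_space \<Rightarrow> 'b::euclidean_space"
  assumes f: "integrable lborel f" and k: "mollifier d k"
  shows "conv k f x - f x = (\<integral>y. k y *\<^sub>R (f (x - y) - f x) \<partial>lborel)"
    "integrable lborel (\<lambda>y. k y *\<^sub>R (f (x - y) - f x))"
proof -
  have I: "integrable lborel (\<lambda>y. k y *\<^sub>R f (x - y))"
    by (rule integrable_mollifier_scaleR[OF f k])
  have J: "integrable lborel (\<lambda>y. k y *\<^sub>R f x)"
    using mollifierD(5)[OF k] by simp
  have "(\<integral>y. k y *\<^sub>R f x \<partial>lborel) = f x"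
    using mollifierD(5,6)[OF k] by simp
  then show "conv k f x - f x = (\<integral>y. k y *\<^sub>R (f (x - y) - f x) \<partial>lborel)"
    using I J by (simp add: conv_def scaleR_diff_right)
  show "integrable lborel (\<lambda>y. k y *\<^sub>R (f (x - y) - f x))"
    using I J by (simp add: scaleR_diff_right)
qed

text \<open>By Jensen's inequality for the probability density \<open>k\<close>, here in the form of
  Hoelder's inequality, and by Fubini's theorem, the error is at most an average over
  \<open>norm y < d\<close> of the translation errors of \<open>f\<close>. Hence one
  \<open>d0\<close> serves all kernels.\<close>

lemma mollify_Lp:
  fixes f :: "'a::euclidean_space \<Rightarrow> 'b::euclidean_space"
  assumes f: "integrable lborel f" and p: "1 < p"
    and fin: "(\<integral>\<^sup>+x. ennreal (norm (f x) powr p) \<partial>lborel) < \<infinity>" and e: "0 < e"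
  obtains d0 where "0 < d0" "\<And>d k. mollifier d k \<Longrightarrow> d \<le> d0 \<Longrightarrow>
    (\<integral>\<^sup>+x. ennreal (norm (conv k f x - f x) powr p) \<partial>lborel) \<le> ennreal e"
proof -
  have fm[measurable]: "f \<in> borel_measurable borel" using f by simp
  obtain d0 where d0: "0 < d0"
    "\<And>h. norm h < d0 \<Longrightarrow> (\<integral>\<^sup>+x. ennreal (norm (f (x - h) - f x) powr p) \<partial>lborel) \<le> ennreal e"
    using Lp_translation_continuous[OF fm _ fin e] p by (metis less_imp_le)
  show ?thesis
  proof (rule that[OF d0(1)])
    fix d and k :: "'a \<Rightarrow> real" assume k: "mollifier d k" and dd: "d \<le> d0"
    note [measurable] = mollifierD(8)[OF k]
    note k0 = mollifierD(2)[OF k]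
    have pt: "ennreal (norm (conv k f x - f x) powr p) \<le> (\<integral>\<^sup>+y. ennreal (k y) * ennreal (norm (f (x - y) - f x) powr p) \<partial>lborel)" for x
    proof -
      let ?F = "\<lambda>y. ennreal (k y) * ennreal (norm (f (x - y) - f x) powr p)"
      have "ennreal (norm (conv k f x - f x)) \<le> (\<integral>\<^sup>+y. ennreal (norm (k y *\<^sub>R (f (x - y) - f x))) \<partial>lborel)"
        unfolding conv_mollifier_diff(1)[OF f k]
        by (rule integral_norm_bound_ennreal[OF conv_mollifier_diff(2)[OF f k]])
      \<comment> \<open>The kernel is split into its powers \<open>1 / p\<close> and
        \<open>1 - 1 / p\<close>; after Hoelder's inequality the second part contributes the total
        mass 1.\<close>
      also have "\<dots> = (\<integral>\<^sup>+y. epow (?F y) (1 / p) * epow (ennreal (k y)) (1 - 1 / p) \<partial>lborel)"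
      proof (rule nn_integral_cong)
        fix y
        have "epow (?F y) (1 / p) = epow (ennreal (k y)) (1 / p) * ennreal (norm (f (x - y) - f x))"
          unfolding epow_mult using p by (simp add: epow_ennreal powr_powr)
        then have "epow (?F y) (1 / p) * epow (ennreal (k y)) (1 - 1 / p) =
            (epow (ennreal (k y)) (1 / p) * epow (ennreal (k y)) (1 - 1 / p)) * ennreal (norm (f (x - y) - f x))"
          by (simp only: mult_ac)
        also have "epow (ennreal (k y)) (1 / p) * epow (ennreal (k y)) (1 - 1 / p) = ennreal (k y)"
          using p by (subst epow_add[symmetric]) (auto simp: field_simps)
        finally show "ennreal (norm (k y *\<^sub>R (f (x - y) - f x))) = epow (?F y) (1 / p) * epow (ennreal (k y)) (1 - 1 / p)"
          using k0[of y] by (simp add: ennreal_mult)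
      qed
      also have "\<dots> \<le> epow (\<integral>\<^sup>+y. ?F y \<partial>lborel) (1 / p) * epow (\<integral>\<^sup>+y. ennreal (k y) \<partial>lborel) (1 - 1 / p)"
        using p by (intro nn_integral_Hoelder) (auto simp: field_simps)
      also have "\<dots> = epow (\<integral>\<^sup>+y. ?F y \<partial>lborel) (1 / p)"
        by (simp add: mollifierD(9)[OF k] epow_one)
      finally have "epow (ennreal (norm (conv k f x - f x))) p \<le> epow (epow (\<integral>\<^sup>+y. ?F y \<partial>lborel) (1 / p)) p"
        using p by (intro epow_mono) auto
      then show ?thesis using p by (simp add: epow_epow epow_ennreal)
    qed
    have "(\<integral>\<^sup>+x. ennreal (norm (conv k f x - f x) powr p) \<partial>lborel)
      \<le> (\<integral>\<^sup>+x. (\<integral>\<^sup>+y. ennreal (k y) * ennreal (norm (f (x - y) - f x) powr p) \<partial>lborel) \<partial>lborel)"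
      by (intro nn_integral_mono pt)
    also have "\<dots> = (\<integral>\<^sup>+y. (\<integral>\<^sup>+x. ennreal (k y) * ennreal (norm (f (x - y) - f x) powr p) \<partial>lborel) \<partial>lborel)"
      by (rule lborel_pair.Fubini') measurable
    also have "\<dots> = (\<integral>\<^sup>+y. ennreal (k y) * (\<integral>\<^sup>+x. ennreal (norm (f (x - y) - f x) powr p) \<partial>lborel) \<partial>lborel)"
      by (intro nn_integral_cong nn_integral_cmult) measurable
    also have "\<dots> \<le> (\<integral>\<^sup>+y. ennreal (k y) * ennreal e \<partial>lborel)"
    proof (rule nn_integral_mono)
      fix y
      show "ennreal (k y) * (\<integral>\<^sup>+x. ennreal (norm (f (x - y) - f x) powr p) \<partial>lborel) \<le> ennreal (k y) * ennreal e"
      proof (cases "norm y < d")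
        case True
        then show ?thesis using dd by (intro mult_left_mono d0(2)) auto
      next
        case False
        then show ?thesis using mollifierD(3)[OF k, of y] by simp
      qed
    qed
    also have "\<dots> = ennreal e" by (simp add: nn_integral_multc mollifierD(9)[OF k])
    finally show "(\<integral>\<^sup>+x. ennreal (norm (conv k f x - f x) powr p) \<partial>lborel) \<le> ennreal e" .
  qed
qed

lemma conv_mollifier_near:
  fixes f :: "'a::euclidean_space \<Rightarrow> 'b::euclidean_space"
  assumes f: "integrable lborel f" and k: "mollifier d k"
    and near: "\<And>y. norm (y - x) < d \<Longrightarrow> norm (f y - f x) \<le> e"
  shows "norm (conv k f x - f x) \<le> e"
proof -
  have "norm (conv k f x - f x) \<le> (\<integral>y. k y * e \<partial>lborel)"
    unfolding conv_mollifier_diff(1)[OF f k]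
  proof (rule Bochner_Integration.integral_norm_bound_integral)
    show "integrable lborel (\<lambda>y. k y *\<^sub>R (f (x - y) - f x))" by (rule conv_mollifier_diff[OF f k])
    show "integrable lborel (\<lambda>y. k y * e)" using mollifierD(5)[OF k] by simp
    fix y
    show "norm (k y *\<^sub>R (f (x - y) - f x)) \<le> k y * e"
    proof (cases "norm y < d")
      case True
      then show ?thesis using near[of "x - y"] mollifierD(2)[OF k, of y] by (auto intro!: mult_left_mono)
    next
      case False
      then show ?thesis using mollifierD(3)[OF k, of y] by simp
    qed
  qed
  then show ?thesis using mollifierD(6)[OF k] by simp
qed

lemma conv_mollifier_ge:
  fixes f :: "'a::euclidean_space \<Rightarrow> real"
  assumes f: "integrable lborel f" and k: "mollifier d k"
    and near: "\<And>y. norm (y - x) < d \<Longrightarrow> m \<le> f y"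
  shows "m \<le> conv k f x"
proof -
  have "(\<integral>y. k y * m \<partial>lborel) \<le> conv k f x"
    unfolding conv_def
  proof (rule Bochner_Integration.integral_mono)
    show "integrable lborel (\<lambda>y. k y *\<^sub>R f (x - y))" by (rule integrable_mollifier_scaleR[OF f k])
    show "integrable lborel (\<lambda>y. k y * m)" using mollifierD(5)[OF k] by simp
    fix y
    show "k y * m \<le> k y *\<^sub>R f (x - y)"
    proof (cases "norm y < d")
      case True
      then show ?thesis using near[of "x - y"] mollifierD(2)[OF k, of y] by (auto intro!: mult_left_mono)
    next
      case False
      then show ?thesis using mollifierD(3)[OF k, of y] by simp
    qed
  qed
  then show ?thesis using mollifierD(6)[OF k] by simp
qed

lemma conv_support:
  assumes "mollifier d k" and "\<And>y. norm (y - x) < d \<Longrightarrow> f y = 0"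
  shows "conv k f x = 0"
proof -
  have "k y *\<^sub>R f (x - y) = 0" for y
    using assms(2)[of "x - y"] mollifierD(3)[OF assms(1), of y] by (cases "norm y < d") auto
  then show ?thesis unfolding conv_def by (simp only: Bochner_Integration.integral_zero)
qed

section \<open>Convexity and differential calculus\<close>

text \<open>Young's inequality for \<open>A\<close> and \<open>B powr (p - 1)\<close> with the
  exponents \<open>p\<close> and \<open>p / (p - 1)\<close>.\<close>

lemma powr_tangent_le:
  fixes A B p :: real
  assumes "0 \<le> A" "0 \<le> B" "1 < p"
  shows "B powr p + p * B powr (p - 1) * (A - B) \<le> A powr p"
proof (cases "B = 0")
  case False
  then have B: "B > 0" using assms by simp
  define q where "q = p / (p - 1)"
  have q: "1 < q" "1 / p + 1 / q = 1" using assms by (auto simp: q_def field_simps)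
  have "A * B powr (p - 1) \<le> A powr p / p + (B powr (p - 1)) powr q / q"
    using assms q by (intro Youngs_inequality) auto
  moreover have "(B powr (p - 1)) powr q = B powr p"
    using assms by (simp add: powr_powr q_def)
  moreover have "1 / q = (p - 1) / p" using assms by (simp add: q_def)
  ultimately have "A * B powr (p - 1) \<le> A powr p / p + B powr p * ((p - 1) / p)"
    by (metis times_divide_eq_right mult.right_neutral)
  then have "p * (A * B powr (p - 1)) \<le> A powr p + B powr p * (p - 1)"
    using assms by (simp add: field_simps)
  moreover have "B powr (p - 1) * B = B powr p"
    using B by (simp add: powr_diff)
  ultimately show ?thesis by (simp add: algebra_simps)
qed (use assms in auto)

text \<open>With \<open>x + y\<close> scaled to 1, each term lies between 0 and 1 and can only
  decrease when raised to a power \<open>s \<ge> 1\<close>.\<close>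

lemma powr_superadditive:
  fixes x y s :: real
  assumes "0 \<le> x" "0 \<le> y" "1 \<le> s"
  shows "x powr s + y powr s \<le> (x + y) powr s"
proof (cases "x + y = 0")
  case False
  then have t: "x + y > 0" using assms by simp
  have *: "z powr s \<le> (z / (x + y)) * (x + y) powr s" if "0 \<le> z" "z \<le> x + y" for z
  proof -
    have "(z / (x + y)) powr s \<le> (z / (x + y)) powr 1"
    proof (cases "z = 0")
      case False
      then show ?thesis using that t assms by (intro powr_mono') auto
    qed (use assms in auto)
    then have "(z / (x + y)) powr s * (x + y) powr s \<le> (z / (x + y)) * (x + y) powr s"
      using that t by (intro mult_right_mono) auto
    moreover have "(z / (x + y)) powr s * (x + y) powr s = z powr s"
      using that t by (simp add: powr_divide)
    ultimately show ?thesis by simp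
  qed
  have "x powr s + y powr s \<le> (x / (x + y)) * (x + y) powr s + (y / (x + y)) * (x + y) powr s"
    using assms by (intro add_mono *) auto
  also have "\<dots> = ((x + y) / (x + y)) * (x + y) powr s" by (simp only: add_divide_distrib distrib_right)
  also have "\<dots> = (x + y) powr s" using t by simp
  finally show ?thesis .
next
  case True
  then have "x = 0" "y = 0" using assms by auto
  then show ?thesis by simp
qed

text \<open>Cauchy-Schwarz reduces the claim to the scalar tangent inequality for
  \<open>norm a\<close> and \<open>norm b\<close>.\<close>

lemma norm_powr_tangent:
  fixes a b :: "'a::real_inner"
  assumes p: "2 \<le> p"
  shows "norm b powr p + p * (norm b powr (p - 2) * (b \<bullet> (a - b))) \<le> norm a powr p"
proof -
  have "norm b powr (p - 2) * (b \<bullet> (a - b)) \<le> norm b powr (p - 2) * (norm b * norm a - norm b * norm b)"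
    using Cauchy_Schwarz_ineq2[of b a]
    by (intro mult_left_mono) (auto simp: inner_diff_right power2_norm_eq_inner[symmetric] power2_eq_square)
  also have "\<dots> = norm b powr (p - 1) * (norm a - norm b)"
  proof (cases "norm b = 0")
    case False
    then have "norm b powr (p - 1) = norm b powr (p - 2) * norm b"
      using powr_add[of "norm b" "p - 2" 1] by simp
    then show ?thesis by (simp add: algebra_simps)
  qed simp
  finally have "p * (norm b powr (p - 2) * (b \<bullet> (a - b))) \<le> p * (norm b powr (p - 1) * (norm a - norm b))"
    using p by (intro mult_left_mono) auto
  moreover have "norm b powr p + p * (norm b powr (p - 1) * (norm a - norm b)) \<le> norm a powr p"
    using powr_tangent_le[of "norm a" "norm b" p] p by (simp add: mult.assoc)
  ultimately show ?thesis by linarith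
qed

text \<open>Clarkson's inequality at the midpoint, combined with convexity between \<open>b\<close> and the midpoint.\<close>
lemma norm_powr_uniformly_convex:
  fixes a b :: "'a::real_inner"
  assumes p: "2 \<le> p"
  shows "norm b powr p + p * (norm b powr (p - 2) * (b \<bullet> (a - b))) + 2 powr (1 - p) * norm (a - b) powr p
    \<le> norm a powr p"
proof -
  define c where "c = (1/2) *\<^sub>R (a + b)"
  define e where "e = (1/2) *\<^sub>R (a - b)"
  \<comment> \<open>Parallelogram identity; superadditivity and then convexity of the power
    \<open>p / 2 \<ge> 1\<close> turn it into Clarkson's inequality.\<close>
  have par: "(norm c)\<^sup>2 + (norm e)\<^sup>2 = ((norm a)\<^sup>2 + (norm b)\<^sup>2) / 2"
    unfolding c_def e_def power2_norm_eq_inner by (simp add: inner_simps inner_commute field_simps)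
  have sq: "x powr p = (x\<^sup>2) powr (p / 2)" if "0 \<le> x" for x :: real
    using that by (simp add: powr_powr flip: powr_numeral)
  have "norm c powr p + norm e powr p = ((norm c)\<^sup>2) powr (p / 2) + ((norm e)\<^sup>2) powr (p / 2)"
    by (simp add: sq)
  also have "\<dots> \<le> ((norm c)\<^sup>2 + (norm e)\<^sup>2) powr (p / 2)"
    using p by (intro powr_superadditive) auto
  also have "\<dots> = (((norm a)\<^sup>2 + (norm b)\<^sup>2) / 2) powr (p / 2)" by (simp add: par)
  also have "\<dots> \<le> (((norm a)\<^sup>2) powr (p / 2) + ((norm b)\<^sup>2) powr (p / 2)) / 2"
  proof (cases "p = 2")
    case True
    then show ?thesis by simp
  next
    case False
    \<comment> \<open>The tangent inequality at the mean \<open>M\<close> of the two squares is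
      added for both of them, and the linear parts cancel. The case \<open>p = 2\<close> is separate
      because \<open>powr_tangent_le\<close> wants an exponent above 1.\<close>
    define M where "M = ((norm a)\<^sup>2 + (norm b)\<^sup>2) / 2"
    have M0: "0 \<le> M" by (simp add: M_def)
    have "M powr (p/2) + (p/2) * M powr (p/2 - 1) * ((norm a)\<^sup>2 - M) \<le> ((norm a)\<^sup>2) powr (p/2)"
      "M powr (p/2) + (p/2) * M powr (p/2 - 1) * ((norm b)\<^sup>2 - M) \<le> ((norm b)\<^sup>2) powr (p/2)"
      using p False M0 by (intro powr_tangent_le; simp)+
    moreover have "(p/2) * M powr (p/2 - 1) * ((norm a)\<^sup>2 - M) + (p/2) * M powr (p/2 - 1) * ((norm b)\<^sup>2 - M) = 0"
      unfolding distrib_left[symmetric] by (simp add: M_def)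
    ultimately have "2 * M powr (p/2) \<le> ((norm a)\<^sup>2) powr (p/2) + ((norm b)\<^sup>2) powr (p/2)"
      by linarith
    then show ?thesis by (simp add: M_def)
  qed
  also have "\<dots> = (norm a powr p + norm b powr p) / 2" by (simp add: sq)
  finally have clarkson: "norm c powr p + norm e powr p \<le> (norm a powr p + norm b powr p) / 2" .
  have tangent: "norm b powr p + p * (norm b powr (p - 2) * (b \<bullet> (c - b))) \<le> norm c powr p"
    by (rule norm_powr_tangent[OF p])
  have "c - b = (1/2) *\<^sub>R (a - b)" by (simp add: c_def algebra_simps flip: scaleR_2)
  then have bc: "b \<bullet> (c - b) = (b \<bullet> (a - b)) / 2" by simp
  have "norm e powr p = (1/2) powr p * norm (a - b) powr p"
    by (simp add: e_def powr_mult[symmetric])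
  moreover have "2 powr (1 - p) = 2 * (1/2) powr p"
    by (simp add: powr_diff powr_divide)
  ultimately have ee: "2 powr (1 - p) * norm (a - b) powr p = 2 * norm e powr p" by simp
  \<comment> \<open>Twice Clarkson's inequality together with twice the tangent bound for
    \<open>norm c powr p\<close>: one \<open>norm b powr p\<close> cancels, the linear part keeps
    the factor \<open>p\<close> because \<open>c - b\<close> is half of \<open>a - b\<close>, and
    the remainder \<open>2 * norm e powr p\<close> gives the constant
    \<open>2 powr (1 - p)\<close>.\<close>
  show ?thesis using clarkson tangent unfolding bc ee by (simp add: field_simps)
qed

text \<open>Positivity of \<open>w\<close> is asked on \<open>K\<close> only: \<open>f\<close>
  vanishes on the open complement, so the quotient is locally 0 there whatever \<open>w\<close> is,
  division by 0 included.\<close>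

lemma C1_grad_quotient:
  fixes f w :: "'a::euclidean_space \<Rightarrow> real"
  assumes f: "C1_grad f f'" and w: "C1_grad w w'" and K: "closed K"
    and f0: "\<And>x. x \<notin> K \<Longrightarrow> f x = 0" and wpos: "\<And>x. x \<in> K \<Longrightarrow> 0 < w x"
  shows "C1_grad (\<lambda>x. f x / w x) (\<lambda>x. (1 / w x) *\<^sub>R (f' x - (f x / w x) *\<^sub>R w' x))"
    "\<And>x. x \<notin> K \<Longrightarrow> f' x = 0"
proof -
  let ?g' = "\<lambda>x. (1 / w x) *\<^sub>R (f' x - (f x / w x) *\<^sub>R w' x)"
  show f'0: "f' x = 0" if x: "x \<notin> K" for x
  proof -
    have "(f has_derivative (\<lambda>h. 0)) (at x)"
      by (rule has_derivative_transform_within_open[OF has_derivative_const, where s="- K"])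
         (use x K f0 in auto)
    then have "(\<lambda>h. f' x \<bullet> h) = (\<lambda>h. 0)"
      using C1_grad_D(2)[OF f] has_derivative_unique by blast
    then have "f' x \<bullet> f' x = 0" by metis
    then show ?thesis by simp
  qed
  have "((\<lambda>x. f x / w x) has_derivative (\<lambda>h. ?g' x \<bullet> h)) (at x) \<and> isCont ?g' x" for x
  proof (cases "x \<in> K")
    case True
    then have wx: "w x \<noteq> 0" using wpos[of x] by auto
    have "((\<lambda>x. f x / w x) has_derivative
       (\<lambda>h. - f x * (inverse (w x) * (w' x \<bullet> h) * inverse (w x)) + (f' x \<bullet> h) / w x)) (at x)"
      by (rule has_derivative_divide[OF C1_grad_D(2)[OF f] C1_grad_D(2)[OF w] wx])
    moreover have "(\<lambda>h. - f x * (inverse (w x) * (w' x \<bullet> h) * inverse (w x)) + (f' x \<bullet> h) / w x) = (\<lambda>h. ?g' x \<bullet> h)"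
      using wx by (auto simp: inner_diff_left field_simps)
    moreover have "isCont f' x" "isCont w' x" "isCont f x" "isCont w x"
      using C1_grad_D(1,3)[OF f] C1_grad_D(1,3)[OF w] by (auto simp: continuous_on_eq_continuous_at)
    then have "isCont ?g' x" using wx by (intro continuous_intros) auto
    ultimately show ?thesis by simp
  next
    case False
    have g0: "?g' y = 0" if "y \<in> - K" for y using that f0 f'0 by simp
    have "((\<lambda>x. f x / w x) has_derivative (\<lambda>h. 0)) (at x)"
      by (rule has_derivative_transform_within_open[OF has_derivative_const, where s="- K"])
         (use False K f0 in auto)
    moreover have "isCont ?g' x"
    proof -
      have "\<forall>\<^sub>F y in nhds x. y \<in> - K" using False K by (intro eventually_nhds_in_open) auto
      then have "\<forall>\<^sub>F y in nhds x. ?g' y = 0" by eventually_elim (rule g0)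
      then have "isCont ?g' x = isCont (\<lambda>_. 0::'a) x" by (rule isCont_cong)
      then show ?thesis by (simp only: continuous_const)
    qed
    moreover have "?g' x = 0" using g0[of x] False by simp
    ultimately show ?thesis by (simp only: inner_zero_left simp_thms)
  qed
  then show "C1_grad (\<lambda>x. f x / w x) ?g'"
    unfolding C1_grad_def by (blast intro: continuous_at_imp_continuous_on)
qed

text \<open>This is the shape of the test function \<open>\<bar>v\<bar> powr p * u\<close>;
  \<open>1 < p\<close> keeps it continuously differentiable at the zeros of
  \<open>v\<close>.\<close>

lemma C1_grad_powr_mult:
  fixes v w :: "'a::euclidean_space \<Rightarrow> real"
  assumes v: "C1_grad v v'" and w: "C1_grad w w'" and p: "1 < p"
  shows "C1_grad (\<lambda>x. \<bar>v x\<bar> powr p * w x)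
    (\<lambda>x. (p * (\<bar>v x\<bar> powr (p - 1) * sgn (v x)) * w x) *\<^sub>R v' x + \<bar>v x\<bar> powr p *\<^sub>R w' x)"
  unfolding C1_grad_def
proof (intro conjI allI)
  have c: "continuous_on UNIV (\<lambda>x. \<bar>v x\<bar> powr (p - 1) * sgn (v x))"
    by (rule continuous_on_compose2[OF continuous_abs_powr_sgn[OF p] C1_grad_D(3)[OF v]]) auto
  have c': "continuous_on UNIV (\<lambda>x. \<bar>v x\<bar> powr p)"
    using p C1_grad_D(3)[OF v] by (intro continuous_on_powr' continuous_intros) auto
  show "continuous_on UNIV (\<lambda>x. (p * (\<bar>v x\<bar> powr (p - 1) * sgn (v x)) * w x) *\<^sub>R v' x + \<bar>v x\<bar> powr p *\<^sub>R w' x)"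
    by (intro continuous_intros c c' C1_grad_D(3)[OF w] C1_grad_D(1)[OF w] C1_grad_D(1)[OF v])
  fix x
  have "((\<lambda>x. \<bar>v x\<bar> powr p) has_derivative (\<lambda>h. p * \<bar>v x\<bar> powr (p - 1) * sgn (v x) * (v' x \<bullet> h))) (at x)"
    by (rule has_derivative_compose[where f=v and g="\<lambda>s. \<bar>s\<bar> powr p"
          and g'="(*) (p * \<bar>v x\<bar> powr (p - 1) * sgn (v x))"])
       (auto intro: C1_grad_D(2)[OF v] abs_powr_has_derivative[OF p, unfolded has_field_derivative_def])
  from has_derivative_mult[OF this C1_grad_D(2)[OF w]]
  show "((\<lambda>x. \<bar>v x\<bar> powr p * w x) has_derivative
     (\<lambda>h. ((p * (\<bar>v x\<bar> powr (p - 1) * sgn (v x)) * w x) *\<^sub>R v' x + \<bar>v x\<bar> powr p *\<^sub>R w' x) \<bullet> h)) (at x)"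
    by (rule has_derivative_eq_rhs) (auto simp: inner_add_left fun_eq_iff algebra_simps)
qed

text \<open>The sum over \<open>n\<close> of all the errors has finite integral by the geometric
  series. Where it is finite its terms tend to 0, and the sum itself dominates each of them.\<close>

lemma fast_Lp_convergence:
  fixes a :: "nat \<Rightarrow> 'a \<Rightarrow> 'b::euclidean_space"
  assumes [measurable]: "\<And>n. a n \<in> borel_measurable M" "b \<in> borel_measurable M"
    and p: "0 < p" and fast: "\<And>n. (\<integral>\<^sup>+x. ennreal (norm (a n x - b x) powr p) \<partial>M) \<le> ennreal ((1/2) ^ n)"
  obtains h :: "'a \<Rightarrow> real" where "integrable M h" "\<And>x. 0 \<le> h x"
    "AE x in M. (\<forall>n. norm (a n x - b x) powr p \<le> h x) \<and> (\<lambda>n. a n x) \<longlonglongrightarrow> b x"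
proof -
  define S where "S x = (\<Sum>n. ennreal (norm (a n x - b x) powr p))" for x
  have Sm[measurable]: "S \<in> borel_measurable M" unfolding S_def by measurable
  have "(\<integral>\<^sup>+x. S x \<partial>M) = (\<Sum>n. \<integral>\<^sup>+x. ennreal (norm (a n x - b x) powr p) \<partial>M)"
    unfolding S_def by (rule nn_integral_suminf) measurable
  also have "\<dots> \<le> (\<Sum>n. ennreal ((1/2) ^ n))"
    by (intro suminf_le fast) auto
  also have "\<dots> < top"
    using geometric_sums[of "1/2::real"] by (subst suminf_ennreal_eq[where x=2]) auto
  finally have fin: "(\<integral>\<^sup>+x. S x \<partial>M) < top" .
  then have AEfin: "AE x in M. S x \<noteq> top"
    using nn_integral_PInf_AE[OF Sm] by (simp add: less_top)
  define h where "h x = enn2real (S x)" for x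
  have hm[measurable]: "h \<in> borel_measurable M" unfolding h_def by measurable
  have h0: "0 \<le> h x" for x by (simp add: h_def)
  have "(\<integral>\<^sup>+x. ennreal (h x) \<partial>M) = (\<integral>\<^sup>+x. S x \<partial>M)"
    using AEfin by (intro nn_integral_cong_AE) (auto simp: h_def less_top)
  then have "integrable M h" using fin h0 by (intro integrableI_nonneg) (auto simp: less_top)
  moreover have "AE x in M. (\<forall>n. norm (a n x - b x) powr p \<le> h x) \<and> (\<lambda>n. a n x) \<longlonglongrightarrow> b x"
    using AEfin
  proof eventually_elim
    fix x assume x: "S x \<noteq> top"
    then have eq: "ennreal (h x) = S x" by (simp add: h_def less_top)
    have le: "norm (a n x - b x) powr p \<le> h x" for n
    proof -
      have "(\<Sum>i\<in>{n}. ennreal (norm (a i x - b x) powr p)) \<le> S x"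
        unfolding S_def by (rule sum_le_suminf) (simp_all add: summableI)
      then have "ennreal (norm (a n x - b x) powr p) \<le> S x" by simp
      then show ?thesis using h0[of x] by (simp add: eq[symmetric])
    qed
    have "summable (\<lambda>n. norm (a n x - b x) powr p)"
      using x unfolding S_def by (intro summable_suminf_not_top) auto
    then have "(\<lambda>n. norm (a n x - b x) powr p) \<longlonglongrightarrow> 0" by (rule summable_LIMSEQ_zero)
    then have "(\<lambda>n. (norm (a n x - b x) powr p) powr (1 / p)) \<longlonglongrightarrow> 0 powr (1 / p)"
      using p by (intro tendsto_powr') auto
    then have "(\<lambda>n. norm (a n x - b x)) \<longlonglongrightarrow> 0" using p by (simp add: powr_powr)
    then have "(\<lambda>n. a n x) \<longlonglongrightarrow> b x" by (rule LIM_zero_cancel[OF tendsto_norm_zero_cancel])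
    with le show "(\<forall>n. norm (a n x - b x) powr p \<le> h x) \<and> (\<lambda>n. a n x) \<longlonglongrightarrow> b x" by blast
  qed
  ultimately show ?thesis using that h0 by blast
qed

text \<open>Mollification approximates a C^1 test function and its gradient uniformly, at the cost
  of enlarging the support from \<open>K\<close> to \<open>L\<close>; uniform convergence suffices
  because \<open>F\<close> and \<open>S\<close> are integrable. In the application \<open>F\<close>
  is the flux \<open>norm G powr (p - 2) *\<^sub>R G\<close> and \<open>S\<close> is
  \<open>V * u powr (p - 1)\<close>.\<close>

lemma weak_form_C1:
  fixes F :: "'a::euclidean_space \<Rightarrow> 'a" and S :: "'a \<Rightarrow> real"
  assumes F: "integrable lborel F" and S: "integrable lborel S"
    and K: "bounded K" and d: "0 < d" "\<And>x. x \<in> K \<Longrightarrow> cball x d \<subseteq> L"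
    and test: "\<And>\<psi>. (\<And>n. Ck n \<psi>) \<Longrightarrow> (\<And>x. x \<notin> L \<Longrightarrow> \<psi> x = 0) \<Longrightarrow>
      (\<integral>x. F x \<bullet> grad \<psi> x + S x * \<psi> x \<partial>lborel) = 0"
    and psi: "C1_grad \<psi> \<psi>'" "\<And>x. x \<notin> K \<Longrightarrow> \<psi> x = 0" "\<And>x. x \<notin> K \<Longrightarrow> \<psi>' x = 0"
  shows "(\<integral>x. F x \<bullet> \<psi>' x + S x * \<psi> x \<partial>lborel) = 0"
proof -
  obtain R where R: "\<And>x. x \<in> K \<Longrightarrow> norm x \<le> R" using K by (auto simp: bounded_iff)
  have s1: "norm x > R \<Longrightarrow> \<psi> x = 0" and s2: "norm x > R \<Longrightarrow> \<psi>' x = 0" for x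
    using psi(2,3)[of x] R[of x] by auto
  note c1 = C1_grad_D(3)[OF psi(1)] and c2 = C1_grad_D(1)[OF psi(1)]
  have i1: "integrable lborel \<psi>" using compact_support_integrable[OF c1, of R] s1 by auto
  have i2: "integrable lborel \<psi>'" using compact_support_integrable[OF c2, of R] s2 by auto
  have int: "integrable lborel (\<lambda>x. F x \<bullet> g' x + S x * g x)"
    if "continuous_on UNIV g" "continuous_on UNIV g'" "\<And>x. norm (g x) \<le> B" "\<And>x. norm (g' x) \<le> B"
    for g :: "'a \<Rightarrow> real" and g' :: "'a \<Rightarrow> 'a" and B
  proof -
    note [measurable] = borel_measurable_continuous_onI[OF that(1)] borel_measurable_continuous_onI[OF that(2)]
    have [measurable]: "F \<in> borel_measurable borel" "S \<in> borel_measurable borel" using F S by auto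
    show ?thesis
    proof (rule Bochner_Integration.integrable_bound[where f="\<lambda>x. B * (norm (F x) + \<bar>S x\<bar>)"])
      show "integrable lborel (\<lambda>x. B * (norm (F x) + \<bar>S x\<bar>))"
        using F S by (intro integrable_mult_right Bochner_Integration.integrable_add) auto
      show "AE x in lborel. norm (F x \<bullet> g' x + S x * g x) \<le> norm (B * (norm (F x) + \<bar>S x\<bar>))"
      proof (rule AE_I2)
        fix x
        have "0 \<le> B" using that(3)[of x] norm_ge_zero order_trans by blast
        have "\<bar>F x \<bullet> g' x\<bar> \<le> norm (F x) * B"
          using Cauchy_Schwarz_ineq2[of "F x" "g' x"] mult_left_mono[OF that(4)[of x], of "norm (F x)"] by simp
        moreover have "\<bar>S x * g x\<bar> \<le> \<bar>S x\<bar> * B"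
          unfolding abs_mult using that(3)[of x] by (intro mult_left_mono) auto
        ultimately show "norm (F x \<bullet> g' x + S x * g x) \<le> norm (B * (norm (F x) + \<bar>S x\<bar>))"
          using \<open>0 \<le> B\<close> by (simp add: algebra_simps)
      qed
    qed measurable
  qed
  define A where "A = (\<integral>x. norm (F x) + \<bar>S x\<bar> \<partial>lborel)"
  have iA: "integrable lborel (\<lambda>x. norm (F x) + \<bar>S x\<bar>)" using F S by auto
  obtain B1 where B1: "B1 > 0" "\<And>x. norm (\<psi> x) \<le> B1" using compact_support_bounded[OF c1, of R] s1 by auto
  obtain B2 where B2: "B2 > 0" "\<And>x. norm (\<psi>' x) \<le> B2" using compact_support_bounded[OF c2, of R] s2 by auto
  have intpsi: "integrable lborel (\<lambda>x. F x \<bullet> \<psi>' x + S x * \<psi> x)"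
    by (rule int[OF c1 c2, where B="max B1 B2"]) (use B1 B2 in \<open>auto simp: le_max_iff_disj\<close>)
  have "\<bar>\<integral>x. F x \<bullet> \<psi>' x + S x * \<psi> x \<partial>lborel\<bar> \<le> e * A" if e: "e > 0" for e
  proof -
    obtain d1 where d1: "d1 > 0" "\<And>x y. dist x y < d1 \<Longrightarrow> dist (\<psi> x) (\<psi> y) < e"
      using compact_support_uniform[OF c1, of R e] s1 e by auto
    obtain d2 where d2: "d2 > 0" "\<And>x y. dist x y < d2 \<Longrightarrow> dist (\<psi>' x) (\<psi>' y) < e"
      using compact_support_uniform[OF c2, of R e] s2 e by auto
    define \<delta> where "\<delta> = min d (min d1 d2)"
    have \<delta>: "0 < \<delta>" using d d1 d2 by (simp add: \<delta>_def)
    obtain k :: "'a \<Rightarrow> real" where k: "mollifier \<delta> k" using mollifier_ex[OF \<delta>] .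
    have km: "k \<in> borel_measurable borel" by (rule mollifierD(8)[OF k])
    have pm: "\<psi> \<in> borel_measurable borel" by (rule borel_measurable_continuous_onI[OF c1])
    \<comment> \<open>Both orders are used: with the kernel second the convolution is smooth, and
      with the kernel first its gradient is the mollification of \<open>\<psi>'\<close>.\<close>
    have comm: "conv k \<psi> = conv \<psi> k" by (rule conv_commute[OF km pm])
    have C: "C1_grad (conv k \<psi>) (conv k \<psi>')"
      using conv_C1[OF mollifierD(5)[OF k] psi(1), of R] s1 s2 by auto
    have g: "grad (conv k \<psi>) = conv k \<psi>'" by (rule C1_grad_grad[OF C])
    have z: "(\<integral>x. F x \<bullet> conv k \<psi>' x + S x * conv k \<psi> x \<partial>lborel) = 0"
    proof -
      have "Ck n (conv k \<psi>)" for n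
        unfolding comm using conv_Ck[OF i1 mollifierD(1)[OF k], of \<delta>] mollifierD(4)[OF k] by auto
      moreover have "conv k \<psi> x = 0" if "x \<notin> L" for x
      proof (rule conv_support[OF k])
        fix y assume "norm (y - x) < \<delta>"
        then have "x \<in> cball y d" by (simp add: \<delta>_def dist_norm)
        then show "\<psi> y = 0" using d(2)[of y] psi(2)[of y] that by blast
      qed
      ultimately have "(\<integral>x. F x \<bullet> grad (conv k \<psi>) x + S x * conv k \<psi> x \<partial>lborel) = 0"
        by (rule test)
      then show ?thesis unfolding g .
    qed
    have n1: "norm (conv k \<psi> x - \<psi> x) \<le> e" for x
    proof (rule conv_mollifier_near[OF i1 k])
      fix y assume "norm (y - x) < \<delta>"
      then show "norm (\<psi> y - \<psi> x) \<le> e" using d1(2)[of y x] by (simp add: \<delta>_def dist_norm)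
    qed
    have n2: "norm (conv k \<psi>' x - \<psi>' x) \<le> e" for x
    proof (rule conv_mollifier_near[OF i2 k])
      fix y assume "norm (y - x) < \<delta>"
      then show "norm (\<psi>' y - \<psi>' x) \<le> e" using d2(2)[of y x] by (simp add: \<delta>_def dist_norm)
    qed
    have b1: "norm (conv k \<psi> x) \<le> max B1 B2 + e" for x
      using n1[of x] B1(2)[of x] by (simp add: abs_le_iff) linarith
    have b2: "norm (conv k \<psi>' x) \<le> max B1 B2 + e" for x
      using n2[of x] B2(2)[of x] norm_triangle_sub[of "conv k \<psi>' x" "\<psi>' x"] by linarith
    have intk: "integrable lborel (\<lambda>x. F x \<bullet> conv k \<psi>' x + S x * conv k \<psi> x)"
      by (rule int[OF C1_grad_D(3)[OF C] C1_grad_D(1)[OF C] b1 b2])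
    have "(\<integral>x. F x \<bullet> \<psi>' x + S x * \<psi> x \<partial>lborel) =
      (\<integral>x. (F x \<bullet> \<psi>' x + S x * \<psi> x) - (F x \<bullet> conv k \<psi>' x + S x * conv k \<psi> x) \<partial>lborel)"
      using Bochner_Integration.integral_diff[OF intpsi intk] z by simp
    also have "norm \<dots> \<le> (\<integral>x. e * (norm (F x) + \<bar>S x\<bar>) \<partial>lborel)"
    proof (rule Bochner_Integration.integral_norm_bound_integral)
      fix x
      have "\<bar>F x \<bullet> (\<psi>' x - conv k \<psi>' x)\<bar> \<le> norm (F x) * e"
        using Cauchy_Schwarz_ineq2[of "F x" "\<psi>' x - conv k \<psi>' x"]
          mult_left_mono[OF n2[of x], of "norm (F x)"] by (simp add: norm_minus_commute)
      moreover have "\<bar>S x * (\<psi> x - conv k \<psi> x)\<bar> \<le> \<bar>S x\<bar> * e"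
        unfolding abs_mult using n1[of x] by (intro mult_left_mono) auto
      ultimately have "\<bar>F x \<bullet> (\<psi>' x - conv k \<psi>' x) + S x * (\<psi> x - conv k \<psi> x)\<bar> \<le> e * (norm (F x) + \<bar>S x\<bar>)"
        by (simp add: algebra_simps)
      then show "norm ((F x \<bullet> \<psi>' x + S x * \<psi> x) - (F x \<bullet> conv k \<psi>' x + S x * conv k \<psi> x)) \<le> e * (norm (F x) + \<bar>S x\<bar>)"
        by (simp add: inner_diff_right algebra_simps)
    qed (use intpsi intk iA in auto)
    also have "\<dots> = e * A" by (simp add: A_def)
    finally show ?thesis by simp
  qed
  then have "\<bar>\<integral>x. F x \<bullet> \<psi>' x + S x * \<psi> x \<partial>lborel\<bar> \<le> 0"
  proof -
    assume *: "\<And>e. 0 < e \<Longrightarrow> \<bar>\<integral>x. F x \<bullet> \<psi>' x + S x * \<psi> x \<partial>lborel\<bar> \<le> e * A"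
    have "A \<ge> 0" unfolding A_def by (intro Bochner_Integration.integral_nonneg) auto
    show ?thesis
    proof (rule field_le_epsilon)
      fix e :: real assume e: "0 < e"
      have "\<bar>\<integral>x. F x \<bullet> \<psi>' x + S x * \<psi> x \<partial>lborel\<bar> \<le> (e / (A + 1)) * A"
        using e \<open>A \<ge> 0\<close> by (intro *) auto
      also have "\<dots> \<le> e" using e \<open>A \<ge> 0\<close> by (simp add: field_simps)
      finally show "\<bar>\<integral>x. F x \<bullet> \<psi>' x + S x * \<psi> x \<partial>lborel\<bar> \<le> 0 + e" by simp
    qed
  qed
  then show ?thesis by simp
qed

section \<open>The ground state transform\<close>

lemma conv_mollifier_tendsto:
  fixes f :: "'a::euclidean_space \<Rightarrow> 'b::euclidean_space"
  assumes f: "integrable lborel f" and cont: "isCont f x"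
    and k: "\<And>n. mollifier (\<delta> n) (k n)" and \<delta>: "\<And>n. \<delta> n \<le> 1 / real (Suc n)"
  shows "(\<lambda>n. conv (k n) f x) \<longlonglongrightarrow> f x"
proof (rule LIMSEQ_I)
  fix r :: real assume r: "0 < r"
  then obtain s where s: "s > 0" "\<And>y. dist y x < s \<Longrightarrow> dist (f y) (f x) < r / 2"
    using cont unfolding continuous_at_eps_delta by (metis half_gt_zero)
  obtain n0 where n0: "1 / real (Suc n0) < s" using s nat_approx_posE by metis
  show "\<exists>no. \<forall>n\<ge>no. norm (conv (k n) f x - f x) < r"
  proof (intro exI[of _ n0] allI impI)
    fix n assume n: "n0 \<le> n"
    have "\<delta> n < s"
    proof -
      have "1 / real (Suc n) \<le> 1 / real (Suc n0)" using n by (simp add: frac_le)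
      then show ?thesis using \<delta>[of n] n0 by linarith
    qed
    then have "norm (conv (k n) f x - f x) \<le> r / 2"
      by (intro conv_mollifier_near[OF f k[of n]] less_imp_le s(2)[unfolded dist_norm]) auto
    then show "norm (conv (k n) f x - f x) < r" using r by simp
  qed
qed

lemma conv_measurable[measurable]:
  fixes f :: "'a::euclidean_space \<Rightarrow> 'b::euclidean_space"
  assumes [measurable]: "k \<in> borel_measurable borel" "f \<in> borel_measurable borel"
  shows "conv k f \<in> borel_measurable borel"
  unfolding conv_def[abs_def] by measurable

text \<open>A crude Young inequality: both numbers are replaced by the larger one.\<close>

lemma powr_mult_le_add:
  fixes X Y p :: real
  assumes "0 \<le> X" "0 \<le> Y" "2 \<le> p"
  shows "X powr (p - 2) * (X * Y) \<le> X powr p + Y powr p"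
proof -
  define t where "t = max X Y"
  have "X powr (p - 2) * (X * Y) \<le> t powr (p - 2) * (t * t)"
    using assms by (intro mult_mono powr_mono2) (auto simp: t_def)
  also have "\<dots> = t powr p"
  proof (cases "t = 0")
    case False
    then have "0 < t" using assms by (auto simp: t_def)
    then show ?thesis by (simp add: powr_diff power2_eq_square)
  qed simp
  also have "\<dots> \<le> X powr p + Y powr p" by (auto simp: t_def max_def)
  finally show ?thesis .
qed

lemma norm_powr_add_le:
  fixes a b :: "'b::real_normed_vector"
  assumes p: "0 \<le> p"
  shows "norm (a + b) powr p \<le> 3 powr p * (norm a powr p + norm b powr p)"
proof -
  have "norm (a + b) powr p \<le> (norm a + norm b + 0) powr p"
    using p norm_triangle_ineq[of a b] by (intro powr_mono2) auto
  also have "\<dots> \<le> 3 powr p * (norm a powr p + norm b powr p + 0 powr p)"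
    using p by (intro powr_add3_le) auto
  finally show ?thesis by simp
qed

text \<open>The uniform convexity inequality with \<open>b = t *\<^sub>R g\<close>, for
  \<open>a = grad \<phi>\<close>, \<open>g = grad u\<close> and \<open>t = \<phi> / u\<close>. The
  bracket is the inner product of \<open>g\<close> with the gradient of
  \<open>\<bar>t\<bar> powr p * u\<close>, so that the subtracted term is the gradient part of the
  weak equation.\<close>

lemma picone_pointwise:
  fixes a g :: "'a::euclidean_space"
  assumes p: "2 \<le> p"
  shows "2 powr (1 - p) * norm (a - t *\<^sub>R g) powr p \<le>
    norm a powr p - norm g powr (p - 2) * (p * (\<bar>t\<bar> powr (p - 1) * sgn t) * (g \<bullet> a) - (p - 1) * \<bar>t\<bar> powr p * (g \<bullet> g))"
proof -
  have gg: "norm g powr (p - 2) * (g \<bullet> g) = norm g powr p"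
  proof (cases "g = 0")
    case False
    then show ?thesis by (simp add: powr_diff dot_square_norm)
  qed simp
  have t1: "\<bar>t\<bar> powr (p - 2) * t = \<bar>t\<bar> powr (p - 1) * sgn t"
  proof (cases "t = 0")
    case False
    then have "\<bar>t\<bar> powr (p - 1) = \<bar>t\<bar> powr (p - 2) * \<bar>t\<bar>"
      using powr_add[of "\<bar>t\<bar>" "p - 2" 1] by simp
    then show ?thesis by (simp add: mult.assoc abs_mult_sgn)
  qed simp
  have t2: "\<bar>t\<bar> powr (p - 2) * (t * t) = \<bar>t\<bar> powr p"
  proof (cases "t = 0")
    case False
    then show ?thesis by (simp add: powr_diff power2_eq_square)
  qed simp
  have eq1: "norm (t *\<^sub>R g) powr p = \<bar>t\<bar> powr p * (norm g powr (p - 2) * (g \<bullet> g))"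
    by (simp add: powr_mult gg)
  have "norm (t *\<^sub>R g) powr (p - 2) * ((t *\<^sub>R g) \<bullet> (a - t *\<^sub>R g))
     = norm g powr (p - 2) * ((\<bar>t\<bar> powr (p - 2) * t) * (g \<bullet> a) - (\<bar>t\<bar> powr (p - 2) * (t * t)) * (g \<bullet> g))"
    by (simp add: powr_mult inner_diff_right algebra_simps)
  note eq2 = this[unfolded t1 t2]
  have "norm (t *\<^sub>R g) powr p + p * (norm (t *\<^sub>R g) powr (p - 2) * ((t *\<^sub>R g) \<bullet> (a - t *\<^sub>R g)))
      + 2 powr (1 - p) * norm (a - t *\<^sub>R g) powr p \<le> norm a powr p"
    by (rule norm_powr_uniformly_convex[OF p])
  then show ?thesis unfolding eq1 eq2 by (simp add: algebra_simps)
qed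

text \<open>Here \<open>u\<close>, \<open>\<phi>\<close>, \<open>V\<close> and the gradients \<open>G\<close>, \<open>H\<close> are Borel functions on the whole space, agreeing
with the original data only on \<open>L\<close>. The support \<open>A\<close> of \<open>\<phi>\<close> and the sets \<open>B\<close>, \<open>L\<close> are nested so that
mollification at a scale below \<open>d\<close> leads from one to the next.\<close>
lemma ground_state_sobolev:
  fixes u \<phi> V :: "'a::euclidean_space \<Rightarrow> real" and G H :: "'a \<Rightarrow> 'a" and p m d :: real
  defines "N \<equiv> real DIM('a)"
  assumes p: "2 \<le> p" "p < N"
    and comp: "compact A" "compact B" "compact L" and d: "0 < d"
    and AB: "\<And>x. x \<in> A \<Longrightarrow> cball x d \<subseteq> B" and BL: "\<And>x. x \<in> B \<Longrightarrow> cball x d \<subseteq> L"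
    and u: "integrable lborel u" "continuous_on L u" "\<And>x. x \<notin> L \<Longrightarrow> u x = 0"
    and m: "0 < m" "\<And>x. x \<in> L \<Longrightarrow> m \<le> u x"
    and phi: "continuous_on UNIV \<phi>" "\<And>x. x \<notin> A \<Longrightarrow> \<phi> x = 0"
    and G: "integrable lborel G" "integrable lborel (\<lambda>x. norm (G x) powr p)"
    and H: "integrable lborel H" "integrable lborel (\<lambda>x. norm (H x) powr p)"
    and V: "integrable lborel V"
    and wu: "\<And>\<delta> k x. mollifier \<delta> k \<Longrightarrow> \<delta> \<le> d \<Longrightarrow> x \<in> B \<Longrightarrow> conv u (grad k) x = conv k G x"
    and wphi: "\<And>\<delta> k x. mollifier \<delta> k \<Longrightarrow> \<delta> \<le> d \<Longrightarrow> x \<in> B \<Longrightarrow> conv \<phi> (grad k) x = conv k H x"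
    and weak: "\<And>\<psi> \<psi>'. C1_grad \<psi> \<psi>' \<Longrightarrow> (\<And>x. x \<notin> B \<Longrightarrow> \<psi> x = 0) \<Longrightarrow> (\<And>x. x \<notin> B \<Longrightarrow> \<psi>' x = 0) \<Longrightarrow>
      (\<integral>x. norm (G x) powr (p - 2) * (G x \<bullet> \<psi>' x) + V x * u x powr (p - 1) * \<psi> x \<partial>lborel) = 0"
  shows "epow (\<integral>\<^sup>+x. ennreal (\<bar>\<phi> x / u x\<bar> powr (N * p / (N - p))) \<partial>lborel) (1 - p / N)
    \<le> ennreal ((p * (N - 1) / (N - p)) powr p * (1 / m) powr p * 2 powr (p - 1) *
        (\<integral>x. indicator B x * (norm (H x) powr p + V x * \<bar>\<phi> x\<bar> powr p) \<partial>lborel))"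
proof -
  define q where "q = N * p / (N - p)"
  define \<gamma> where "\<gamma> = (p * (N - 1) / (N - p)) powr p"
  have N2: "2 \<le> DIM('a)" using p by (simp add: N_def)
  have q0: "0 < q" using p by (simp add: q_def)
  have p1: "1 < p" using p by simp
  have um[measurable]: "u \<in> borel_measurable borel" using u(1) by simp
  have phim[measurable]: "\<phi> \<in> borel_measurable borel" by (rule borel_measurable_continuous_onI[OF phi(1)])
  have Gm[measurable]: "G \<in> borel_measurable borel" using G by simp
  have Hm[measurable]: "H \<in> borel_measurable borel" using H by simp
  have Vm[measurable]: "V \<in> borel_measurable borel" using V by simp
  have clB: "closed B" using comp by (simp add: compact_imp_closed)
  have [measurable]: "B \<in> sets borel" using clB by simp
  have BsubL: "B \<subseteq> L" using BL d by (meson centre_in_cball less_imp_le subset_eq)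
  have AsubB: "A \<subseteq> B" using AB d by (meson centre_in_cball less_imp_le subset_eq)
  obtain R where R: "\<And>x. x \<in> B \<Longrightarrow> norm x \<le> R"
    using compact_imp_bounded[OF comp(2)] unfolding bounded_iff by metis
  have phiR: "\<phi> x = 0" if "norm x > R" for x using phi(2)[of x] R[of x] AsubB that by auto
  have phiint: "integrable lborel \<phi>"
    using compact_support_integrable[OF phi(1), of R] phiR by auto
  obtain Mp where Mp: "Mp > 0" "\<And>x. norm (\<phi> x) \<le> Mp"
    using compact_support_bounded[OF phi(1), of R] phiR by auto
  obtain Mu where Mu: "Mu > 0" "\<And>x. \<bar>u x\<bar> \<le> Mu"
  proof -
    have "bounded (u ` L)" using u(2) comp(3) by (intro compact_imp_bounded compact_continuous_image)
    then obtain M where M: "M > 0" "\<And>x. x \<in> L \<Longrightarrow> norm (u x) \<le> M" unfolding bounded_pos by auto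
    have "\<bar>u x\<bar> \<le> M" for x using M u(3)[of x] by (cases "x \<in> L") auto
    with M(1) show ?thesis using that by blast
  qed
  have ucont: "isCont u x" if "x \<in> B" for x
  proof -
    have "continuous_on (ball x d) u"
      using u(2) BL[OF that] ball_subset_cball by (blast intro: continuous_on_subset)
    then show ?thesis using d by (simp add: continuous_on_eq_continuous_at)
  qed
  have finG: "(\<integral>\<^sup>+x. ennreal (norm (G x) powr p) \<partial>lborel) < \<infinity>"
    and finH: "(\<integral>\<^sup>+x. ennreal (norm (H x) powr p) \<partial>lborel) < \<infinity>"
    using G(2) H(2) by (auto simp: integrable_iff_bounded)
  \<comment> \<open>Besides a radius that is below \<open>d\<close> and tends to 0, the rate
    \<open>(1/2)^n\<close> is demanded of both mollified gradients, as
    \<open>fast_Lp_convergence\<close> requires.\<close>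
  define good where "good n k \<delta> \<longleftrightarrow> mollifier \<delta> k \<and> \<delta> \<le> d \<and> \<delta> \<le> 1 / real (Suc n) \<and>
      (\<integral>\<^sup>+x. ennreal (norm (conv k G x - G x) powr p) \<partial>lborel) \<le> ennreal ((1/2)^n) \<and>
      (\<integral>\<^sup>+x. ennreal (norm (conv k H x - H x) powr p) \<partial>lborel) \<le> ennreal ((1/2)^n)" for n k \<delta>
  have "\<exists>k \<delta>. good n k \<delta>" for n
  proof -
    have e: "(0::real) < (1/2)^n" by simp
    obtain dG where dG: "0 < dG" "\<And>\<delta> k. mollifier \<delta> k \<Longrightarrow> \<delta> \<le> dG \<Longrightarrow>
        (\<integral>\<^sup>+x. ennreal (norm (conv k G x - G x) powr p) \<partial>lborel) \<le> ennreal ((1/2)^n)"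
      by (rule mollify_Lp[OF G(1) p1 finG e]) blast
    obtain dH where dH: "0 < dH" "\<And>\<delta> k. mollifier \<delta> k \<Longrightarrow> \<delta> \<le> dH \<Longrightarrow>
        (\<integral>\<^sup>+x. ennreal (norm (conv k H x - H x) powr p) \<partial>lborel) \<le> ennreal ((1/2)^n)"
      by (rule mollify_Lp[OF H(1) p1 finH e]) blast
    define \<delta> where "\<delta> = min (min d (1 / real (Suc n))) (min dG dH)"
    have "0 < \<delta>" using d dG dH by (simp add: \<delta>_def)
    then obtain k :: "'a \<Rightarrow> real" where k: "mollifier \<delta> k" by (rule mollifier_ex)
    show ?thesis
      unfolding good_def
    proof (intro exI conjI)
      show "mollifier \<delta> k" by (rule k)
      show "\<delta> \<le> d" "\<delta> \<le> 1 / real (Suc n)" by (simp_all add: \<delta>_def)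
      show "(\<integral>\<^sup>+x. ennreal (norm (conv k G x - G x) powr p) \<partial>lborel) \<le> ennreal ((1/2)^n)"
        by (rule dG(2)[OF k]) (simp add: \<delta>_def)
      show "(\<integral>\<^sup>+x. ennreal (norm (conv k H x - H x) powr p) \<partial>lborel) \<le> ennreal ((1/2)^n)"
        by (rule dH(2)[OF k]) (simp add: \<delta>_def)
    qed
  qed
  then have "\<forall>n. \<exists>k \<delta>. good n k \<delta>" by blast
  then obtain k \<delta> where z: "\<And>n. good n (k n) (\<delta> n)" by (auto dest!: choice)
  have k: "mollifier (\<delta> n) (k n)" and \<delta>d: "\<delta> n \<le> d" and \<delta>n: "\<delta> n \<le> 1 / real (Suc n)"
    and kG: "(\<integral>\<^sup>+x. ennreal (norm (conv (k n) G x - G x) powr p) \<partial>lborel) \<le> ennreal ((1/2)^n)"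
    and kH: "(\<integral>\<^sup>+x. ennreal (norm (conv (k n) H x - H x) powr p) \<partial>lborel) \<le> ennreal ((1/2)^n)" for n
    using z[of n] by (simp_all add: good_def)
  have km[measurable]: "k n \<in> borel_measurable borel" for n by (rule mollifierD(8)[OF k])
  define a where "a n = conv (k n) H" for n
  define b where "b n = conv (k n) G" for n
  have am[measurable]: "a n \<in> borel_measurable borel" and bm[measurable]: "b n \<in> borel_measurable borel" for n
    unfolding a_def b_def by measurable
  obtain hG where hG: "integrable lborel hG" "\<And>x. 0 \<le> hG x"
    "AE x in lborel. (\<forall>n. norm (b n x - G x) powr p \<le> hG x) \<and> (\<lambda>n. b n x) \<longlonglongrightarrow> G x"
    by (rule fast_Lp_convergence[of b lborel G p]) (use kG p in \<open>auto simp: b_def\<close>)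
  obtain hH where hH: "integrable lborel hH" "\<And>x. 0 \<le> hH x"
    "AE x in lborel. (\<forall>n. norm (a n x - H x) powr p \<le> hH x) \<and> (\<lambda>n. a n x) \<longlonglongrightarrow> H x"
    by (rule fast_Lp_convergence[of a lborel H p]) (use kH p in \<open>auto simp: a_def\<close>)
  define U where "U n = conv (k n) u" for n
  define P where "P n = conv (k n) \<phi>" for n
  have Ucomm: "U n = conv u (k n)" for n unfolding U_def by (rule conv_commute) measurable
  have Pcomm: "P n = conv \<phi> (k n)" for n unfolding P_def by (rule conv_commute) measurable
  have UC: "C1_grad (U n) (conv u (grad (k n)))" for n
    unfolding Ucomm using conv_C1[OF u(1) mollifierD(10)[OF k], of "\<delta> n"] mollifierD(4,11)[OF k] by auto
  have PC: "C1_grad (P n) (conv \<phi> (grad (k n)))" for n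
    unfolding Pcomm using conv_C1[OF phiint mollifierD(10)[OF k], of "\<delta> n"] mollifierD(4,11)[OF k] by auto
  have Um: "m \<le> U n x" if x: "x \<in> B" for n x
    unfolding U_def
  proof (rule conv_mollifier_ge[OF u(1) k])
    fix y assume "norm (y - x) < \<delta> n"
    then have "y \<in> cball x d" using \<delta>d[of n] by (simp add: dist_norm norm_minus_commute)
    then show "m \<le> u y" using BL[OF x] m(2) by auto
  qed
  have UM: "\<bar>U n x\<bar> \<le> 3 * Mu" for n x
  proof -
    have "norm (U n x - u x) \<le> 2 * Mu"
      unfolding U_def
    proof (rule conv_mollifier_near[OF u(1) k])
      show "norm (u y - u x) \<le> 2 * Mu" for y using Mu(2)[of x] Mu(2)[of y] by (simp add: abs_le_iff)
    qed
    then show ?thesis using Mu(2)[of x] by (simp add: abs_le_iff)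
  qed
  have PM: "\<bar>P n x\<bar> \<le> 3 * Mp" for n x
  proof -
    have "norm (P n x - \<phi> x) \<le> 2 * Mp"
      unfolding P_def
    proof (rule conv_mollifier_near[OF phiint k])
      show "norm (\<phi> y - \<phi> x) \<le> 2 * Mp" for y using Mp(2)[of x] Mp(2)[of y] by (simp add: abs_le_iff)
    qed
    then show ?thesis using Mp(2)[of x] by (simp add: abs_le_iff)
  qed
  have P0: "P n x = 0" if x: "x \<notin> B" for n x
    unfolding P_def
  proof (rule conv_support[OF k])
    fix y assume "norm (y - x) < \<delta> n"
    then have "x \<in> cball y d" using \<delta>d[of n] by (simp add: dist_norm)
    then show "\<phi> y = 0" using AB[of y] x phi(2)[of y] by blast
  qed
  define v where "v x = \<phi> x / u x" for x
  \<comment> \<open>A quotient of mollifications rather than a mollified quotient: it is C^1 with an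
    explicit gradient, it vanishes off \<open>B\<close>, and on \<open>B\<close> its denominator is
    at least \<open>m\<close>.\<close>
  define vn where "vn n x = P n x / U n x" for n x
  define vn' where "vn' n x = (1 / U n x) *\<^sub>R (conv \<phi> (grad (k n)) x - vn n x *\<^sub>R conv u (grad (k n)) x)" for n x
  have [measurable]: "v \<in> borel_measurable borel" unfolding v_def by measurable
  have [measurable]: "U n \<in> borel_measurable borel" "P n \<in> borel_measurable borel" for n
    unfolding U_def P_def by measurable
  have [measurable]: "vn n \<in> borel_measurable borel" for n unfolding vn_def by measurable
  have Upos: "0 < U n x" if "x \<in> B" for n x using Um[OF that, of n] m by linarith
  have VC: "C1_grad (vn n) (vn' n)" for n
    using C1_grad_quotient(1)[OF PC[of n] UC[of n] clB P0 Upos]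
    by (simp add: vn_def[abs_def] vn'_def[abs_def])
  have P'0: "conv \<phi> (grad (k n)) x = 0" if "x \<notin> B" for n x
    using C1_grad_quotient(2)[OF PC[of n] UC[of n] clB P0 Upos that] .
  have vn0: "vn n x = 0" and vn'0: "vn' n x = 0" if "x \<notin> B" for n x
    using P0[OF that] P'0[OF that] by (auto simp: vn_def vn'_def)
  have vn'B: "vn' n x = (1 / U n x) *\<^sub>R (a n x - vn n x *\<^sub>R b n x)" if "x \<in> B" for n x
    using wu[OF k \<delta>d that] wphi[OF k \<delta>d that] by (simp add: vn'_def a_def b_def)
  define Cv where "Cv = 3 * Mp / m"
  have Cv0: "0 < Cv" using Mp m by (simp add: Cv_def)
  have vnM: "\<bar>vn n x\<bar> \<le> Cv" for n x
  proof (cases "x \<in> B")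
    case True
    then have "\<bar>vn n x\<bar> = \<bar>P n x\<bar> / U n x" using Upos[of x n] by (simp add: vn_def)
    also have "\<dots> \<le> (3 * Mp) / m"
      using PM[of n x] Um[OF True, of n] m Mp by (intro frac_le) auto
    finally show ?thesis by (simp add: Cv_def)
  qed (use vn0 Cv0 in auto)
  have vlim: "(\<lambda>n. vn n x) \<longlonglongrightarrow> v x" if "x \<in> B" for x
  proof -
    have "isCont \<phi> x" using phi(1) by (simp add: continuous_on_eq_continuous_at)
    then have "(\<lambda>n. P n x) \<longlonglongrightarrow> \<phi> x"
      unfolding P_def by (intro conv_mollifier_tendsto[OF phiint _ k \<delta>n])
    moreover have "(\<lambda>n. U n x) \<longlonglongrightarrow> u x"
      unfolding U_def by (intro conv_mollifier_tendsto[OF u(1) _ k \<delta>n] ucont that)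
    moreover have "u x \<noteq> 0" using m BsubL that by (metis less_le_not_le subsetD)
    ultimately show ?thesis unfolding vn_def v_def by (intro tendsto_divide)
  qed
  have Ulim: "(\<lambda>n. U n x) \<longlonglongrightarrow> u x" if "x \<in> B" for x
    unfolding U_def by (intro conv_mollifier_tendsto[OF u(1) _ k \<delta>n] ucont that)
  define s where "s t = \<bar>t\<bar> powr (p - 1) * sgn t" for t :: real
  have scont: "continuous_on UNIV s" unfolding s_def by (rule continuous_abs_powr_sgn[OF p1])
  have [measurable]: "s \<in> borel_measurable borel" by (rule borel_measurable_continuous_onI[OF scont])
  have pcont: "continuous_on UNIV (\<lambda>t::real. \<bar>t\<bar> powr p)"
    using p by (intro continuous_on_powr' continuous_intros) auto
  \<comment> \<open>One integrable majorant for all the gradient powers that occur, and for the sums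
    of two of them that arise from \<open>powr_mult_le_add\<close>.\<close>
  define D where "D x = norm (G x) powr p + 3 powr p * (hH x + norm (H x) powr p) + 3 powr p * (hG x + norm (G x) powr p)" for x
  have Dint: "integrable lborel D"
    unfolding D_def using G H hG hH by (intro Bochner_Integration.integrable_add integrable_mult_right)
  have AED: "AE x in lborel. (\<forall>n. norm (a n x) powr p \<le> D x) \<and> (\<forall>n. norm (b n x) powr p \<le> D x) \<and>
      norm (G x) powr p \<le> D x \<and> (\<forall>n. norm (G x) powr p + norm (a n x) powr p \<le> D x) \<and>
      (\<forall>n. norm (G x) powr p + norm (b n x) powr p \<le> D x) \<and>
      (\<forall>n. norm (a n x) powr p + norm (b n x) powr p \<le> D x) \<and>
      (\<lambda>n. a n x) \<longlonglongrightarrow> H x \<and> (\<lambda>n. b n x) \<longlonglongrightarrow> G x"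
    using hG(3) hH(3)
  proof eventually_elim
    case (elim x)
    have 1: "norm (a n x) powr p \<le> 3 powr p * (hH x + norm (H x) powr p)" for n
    proof -
      have "norm (a n x) powr p \<le> 3 powr p * (norm (a n x - H x) powr p + norm (H x) powr p)"
        using norm_powr_add_le[of p "a n x - H x" "H x"] p by simp
      also have "\<dots> \<le> 3 powr p * (hH x + norm (H x) powr p)"
        using elim by (intro mult_left_mono add_mono) auto
      finally show ?thesis .
    qed
    have 2: "norm (b n x) powr p \<le> 3 powr p * (hG x + norm (G x) powr p)" for n
    proof -
      have "norm (b n x) powr p \<le> 3 powr p * (norm (b n x - G x) powr p + norm (G x) powr p)"
        using norm_powr_add_le[of p "b n x - G x" "G x"] p by simp
      also have "\<dots> \<le> 3 powr p * (hG x + norm (G x) powr p)"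
        using elim by (intro mult_left_mono add_mono) auto
      finally show ?thesis .
    qed
    have 3: "0 \<le> norm (G x) powr p" by simp
    have 4: "0 \<le> 3 powr p * (hG x + norm (G x) powr p)" using hG(2)[of x] by simp
    have 5: "0 \<le> 3 powr p * (hH x + norm (H x) powr p)" using hH(2)[of x] by simp
    show ?case
    proof (intro conjI allI)
      fix n
      show "norm (a n x) powr p \<le> D x" "norm (b n x) powr p \<le> D x" "norm (G x) powr p \<le> D x"
        "norm (G x) powr p + norm (a n x) powr p \<le> D x"
        "norm (G x) powr p + norm (b n x) powr p \<le> D x"
        "norm (a n x) powr p + norm (b n x) powr p \<le> D x"
        unfolding D_def using 1[of n] 2[of n] 3 4 5 by linarith+
    qed (use elim in auto)
  qed
  \<comment> \<open>The integrand of the weak equation for the test function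
    \<open>\<bar>t\<bar> powr p * w\<close>, where \<open>ax\<close> and \<open>bx\<close> are the
    gradients of the numerator and the denominator of \<open>t\<close>. Only these four arguments
    are approximated; \<open>G\<close>, \<open>V\<close> and \<open>u\<close> in the body remain
    those of the equation.\<close>
  define E where "E = (\<lambda>t w ax bx x. indicator B x * (norm (G x) powr (p - 2) *
     (p * s t * (G x \<bullet> ax) - (p - 1) * \<bar>t\<bar> powr p * (G x \<bullet> bx)) + V x * u x powr (p - 1) * (\<bar>t\<bar> powr p * w)))"
  have E0: "(\<integral>x. E (vn n x) (U n x) (a n x) (b n x) x \<partial>lborel) = 0" for n
  proof -
    define \<psi> where "\<psi> x = \<bar>vn n x\<bar> powr p * U n x" for x
    define \<psi>' where "\<psi>' x = (p * (\<bar>vn n x\<bar> powr (p - 1) * sgn (vn n x)) * U n x) *\<^sub>R vn' n x +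
        \<bar>vn n x\<bar> powr p *\<^sub>R conv u (grad (k n)) x" for x
    have "C1_grad \<psi> \<psi>'" unfolding \<psi>_def[abs_def] \<psi>'_def[abs_def]
      by (rule C1_grad_powr_mult[OF VC UC p1])
    moreover have "\<psi> x = 0" "\<psi>' x = 0" if "x \<notin> B" for x
      using vn0[OF that] by (simp_all add: \<psi>_def \<psi>'_def)
    ultimately have "(\<integral>x. norm (G x) powr (p - 2) * (G x \<bullet> \<psi>' x) + V x * u x powr (p - 1) * \<psi> x \<partial>lborel) = 0"
      by (rule weak)
    also have "(\<lambda>x. norm (G x) powr (p - 2) * (G x \<bullet> \<psi>' x) + V x * u x powr (p - 1) * \<psi> x) =
        (\<lambda>x. E (vn n x) (U n x) (a n x) (b n x) x)"
    proof
      fix x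
      show "norm (G x) powr (p - 2) * (G x \<bullet> \<psi>' x) + V x * u x powr (p - 1) * \<psi> x = E (vn n x) (U n x) (a n x) (b n x) x"
      proof (cases "x \<in> B")
        case True
        have U: "U n x \<noteq> 0" using Upos[OF True, of n] by simp
        have "conv u (grad (k n)) x = b n x" using wu[OF k \<delta>d True] by (simp add: b_def)
        then have "\<psi>' x = (p * s (vn n x)) *\<^sub>R (a n x - vn n x *\<^sub>R b n x) + \<bar>vn n x\<bar> powr p *\<^sub>R b n x"
          unfolding \<psi>'_def vn'B[OF True] s_def using U by simp
        also have "\<dots> = (p * s (vn n x)) *\<^sub>R a n x - (p * (s (vn n x) * vn n x) - \<bar>vn n x\<bar> powr p) *\<^sub>R b n x"
          by (simp add: algebra_simps)
        \<comment> \<open>With this identity the two multiples of \<open>b n x\<close>, with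
          coefficients \<open>- p\<close> and 1 times \<open>\<bar>vn n x\<bar> powr p\<close>,
          combine to \<open>- (p - 1)\<close>.\<close>
        also have "s (vn n x) * vn n x = \<bar>vn n x\<bar> powr p"
        proof (cases "vn n x = 0")
          case False
          then show ?thesis by (simp add: s_def powr_diff mult.assoc abs_sgn[symmetric] mult.commute[of "sgn _"])
        qed (simp add: s_def)
        finally have "\<psi>' x = (p * s (vn n x)) *\<^sub>R a n x - ((p - 1) * \<bar>vn n x\<bar> powr p) *\<^sub>R b n x"
          by (simp add: algebra_simps)
        then show ?thesis using True by (simp add: E_def \<psi>_def inner_diff_right)
      next
        case False
        then show ?thesis using vn0[OF False] by (simp add: \<psi>_def \<psi>'_def E_def)
      qed
    qed
    finally show ?thesis .
  qed
  have GH: "\<bar>norm (G x) powr (p - 2) * (G x \<bullet> y)\<bar> \<le> norm (G x) powr p + norm y powr p" for x y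
  proof -
    have "\<bar>norm (G x) powr (p - 2) * (G x \<bullet> y)\<bar> \<le> norm (G x) powr (p - 2) * (norm (G x) * norm y)"
      unfolding abs_mult by (simp add: mult_left_mono Cauchy_Schwarz_ineq2)
    also have "\<dots> \<le> norm (G x) powr p + norm y powr p" using p by (intro powr_mult_le_add) auto
    finally show ?thesis .
  qed
  define c1 where "c1 = p * Cv powr (p - 1) + (p - 1) * Cv powr p"
  define c3 where "c3 = Mu powr (p - 1) * (Cv powr p * (3 * Mu))"
  have Elim: "(\<lambda>n. \<integral>x. E (vn n x) (U n x) (a n x) (b n x) x \<partial>lborel) \<longlonglongrightarrow>
      (\<integral>x. E (v x) (u x) (H x) (G x) x \<partial>lborel)"
    and Eint: "integrable lborel (\<lambda>x. E (v x) (u x) (H x) (G x) x)"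
  proof -
    have meas: "(\<lambda>x. E (f x) (g x) (y x) (z x) x) \<in> borel_measurable lborel"
      if [measurable]: "f \<in> borel_measurable borel" "g \<in> borel_measurable borel"
        "y \<in> borel_measurable borel" "z \<in> borel_measurable borel" for f g y z
      unfolding E_def by measurable
    have w: "integrable lborel (\<lambda>x. c1 * D x + c3 * \<bar>V x\<bar>)"
      using Dint V by (intro Bochner_Integration.integrable_add integrable_mult_right) auto
    have lim: "AE x in lborel. (\<lambda>n. E (vn n x) (U n x) (a n x) (b n x) x) \<longlonglongrightarrow> E (v x) (u x) (H x) (G x) x"
      using AED
    proof eventually_elim
      case (elim x)
      show ?case
      proof (cases "x \<in> B")
        case True
        have "(\<lambda>n. s (vn n x)) \<longlonglongrightarrow> s (v x)"
          by (rule continuous_on_tendsto_compose[OF scont vlim[OF True]]) auto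
        moreover have "(\<lambda>n. \<bar>vn n x\<bar> powr p) \<longlonglongrightarrow> \<bar>v x\<bar> powr p"
          by (rule continuous_on_tendsto_compose[OF pcont vlim[OF True]]) auto
        ultimately show ?thesis
          unfolding E_def using elim Ulim[OF True]
          by (intro tendsto_mult tendsto_add tendsto_diff tendsto_inner tendsto_const) blast+
      qed (simp add: E_def)
    qed
    have bd: "AE x in lborel. norm (E (vn n x) (U n x) (a n x) (b n x) x) \<le> c1 * D x + c3 * \<bar>V x\<bar>" for n
      using AED
    proof eventually_elim
      case (elim x)
      let ?t = "vn n x"
      have s1: "\<bar>s ?t\<bar> \<le> Cv powr (p - 1)"
      proof -
        have "\<bar>s ?t\<bar> \<le> \<bar>?t\<bar> powr (p - 1) * 1"
          unfolding s_def abs_mult by (intro mult_mono) (auto simp: sgn_if)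
        also have "\<dots> \<le> Cv powr (p - 1)" using vnM[of n x] p by (auto intro!: powr_mono2)
        finally show ?thesis .
      qed
      have s2: "\<bar>?t\<bar> powr p \<le> Cv powr p" using vnM[of n x] p by (auto intro!: powr_mono2)
      have D0: "0 \<le> D x" using elim order_trans[of 0 "norm (G x) powr p" "D x"] by simp
      have e1: "\<bar>norm (G x) powr (p - 2) * (p * s ?t * (G x \<bullet> a n x))\<bar> \<le> (p * Cv powr (p - 1)) * D x"
      proof -
        have "\<bar>norm (G x) powr (p - 2) * (p * s ?t * (G x \<bullet> a n x))\<bar> = (p * \<bar>s ?t\<bar>) * \<bar>norm (G x) powr (p - 2) * (G x \<bullet> a n x)\<bar>"
          using p by (simp add: abs_mult)
        also have "\<dots> \<le> (p * Cv powr (p - 1)) * (norm (G x) powr p + norm (a n x) powr p)"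
          using s1 p by (intro mult_mono GH) auto
        also have "\<dots> \<le> (p * Cv powr (p - 1)) * D x"
          using elim p by (intro mult_left_mono) auto
        finally show ?thesis .
      qed
      have e2: "\<bar>norm (G x) powr (p - 2) * ((p - 1) * \<bar>?t\<bar> powr p * (G x \<bullet> b n x))\<bar> \<le> ((p - 1) * Cv powr p) * D x"
      proof -
        have "\<bar>norm (G x) powr (p - 2) * ((p - 1) * \<bar>?t\<bar> powr p * (G x \<bullet> b n x))\<bar> = ((p - 1) * \<bar>?t\<bar> powr p) * \<bar>norm (G x) powr (p - 2) * (G x \<bullet> b n x)\<bar>"
          using p by (simp add: abs_mult)
        also have "\<dots> \<le> ((p - 1) * Cv powr p) * (norm (G x) powr p + norm (b n x) powr p)"
          using s2 p by (intro mult_mono GH) auto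
        also have "\<dots> \<le> ((p - 1) * Cv powr p) * D x"
          using elim p by (intro mult_left_mono) auto
        finally show ?thesis .
      qed
      have e3: "\<bar>V x * u x powr (p - 1) * (\<bar>?t\<bar> powr p * U n x)\<bar> \<le> c3 * \<bar>V x\<bar>" if xB: "x \<in> B"
      proof -
        have ux: "0 \<le> u x" using m(2)[of x] m(1) xB BsubL by force
        have "\<bar>V x * u x powr (p - 1) * (\<bar>?t\<bar> powr p * U n x)\<bar> = (u x powr (p - 1) * (\<bar>?t\<bar> powr p * \<bar>U n x\<bar>)) * \<bar>V x\<bar>"
          by (simp add: abs_mult)
        also have "\<dots> \<le> c3 * \<bar>V x\<bar>"
          unfolding c3_def using s2 vnM[of n x] UM[of n x] Mu ux Mu(2)[of x] p
          by (intro mult_right_mono mult_mono powr_mono2) auto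
        finally show ?thesis .
      qed
      have "c1 * D x = (p * Cv powr (p - 1)) * D x + ((p - 1) * Cv powr p) * D x"
        by (simp add: c1_def distrib_right)
      moreover have "0 \<le> c1 * D x + c3 * \<bar>V x\<bar>"
        using D0 p Mu by (auto simp: c1_def c3_def intro!: add_nonneg_nonneg mult_nonneg_nonneg)
      moreover have "\<bar>X - Y + Z\<bar> \<le> a + b + c" if "\<bar>X\<bar> \<le> a" "\<bar>Y\<bar> \<le> b" "\<bar>Z\<bar> \<le> c" for X Y Z a b c :: real
        using that by linarith
      note this[OF e1 e2 e3]
      ultimately show ?case
        by (cases "x \<in> B") (simp_all add: E_def right_diff_distrib)
    qed
    show "(\<lambda>n. \<integral>x. E (vn n x) (U n x) (a n x) (b n x) x \<partial>lborel) \<longlonglongrightarrow> (\<integral>x. E (v x) (u x) (H x) (G x) x \<partial>lborel)"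
      by (rule integral_dominated_convergence[OF _ _ w lim bd]) (intro meas; measurable)+
    show "integrable lborel (\<lambda>x. E (v x) (u x) (H x) (G x) x)"
      by (rule integrable_dominated_convergence[OF _ _ w lim bd]) (intro meas; measurable)+
  qed
  have Ezero: "(\<integral>x. E (v x) (u x) (H x) (G x) x \<partial>lborel) = 0"
    using Elim unfolding E0 by (simp add: LIMSEQ_const_iff)
  \<comment> \<open>Since \<open>u grad v = grad \<phi> - v grad u\<close>, the function
    \<open>W\<close> is \<open>u^p |grad v|^p\<close> on \<open>B\<close>, the remainder left by the
    convexity inequality.\<close>
  define Wn where "Wn n x = indicator B x * norm (a n x - vn n x *\<^sub>R b n x) powr p" for n x
  define W where "W x = indicator B x * norm (H x - v x *\<^sub>R G x) powr p" for x
  define c4 where "c4 = 3 powr p * (1 + Cv powr p)"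
  have Wlim: "(\<lambda>n. \<integral>x. Wn n x \<partial>lborel) \<longlonglongrightarrow> (\<integral>x. W x \<partial>lborel)"
    and Wint: "integrable lborel W" and Wnint: "\<And>n. integrable lborel (Wn n)"
  proof -
    have w: "integrable lborel (\<lambda>x. c4 * D x)" using Dint by (intro integrable_mult_right)
    have lim: "AE x in lborel. (\<lambda>n. Wn n x) \<longlonglongrightarrow> W x"
      using AED
    proof eventually_elim
      case (elim x)
      show ?case
      proof (cases "x \<in> B")
        case True
        have "(\<lambda>n. norm (a n x - vn n x *\<^sub>R b n x)) \<longlonglongrightarrow> norm (H x - v x *\<^sub>R G x)"
          using elim vlim[OF True] by (intro tendsto_intros) auto
        then have "(\<lambda>n. norm (a n x - vn n x *\<^sub>R b n x) powr p) \<longlonglongrightarrow> norm (H x - v x *\<^sub>R G x) powr p"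
          using p by (intro tendsto_powr') auto
        then show ?thesis using True by (simp add: Wn_def W_def)
      qed (simp add: Wn_def W_def)
    qed
    have bd: "AE x in lborel. norm (Wn n x) \<le> c4 * D x" for n
      using AED
    proof eventually_elim
      case (elim x)
      have "norm (a n x + (- vn n x) *\<^sub>R b n x) powr p \<le> 3 powr p * (norm (a n x) powr p + norm ((- vn n x) *\<^sub>R b n x) powr p)"
        using p by (intro norm_powr_add_le) auto
      also have "norm ((- vn n x) *\<^sub>R b n x) powr p = \<bar>vn n x\<bar> powr p * norm (b n x) powr p"
        by (simp add: powr_mult)
      also have "\<dots> \<le> Cv powr p * D x"
        using elim vnM[of n x] p by (intro mult_mono powr_mono2) auto
      also have "3 powr p * (norm (a n x) powr p + Cv powr p * D x) \<le> 3 powr p * (D x + Cv powr p * D x)"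
        using elim by (intro mult_left_mono add_mono) auto
      also have "\<dots> = c4 * D x" by (simp add: c4_def algebra_simps)
      finally have *: "norm (a n x - vn n x *\<^sub>R b n x) powr p \<le> c4 * D x" by simp
      then have "0 \<le> c4 * D x" using order_trans[OF powr_ge_zero] by blast
      with * show ?case by (auto simp: Wn_def indicator_def)
    qed
    have mW: "W \<in> borel_measurable lborel" unfolding W_def[abs_def] by measurable
    have mWn: "Wn n \<in> borel_measurable lborel" for n unfolding Wn_def[abs_def] by measurable
    show "(\<lambda>n. \<integral>x. Wn n x \<partial>lborel) \<longlonglongrightarrow> (\<integral>x. W x \<partial>lborel)"
      by (rule integral_dominated_convergence[OF mW mWn w lim bd])
    show "integrable lborel W"
      by (rule integrable_dominated_convergence[OF mW mWn w lim bd])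
    show "integrable lborel (Wn n)" for n
      by (rule integrable_dominated_convergence2[OF mW mWn w lim bd])
  qed
  define Q where "Q = (\<integral>x. indicator B x * (norm (H x) powr p + V x * \<bar>\<phi> x\<bar> powr p) \<partial>lborel)"
  have Vphi: "integrable lborel (\<lambda>x. V x * \<bar>\<phi> x\<bar> powr p)"
  proof (rule Bochner_Integration.integrable_bound[where f="\<lambda>x. Mp powr p * \<bar>V x\<bar>"])
    show "AE x in lborel. norm (V x * \<bar>\<phi> x\<bar> powr p) \<le> norm (Mp powr p * \<bar>V x\<bar>)"
    proof (rule AE_I2)
      fix x
      have "\<bar>\<phi> x\<bar> powr p \<le> Mp powr p" using Mp(2)[of x] p by (intro powr_mono2) auto
      then show "norm (V x * \<bar>\<phi> x\<bar> powr p) \<le> norm (Mp powr p * \<bar>V x\<bar>)"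
        by (auto simp: abs_mult mult.commute intro!: mult_left_mono)
    qed
  qed (use V in auto)
  have "2 powr (1 - p) * (\<integral>x. W x \<partial>lborel) \<le> Q"
  proof -
    have Qint: "integrable lborel (\<lambda>x. indicator B x * (norm (H x) powr p + V x * \<bar>\<phi> x\<bar> powr p))"
      using H(2) Vphi integrable_real_mult_indicator[of B lborel "\<lambda>x. norm (H x) powr p + V x * \<bar>\<phi> x\<bar> powr p"]
      by (simp add: mult.commute)
    have "2 powr (1 - p) * (\<integral>x. W x \<partial>lborel) = (\<integral>x. 2 powr (1 - p) * W x \<partial>lborel)" by simp
    \<comment> \<open>Subtracting \<open>E\<close> does not change the integral, by
      \<open>Ezero\<close>. Pointwise the potential terms cancel, because
      \<open>u powr (p - 1) * (\<bar>v\<bar> powr p * u)\<close> is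
      \<open>\<bar>\<phi>\<bar> powr p\<close>, and the right-hand side of
      \<open>picone_pointwise\<close> remains.\<close>
    also have "\<dots> \<le> (\<integral>x. indicator B x * (norm (H x) powr p + V x * \<bar>\<phi> x\<bar> powr p) - E (v x) (u x) (H x) (G x) x \<partial>lborel)"
    proof (rule Bochner_Integration.integral_mono)
      fix x
      show "2 powr (1 - p) * W x \<le> indicator B x * (norm (H x) powr p + V x * \<bar>\<phi> x\<bar> powr p) - E (v x) (u x) (H x) (G x) x"
      proof (cases "x \<in> B")
        case True
        then have ux: "0 < u x" using m BsubL by (metis less_le_trans subsetD)
        have "u x powr (p - 1) * (\<bar>v x\<bar> powr p * u x) = \<bar>v x\<bar> powr p * u x powr p"
          using ux by (simp add: powr_diff)
        also have "\<dots> = \<bar>\<phi> x\<bar> powr p"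
          using ux by (simp add: v_def powr_divide)
        finally have "u x powr (p - 1) * (\<bar>v x\<bar> powr p * u x) = \<bar>\<phi> x\<bar> powr p" .
        then have eqV: "V x * u x powr (p - 1) * (\<bar>v x\<bar> powr p * u x) = V x * \<bar>\<phi> x\<bar> powr p"
          by (simp add: mult.assoc)
        show ?thesis
          using picone_pointwise[OF p(1), of "H x" "v x" "G x"] True
          unfolding W_def E_def s_def eqV by simp
      qed (simp add: W_def E_def)
    qed (use Wint Qint Eint in auto)
    also have "\<dots> = Q" using Qint Eint Ezero by (simp add: Q_def)
    finally show ?thesis .
  qed
  then have WQ: "(\<integral>x. W x \<partial>lborel) \<le> 2 powr (p - 1) * Q"
    using powr_gt_zero[of 2 "p - 1"] by (simp add: powr_diff field_simps)
  define c where "c = \<gamma> * (1 / m) powr p"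
  have c0: "0 < c"
  proof -
    have "p * (N - 1) / (N - p) > 0" using p by (intro divide_pos_pos mult_pos_pos) auto
    then have "p * (N - 1) / (N - p) \<noteq> 0" "1 / m \<noteq> 0" using m by (metis less_irrefl, simp)
    then show ?thesis unfolding c_def \<gamma>_def by (intro mult_pos_pos) (simp_all only: powr_gt_zero not_False_eq_True)
  qed
  define X where "X n = (\<integral>\<^sup>+x. ennreal (\<bar>vn n x\<bar> powr q) \<partial>lborel)" for n
  have vnR: "vn n x = 0" if "norm x > R" for n x
    using vn0[of x n] R[of x] that by (meson not_le)
  \<comment> \<open>On \<open>B\<close> the factor \<open>1 / U n\<close> in \<open>vn'\<close> is
    at most \<open>1 / m\<close>; here the weight of the ground state energy is dropped.\<close>
  have sob: "epow (X n) (1 - p / N) \<le> ennreal (c * (\<integral>x. Wn n x \<partial>lborel))" for n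
  proof -
    have "epow (X n) (1 - p / N) \<le> ennreal \<gamma> * (\<integral>\<^sup>+x. ennreal (norm (vn' n x) powr p) \<partial>lborel)"
      unfolding X_def q_def \<gamma>_def N_def
      by (rule sobolev_C1[OF VC, where R=R]) (use vnR p1 p N2 in \<open>auto simp: N_def\<close>)
    also have "\<dots> \<le> ennreal \<gamma> * (\<integral>\<^sup>+x. ennreal ((1 / m) powr p * Wn n x) \<partial>lborel)"
    proof (intro mult_left_mono nn_integral_mono ennreal_leI)
      fix x
      show "norm (vn' n x) powr p \<le> (1 / m) powr p * Wn n x"
      proof (cases "x \<in> B")
        case True
        have "norm (vn' n x) powr p = (1 / U n x) powr p * norm (a n x - vn n x *\<^sub>R b n x) powr p"
          unfolding vn'B[OF True] using Upos[OF True, of n] by (simp add: powr_mult[symmetric])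
        also have "\<dots> \<le> (1 / m) powr p * norm (a n x - vn n x *\<^sub>R b n x) powr p"
          using Upos[OF True, of n] Um[OF True, of n] m p
          by (intro mult_right_mono powr_mono2 frac_le) auto
        finally show ?thesis using True by (simp add: Wn_def)
      next
        case False
        then show ?thesis using vn'0[OF False] by (simp add: Wn_def)
      qed
    qed auto
    also have "(\<integral>\<^sup>+x. ennreal ((1 / m) powr p * Wn n x) \<partial>lborel) = ennreal (\<integral>x. (1 / m) powr p * Wn n x \<partial>lborel)"
    proof (rule nn_integral_eq_integral)
      show "integrable lborel (\<lambda>x. (1 / m) powr p * Wn n x)" by (intro integrable_mult_right Wnint)
    qed (simp add: Wn_def)
    also have "ennreal \<gamma> * \<dots> = ennreal (c * (\<integral>x. Wn n x \<partial>lborel))"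
      by (simp add: c_def \<gamma>_def ennreal_mult'[symmetric] mult.assoc)
    finally show ?thesis .
  qed
  have pN: "0 < 1 - p / N" using p by simp
  have "(1 - p / N) * (1 / (1 - p / N)) = 1" "(1 / (1 - p / N)) * (1 - p / N) = 1"
    using pN by (metis less_irrefl mult.commute nonzero_mult_div_cancel_left times_divide_eq_right mult.right_neutral)+
  then have cancel: "epow (epow x (1 - p / N)) (1 / (1 - p / N)) = x"
    "epow (epow x (1 / (1 - p / N))) (1 - p / N) = x" for x
    by (simp_all only: epow_epow epow_1)
  \<comment> \<open>A number \<open>T\<close> strictly above the limit bounds the right-hand sides
    of \<open>sob\<close> eventually. The power is inverted so that \<open>X n\<close> itself is
    bounded, and Fatou's lemma passes to \<open>v\<close>.\<close>
  have main: "epow (\<integral>\<^sup>+x. ennreal (\<bar>v x\<bar> powr q) \<partial>lborel) (1 - p / N) \<le> ennreal T"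
    if T: "c * (\<integral>x. W x \<partial>lborel) < T" for T
  proof -
    have "(\<lambda>n. c * (\<integral>x. Wn n x \<partial>lborel)) \<longlonglongrightarrow> c * (\<integral>x. W x \<partial>lborel)"
      using Wlim by (intro tendsto_intros)
    then have "\<forall>\<^sub>F n in sequentially. c * (\<integral>x. Wn n x \<partial>lborel) < T"
      using T by (rule order_tendstoD(2))
    then have ev: "\<forall>\<^sub>F n in sequentially. X n \<le> epow (ennreal T) (1 / (1 - p / N))"
    proof eventually_elim
      case (elim n)
      have "epow (X n) (1 - p / N) \<le> ennreal T"
        using sob[of n] elim by (meson ennreal_leI less_imp_le order_trans)
      then have "epow (epow (X n) (1 - p / N)) (1 / (1 - p / N)) \<le> epow (ennreal T) (1 / (1 - p / N))"
        using pN by (intro epow_mono) auto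
      then show ?case unfolding cancel .
    qed
    have "(\<integral>\<^sup>+x. ennreal (\<bar>v x\<bar> powr q) \<partial>lborel) \<le> (\<integral>\<^sup>+x. liminf (\<lambda>n. ennreal (\<bar>vn n x\<bar> powr q)) \<partial>lborel)"
    proof (rule nn_integral_mono)
      fix x
      show "ennreal (\<bar>v x\<bar> powr q) \<le> liminf (\<lambda>n. ennreal (\<bar>vn n x\<bar> powr q))"
      proof (cases "x \<in> B")
        case True
        have "(\<lambda>n. \<bar>vn n x\<bar> powr q) \<longlonglongrightarrow> \<bar>v x\<bar> powr q"
          using q0 vlim[OF True] by (intro tendsto_powr' tendsto_intros) auto
        then have "liminf (\<lambda>n. ennreal (\<bar>vn n x\<bar> powr q)) = ennreal (\<bar>v x\<bar> powr q)"
          by (intro lim_imp_Liminf) auto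
        then show ?thesis by simp
      next
        case False
        then have "v x = 0" using phi(2)[of x] AsubB by (auto simp: v_def)
        then show ?thesis by simp
      qed
    qed
    also have "\<dots> \<le> liminf X" unfolding X_def by (rule nn_integral_liminf) measurable
    also have "\<dots> \<le> epow (ennreal T) (1 / (1 - p / N))"
    proof -
      have "liminf X \<le> liminf (\<lambda>_. epow (ennreal T) (1 / (1 - p / N)))"
        using ev by (rule Liminf_mono)
      then show ?thesis by (simp add: Liminf_const)
    qed
    finally have "epow (\<integral>\<^sup>+x. ennreal (\<bar>v x\<bar> powr q) \<partial>lborel) (1 - p / N) \<le> epow (epow (ennreal T) (1 / (1 - p / N))) (1 - p / N)"
      using pN by (intro epow_mono) auto
    then show ?thesis unfolding cancel .
  qed
  have "epow (\<integral>\<^sup>+x. ennreal (\<bar>v x\<bar> powr q) \<partial>lborel) (1 - p / N) \<le> ennreal (c * (\<integral>x. W x \<partial>lborel))"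
  proof (rule ennreal_le_epsilon)
    fix e :: real assume e: "0 < e"
    have W0: "0 \<le> c * (\<integral>x. W x \<partial>lborel)"
      using c0 by (intro mult_nonneg_nonneg Bochner_Integration.integral_nonneg) (auto simp: W_def)
    have "epow (\<integral>\<^sup>+x. ennreal (\<bar>v x\<bar> powr q) \<partial>lborel) (1 - p / N) \<le> ennreal (c * (\<integral>x. W x \<partial>lborel) + e)"
      using e by (intro main) auto
    then show "epow (\<integral>\<^sup>+x. ennreal (\<bar>v x\<bar> powr q) \<partial>lborel) (1 - p / N) \<le> ennreal (c * (\<integral>x. W x \<partial>lborel)) + ennreal e"
      using W0 e by simp
  qed
  also have "\<dots> \<le> ennreal (c * (2 powr (p - 1) * Q))"
    using WQ c0 by (intro ennreal_leI mult_left_mono) auto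
  finally show ?thesis
    by (simp add: v_def q_def c_def \<gamma>_def Q_def mult.assoc)
qed

section \<open>Consequences of the mean value condition\<close>

lemma recip_hoelder_conj:
  assumes "1 \<le> s"
  shows "recip (hoelder_conj s) = 1 - recip s"
proof (cases s)
  case (real a)
  then have a: "1 \<le> a" using assms by simp
  show ?thesis
  proof (cases "a = 1")
    case True
    then show ?thesis using real by (simp add: recip_def hoelder_conj_def one_ereal_def)
  next
    case False
    then have "hoelder_conj s = ereal (a / (a - 1))"
      using real by (simp add: hoelder_conj_def one_ereal_def)
    then show ?thesis using a False real by (simp add: recip_def one_ereal_def field_simps)
  qed
qed (use assms in \<open>auto simp: recip_def hoelder_conj_def one_ereal_def\<close>)

lemma recip_bounds:
  assumes "1 \<le> s"
  shows "0 \<le> recip s" "recip s \<le> 1"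
  using assms by (cases s; auto simp: recip_def one_ereal_def)+

lemma recip_ereal: "a \<noteq> 0 \<Longrightarrow> recip (ereal a) = 1 / a"
  by (simp add: recip_def one_ereal_def)

lemma real_of_hoelder_conj: "1 < a \<Longrightarrow> real_of_ereal (hoelder_conj (ereal a)) = a / (a - 1)"
  by (simp add: hoelder_conj_def one_ereal_def)

text \<open>\<open>S\<close> takes up at least half of \<open>A\<close>, as each of two balls of
  equal measure does in their union, whether they overlap or not; hence the loss of a factor
  2.\<close>

lemma average_ge:
  fixes A S :: "'a::euclidean_space set"
  assumes A: "A \<in> sets lebesgue" "0 < emeasure lebesgue A" "emeasure lebesgue A < \<infinity>"
    and S: "S \<in> sets lebesgue" "S \<subseteq> A" "emeasure lebesgue A \<le> 2 * emeasure lebesgue S"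
    and f: "\<And>x. x \<in> S \<Longrightarrow> c \<le> f x" and c: "0 \<le> c"
  shows "ennreal (c / 2) \<le> average A f"
proof -
  let ?m = "emeasure lebesgue"
  have "ennreal (c / 2) * ?m A \<le> ennreal (c / 2) * (2 * ?m S)"
    using S(3) by (intro mult_left_mono) auto
  also have "\<dots> = ennreal c * ?m S"
    using c by (simp add: mult.assoc[symmetric] ennreal_mult[symmetric] flip: ennreal_numeral)
  also have "\<dots> = (\<integral>\<^sup>+x. ennreal c * indicator S x \<partial>lebesgue)"
    using S(1) by (simp add: nn_integral_cmult_indicator)
  also have "\<dots> \<le> (\<integral>\<^sup>+x. ennreal (f x) * indicator A x \<partial>lebesgue)"
    using S(2) f by (intro nn_integral_mono) (auto simp: indicator_def intro!: ennreal_leI)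
  also have "\<dots> = (\<integral>\<^sup>+x. ennreal (f x) \<partial>lebesgue_on A)"
    using A(1) by (subst nn_integral_restrict_space) auto
  finally have *: "ennreal (c / 2) * ?m A \<le> (\<integral>\<^sup>+x. ennreal (f x) \<partial>lebesgue_on A)" .
  have "ennreal (c / 2) = ennreal (c / 2) * ?m A / ?m A"
    using A by (simp add: ennreal_mult_divide_eq less_top)
  also have "\<dots> \<le> average A f" unfolding average_def by (rule divide_right_mono_ennreal[OF *])
  finally show ?thesis .
qed

lemma ennpow_mono: "x \<le> y \<Longrightarrow> 0 < a \<Longrightarrow> ennpow x a \<le> ennpow y a"
  using epow_mono[of x y a] by (simp add: epow_def)

text \<open>The factor 1/2 lost in an average becomes \<open>(1 / 2) powr (1 / e)\<close>, which for
  \<open>e \<ge> 1\<close> is at least 1/2; the constants below are thus independent of the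
  exponents.\<close>

lemma half_powr_ge:
  fixes t e :: real
  assumes "0 \<le> t" "1 \<le> e"
  shows "t / 2 \<le> (t powr e / 2) powr (1 / e)"
proof -
  have "(t powr e / 2) powr (1 / e) = t * (1 / 2) powr (1 / e)"
    using assms by (cases "t = 0") (auto simp: powr_divide powr_powr)
  moreover have "(1 / 2) powr 1 \<le> (1 / 2 :: real) powr (1 / e)"
    using assms by (intro powr_mono') auto
  ultimately show ?thesis using assms mult_left_mono[of "1/2" "(1/2) powr (1/e)" t] by simp
qed

lemma average_powr_ge:
  fixes A S :: "'a::euclidean_space set"
  assumes A: "A \<in> sets lebesgue" "0 < emeasure lebesgue A" "emeasure lebesgue A < \<infinity>"
    and S: "S \<in> sets lebesgue" "S \<subseteq> A" "emeasure lebesgue A \<le> 2 * emeasure lebesgue S"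
    and f: "\<And>x. x \<in> S \<Longrightarrow> t powr e \<le> f x" and t: "0 \<le> t" and e: "1 \<le> e"
  shows "ennreal (t / 2) \<le> ennpow (average A f) (1 / e)"
proof -
  have "ennreal (t / 2) \<le> ennreal ((t powr e / 2) powr (1 / e))"
    by (rule ennreal_leI[OF half_powr_ge[OF t e]])
  also have "\<dots> = ennpow (ennreal (t powr e / 2)) (1 / e)" by (simp add: ennpow_def)
  also have "\<dots> \<le> ennpow (average A f) (1 / e)"
    using e by (intro ennpow_mono average_ge[OF A S] f) auto
  finally show ?thesis .
qed

lemma upper_mean_ge:
  fixes A S :: "'a::euclidean_space set"
  assumes A: "A \<in> sets lebesgue" "0 < emeasure lebesgue A" "emeasure lebesgue A < \<infinity>"
    and S: "S \<in> sets lebesgue" "S \<subseteq> A" "emeasure lebesgue A \<le> 2 * emeasure lebesgue S"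
    and u: "\<And>x. x \<in> S \<Longrightarrow> t \<le> u x" and t: "0 < t"
    and par: "1 \<le> \<alpha>" "1 \<le> \<beta>" "1 < p" "1 < r"
  shows "ennreal (t powr recip (hoelder_conj \<beta>) / 2) \<le> upper_mean \<alpha> \<beta> p r u A"
proof -
  define s where "s = recip (hoelder_conj \<beta>)"
  have s: "0 \<le> s" using recip_hoelder_conj[OF par(2)] recip_bounds[OF par(2)] by (simp add: s_def)
  show ?thesis
  proof (cases "\<alpha> = 1")
    case True
    let ?g = "\<lambda>x. ennreal (u x powr s)"
    \<comment> \<open>Otherwise \<open>S\<close> would be a null set, although it has at least half
      of the positive measure of \<open>A\<close>.\<close>
    have "ennreal (t powr s) \<le> esssup (lebesgue_on A) ?g"
    proof (rule ccontr)
      assume "\<not> ?thesis"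
      then have less: "esssup (lebesgue_on A) ?g < ennreal (t powr s)" by simp
      have "AE x in lebesgue_on A. x \<notin> S"
        using esssup_AE[of ?g "lebesgue_on A"]
      proof eventually_elim
        case (elim x)
        show ?case
        proof
          assume "x \<in> S"
          then have "ennreal (t powr s) \<le> ?g x"
            using u t s by (intro ennreal_leI powr_mono2) auto
          then have "ennreal (t powr s) \<le> esssup (lebesgue_on A) ?g" using elim by (rule order_trans)
          then show False using less by (meson leD)
        qed
      qed
      then have "AE x in lebesgue. x \<in> A \<longrightarrow> x \<notin> S"
        using A(1) by (subst (asm) AE_restrict_space_iff) auto
      then have "AE x in lebesgue. x \<notin> S" by eventually_elim (use S in auto)
      then have "emeasure lebesgue S = 0"
        using S(1) AE_iff_null_sets[OF S(1)] by (simp add: null_sets_def)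
      then show False using S(3) A(2) by simp
    qed
    moreover have "ennreal (t powr s / 2) \<le> ennreal (t powr s)"
      by (intro ennreal_leI) simp
    ultimately have "ennreal (t powr s / 2) \<le> esssup (lebesgue_on A) ?g" by (rule order_trans[rotated])
    then show ?thesis using True by (simp add: upper_mean_def s_def)
  next
    case False
    then have a: "1 < \<alpha>" using par by simp
    define \<alpha>' where "\<alpha>' = real_of_ereal (hoelder_conj (ereal \<alpha>))"
    have a': "1 \<le> \<alpha>'" using a by (simp add: \<alpha>'_def real_of_hoelder_conj)
    define e where "e = \<alpha>' * p * r"
    have e: "1 \<le> e"
    proof -
      have "1 * 1 * 1 \<le> \<alpha>' * p * r" using a' par by (intro mult_mono) auto
      then show ?thesis by (simp add: e_def)
    qed
    have "ennreal (t powr s / 2) \<le> ennpow (average A (\<lambda>x. u x powr (e * s))) (1 / e)"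
    proof (rule average_powr_ge[OF A S])
      fix x assume "x \<in> S"
      then show "(t powr s) powr e \<le> u x powr (e * s)"
        using u[of x] t s e by (auto simp: powr_powr mult.commute intro!: powr_mono2)
    qed (use e in auto)
    then show ?thesis
      using False by (simp add: upper_mean_def Let_def \<alpha>'_def e_def s_def)
  qed
qed

lemma lower_mean_ge:
  fixes A S :: "'a::euclidean_space set"
  assumes A: "A \<in> sets lebesgue" "0 < emeasure lebesgue A" "emeasure lebesgue A < \<infinity>"
    and S: "S \<in> sets lebesgue" "S \<subseteq> A" "emeasure lebesgue A \<le> 2 * emeasure lebesgue S"
    and u: "\<And>x. x \<in> S \<Longrightarrow> 0 < u x \<and> u x \<le> t" and t: "0 < t"
    and par: "1 < p" "1 < r"
  shows "ennreal (1 / (2 * t)) \<le> lower_mean p r u A"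
proof -
  define p' where "p' = real_of_ereal (hoelder_conj (ereal p))"
  have p': "1 \<le> p'" using par by (simp add: p'_def real_of_hoelder_conj)
  define e where "e = p' * r"
  have e: "1 \<le> e" using mult_mono[of 1 p' 1 r] p' par by (simp add: e_def)
  have "ennreal ((1 / t) / 2) \<le> ennpow (average A (\<lambda>x. u x powr (- e))) (1 / e)"
  proof (rule average_powr_ge[OF A S])
    fix x assume "x \<in> S"
    then have "u x powr e \<le> t powr e" "0 < u x powr e" using u[of x] e by (auto intro!: powr_mono2)
    then show "(1 / t) powr e \<le> u x powr (- e)"
      using t by (simp add: powr_minus powr_divide field_simps)
  qed (use e t in auto)
  then show ?thesis by (simp add: lower_mean_def Let_def p'_def e_def mult.commute)
qed

text \<open>The 16 collects four factors 2: from \<open>u \<ge> u x / 2\<close> near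
  \<open>x\<close>, where \<open>recip (hoelder_conj \<beta>) \<le> 1\<close> is used, from
  \<open>u \<le> 2 * u y\<close> near \<open>y\<close>, and from the halves in the two means. The
  exponent of the measure is kept general: it is first determined and then set to 0.\<close>

lemma mean_bound_pointwise:
  fixes u :: "'a::euclidean_space \<Rightarrow> real"
  assumes \<Omega>: "open \<Omega>" and u: "continuous_on \<Omega> u" "\<And>x. x \<in> \<Omega> \<Longrightarrow> 0 < u x"
    and par: "1 \<le> \<alpha>" "1 \<le> \<beta>" "1 < p" "1 < r" and C: "0 < C"
    and bound: "\<And>A. A \<in> sets lebesgue \<Longrightarrow> A \<subseteq> \<Omega> \<Longrightarrow> 0 < emeasure lebesgue A \<Longrightarrow> emeasure lebesgue A < \<infinity> \<Longrightarrow>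
         ennreal (measure lebesgue A powr \<theta>) * upper_mean \<alpha> \<beta> p r u A * lower_mean p r u A < ennreal C"
    and xy: "x \<in> \<Omega>" "y \<in> \<Omega>"
  shows "\<exists>\<rho>0>0. \<forall>\<rho>. 0 < \<rho> \<longrightarrow> \<rho> < \<rho>0 \<longrightarrow>
     measure lebesgue (ball x \<rho> \<union> ball y \<rho>) powr \<theta> * u x powr recip (hoelder_conj \<beta>) \<le> 16 * C * u y"
proof -
  define s where "s = recip (hoelder_conj \<beta>)"
  have s: "0 \<le> s" "s \<le> 1"
    using recip_hoelder_conj[OF par(2)] recip_bounds[OF par(2)] by (simp_all add: s_def)
  obtain ex where ex: "0 < ex" "cball x ex \<subseteq> \<Omega>" using \<Omega> xy open_contains_cball by metis
  obtain ey where ey: "0 < ey" "cball y ey \<subseteq> \<Omega>" using \<Omega> xy open_contains_cball by metis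
  have "isCont u x" "isCont u y" using u(1) \<Omega> xy by (auto simp: continuous_on_eq_continuous_at)
  moreover have "0 < u x / 2" "0 < u y" using u(2) xy by auto
  ultimately obtain dx dy where dx: "0 < dx" "\<And>z. dist z x < dx \<Longrightarrow> dist (u z) (u x) < u x / 2"
    and dy: "0 < dy" "\<And>z. dist z y < dy \<Longrightarrow> dist (u z) (u y) < u y"
    unfolding continuous_at_eps_delta by metis
  show ?thesis
  proof (intro exI[of _ "min (min ex ey) (min dx dy)"] conjI allI impI)
    fix \<rho> :: real assume \<rho>: "0 < \<rho>" "\<rho> < min (min ex ey) (min dx dy)"
    define A where "A = ball x \<rho> \<union> ball y \<rho>"
    let ?m = "emeasure lebesgue"
    have eqm: "?m (ball x \<rho>) = ?m (ball y \<rho>)"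
      using \<rho> by (simp add: emeasure_ball)
    have fin: "?m (ball x \<rho>) < \<infinity>" using emeasure_lborel_ball_finite[of x \<rho>] by simp
    have A: "A \<in> sets lebesgue" by (simp add: A_def)
    have le: "?m A \<le> 2 * ?m (ball x \<rho>)" "?m A \<le> 2 * ?m (ball y \<rho>)"
      using emeasure_subadditive[of "ball x \<rho>" lebesgue "ball y \<rho>"] eqm by (auto simp: A_def mult_2)
    have "0 < measure lborel (ball x \<rho>)" using \<rho> by (intro content_ball_pos)
    then have "0 < ?m (ball x \<rho>)" by (auto simp: measure_def zero_less_iff_neq_zero)
    then have pos: "0 < ?m A"
      using emeasure_mono[of "ball x \<rho>" A lebesgue] A by (auto simp: A_def)
    have finA: "?m A < \<infinity>" using le(1) fin by (auto simp: ennreal_mult_less_top intro: le_less_trans)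
    have sub: "A \<subseteq> \<Omega>" using \<rho> ex ey by (auto simp: A_def subset_eq)
    have "ennreal ((u x / 2) powr s / 2) \<le> upper_mean \<alpha> \<beta> p r u A"
      unfolding s_def
    proof (rule upper_mean_ge[OF A pos finA _ _ le(1) _ _ par])
      fix z assume "z \<in> ball x \<rho>"
      then have "dist (u z) (u x) < u x / 2" using \<rho> by (intro dx) (auto simp: dist_commute)
      then show "u x / 2 \<le> u z" unfolding dist_real_def by linarith
    qed (use u xy in \<open>auto simp: A_def\<close>)
    moreover have "ennreal (1 / (2 * (2 * u y))) \<le> lower_mean p r u A"
    proof (rule lower_mean_ge[OF A pos finA _ _ le(2) _ _ par(3,4)])
      fix z assume z: "z \<in> ball y \<rho>"
      then have "dist (u z) (u y) < u y" using \<rho> by (intro dy) (auto simp: dist_commute)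
      then have "u z \<le> 2 * u y" unfolding dist_real_def by linarith
      moreover have "z \<in> \<Omega>" using z sub by (auto simp: A_def)
      ultimately show "0 < u z \<and> u z \<le> 2 * u y" using u(2) by auto
    qed (use u xy in \<open>auto simp: A_def\<close>)
    ultimately have "ennreal (measure lebesgue A powr \<theta>) * ennreal ((u x / 2) powr s / 2) * ennreal (1 / (2 * (2 * u y)))
        \<le> ennreal (measure lebesgue A powr \<theta>) * upper_mean \<alpha> \<beta> p r u A * lower_mean p r u A"
      by (intro mult_mono) auto
    also have "\<dots> < ennreal C" by (rule bound[OF A sub pos finA])
    also have "ennreal (measure lebesgue A powr \<theta>) * ennreal ((u x / 2) powr s / 2) * ennreal (1 / (2 * (2 * u y))) =
        ennreal (measure lebesgue A powr \<theta> * ((u x / 2) powr s / 2) * (1 / (2 * (2 * u y))))"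
    proof -
      have "ennreal a * ennreal b * ennreal c = ennreal (a * b * c)" if "0 \<le> a" "0 \<le> b" "0 \<le> c" for a b c
        using that by (simp add: ennreal_mult)
      then show ?thesis using u(2)[OF xy(2)] by (simp del: times_divide_eq_right)
    qed
    finally have "ennreal (measure lebesgue A powr \<theta> * ((u x / 2) powr s / 2) * (1 / (2 * (2 * u y)))) < ennreal C" .
    then have *: "measure lebesgue A powr \<theta> * ((u x / 2) powr s / 2) * (1 / (2 * (2 * u y))) < C"
      by (subst (asm) ennreal_less_iff) (use u(2)[OF xy(2)] in auto)
    have "(u x / 2) powr s = u x powr s / 2 powr s" using u(2)[OF xy(1)] by (simp add: powr_divide)
    moreover have "u x powr s / 2 powr 1 \<le> u x powr s / 2 powr s"
      using s by (intro divide_left_mono powr_mono) auto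
    ultimately have h: "u x powr s / 2 \<le> (u x / 2) powr s" by simp
    have "measure lebesgue A powr \<theta> * (u x powr s / 2 / 2) * (1 / (2 * (2 * u y)))
        \<le> measure lebesgue A powr \<theta> * ((u x / 2) powr s / 2) * (1 / (2 * (2 * u y)))"
      using u(2)[OF xy(2)] by (intro mult_right_mono mult_left_mono divide_right_mono h) auto
    with * have "measure lebesgue A powr \<theta> * (u x powr s / 2 / 2) * (1 / (2 * (2 * u y))) < C" by linarith
    then show "measure lebesgue (ball x \<rho> \<union> ball y \<rho>) powr \<theta> * u x powr recip (hoelder_conj \<beta>) \<le> 16 * C * u y"
      using u(2)[OF xy(2)] by (simp add: A_def s_def field_simps)
  qed (use ex ey dx dy in auto)
qed

text \<open>For \<open>x = y\<close> both values of \<open>u\<close> are one fixed positive number,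
  so the power of the measure stays bounded on shrinking balls; with a negative exponent it would
  tend to infinity.\<close>

lemma mean_bound_exponent:
  fixes u :: "'a::euclidean_space \<Rightarrow> real"
  assumes \<Omega>: "open \<Omega>" "\<Omega> \<noteq> {}" and u: "continuous_on \<Omega> u" "\<And>x. x \<in> \<Omega> \<Longrightarrow> 0 < u x"
    and par: "1 \<le> \<alpha>" "1 \<le> \<beta>" "1 < p" "1 < r" and C: "0 < C"
    and bound: "\<And>A. A \<in> sets lebesgue \<Longrightarrow> A \<subseteq> \<Omega> \<Longrightarrow> 0 < emeasure lebesgue A \<Longrightarrow> emeasure lebesgue A < \<infinity> \<Longrightarrow>
         ennreal (measure lebesgue A powr \<theta>) * upper_mean \<alpha> \<beta> p r u A * lower_mean p r u A < ennreal C"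
  shows "0 \<le> \<theta>"
proof (rule ccontr)
  assume "\<not> 0 \<le> \<theta>"
  then have \<theta>: "\<theta> < 0" by simp
  obtain x where x: "x \<in> \<Omega>" using \<Omega> by auto
  obtain \<rho>0 where \<rho>0: "0 < \<rho>0" "\<And>\<rho>. 0 < \<rho> \<Longrightarrow> \<rho> < \<rho>0 \<Longrightarrow>
     measure lebesgue (ball x \<rho> \<union> ball x \<rho>) powr \<theta> * u x powr recip (hoelder_conj \<beta>) \<le> 16 * C * u x"
    using mean_bound_pointwise[OF \<Omega>(1) u par C bound x x] by auto
  define K where "K = 16 * C * u x / u x powr recip (hoelder_conj \<beta>)"
  have ux: "0 < u x" using u x by auto
  have K: "0 < K" using C ux by (simp add: K_def)
  have "((\<lambda>\<rho>::real. unit_ball_vol (real DIM('a)) * \<rho> ^ DIM('a)) \<longlongrightarrow> unit_ball_vol (real DIM('a)) * 0 ^ DIM('a)) (at_right 0)"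
    by (intro tendsto_intros)
  \<comment> \<open>\<open>K powr (1 / \<theta>)\<close> is the volume at which the power equals the
    permitted bound \<open>K\<close>; smaller balls exceed that bound because
    \<open>\<theta> < 0\<close>.\<close>
  then have "\<forall>\<^sub>F \<rho> in at_right 0. unit_ball_vol (real DIM('a)) * \<rho> ^ DIM('a) < K powr (1 / \<theta>)"
    by (rule order_tendstoD) (use K in \<open>simp add: zero_power\<close>)
  moreover have "\<forall>\<^sub>F \<rho> in at_right 0. \<rho> < \<rho>0" "\<forall>\<^sub>F \<rho>::real in at_right 0. 0 < \<rho>"
    using \<rho>0 eventually_at_right_field by (auto simp: eventually_at_right_less)
  ultimately have "\<forall>\<^sub>F \<rho>::real in at_right 0. False"
  proof eventually_elim
    case (elim \<rho>)
    have m: "measure lebesgue (ball x \<rho>) = unit_ball_vol (real DIM('a)) * \<rho> ^ DIM('a)"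
      using elim by (simp add: content_ball)
    have mp: "0 < measure lebesgue (ball x \<rho>)" using elim content_ball_pos[of \<rho> x] by simp
    have "(K powr (1 / \<theta>)) powr \<theta> < measure lebesgue (ball x \<rho>) powr \<theta>"
      using elim mp \<theta> by (intro powr_less_mono2_neg) (auto simp: m)
    then have "K < measure lebesgue (ball x \<rho>) powr \<theta>" using \<theta> K by (simp add: powr_powr)
    moreover have "measure lebesgue (ball x \<rho>) powr \<theta> \<le> K"
      using \<rho>0(2)[of \<rho>] elim ux by (simp add: K_def field_simps)
    ultimately show False by simp
  qed
  then show False by (simp add: trivial_limit_at_right_real[unfolded trivial_limit_def])
qed

lemma mean_bound_harnack:
  fixes u :: "'a::euclidean_space \<Rightarrow> real"
  assumes \<Omega>: "open \<Omega>" and u: "continuous_on \<Omega> u" "\<And>x. x \<in> \<Omega> \<Longrightarrow> 0 < u x"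
    and par: "1 \<le> \<alpha>" "1 \<le> \<beta>" "1 < p" "1 < r" and C: "0 < C"
    and bound: "\<And>A. A \<in> sets lebesgue \<Longrightarrow> A \<subseteq> \<Omega> \<Longrightarrow> 0 < emeasure lebesgue A \<Longrightarrow> emeasure lebesgue A < \<infinity> \<Longrightarrow>
         ennreal (measure lebesgue A powr 0) * upper_mean \<alpha> \<beta> p r u A * lower_mean p r u A < ennreal C"
    and xy: "x \<in> \<Omega>" "y \<in> \<Omega>"
  shows "u x powr recip (hoelder_conj \<beta>) \<le> 16 * C * u y"
proof -
  obtain \<rho>0 where \<rho>0: "0 < \<rho>0" "\<And>\<rho>. 0 < \<rho> \<Longrightarrow> \<rho> < \<rho>0 \<Longrightarrow>
     measure lebesgue (ball x \<rho> \<union> ball y \<rho>) powr 0 * u x powr recip (hoelder_conj \<beta>) \<le> 16 * C * u y"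
    using mean_bound_pointwise[OF \<Omega> u par C bound xy] by auto
  define \<rho> where "\<rho> = \<rho>0 / 2"
  have \<rho>: "0 < \<rho>" "\<rho> < \<rho>0" using \<rho>0 by (auto simp: \<rho>_def)
  have "measure lebesgue (ball x \<rho>) \<le> measure lebesgue (ball x \<rho> \<union> ball y \<rho>)"
    by (rule measure_mono_fmeasurable) auto
  moreover have "0 < measure lebesgue (ball x \<rho>)" using \<rho> content_ball_pos[of \<rho> x] by simp
  \<comment> \<open>\<open>0 powr 0\<close> is 0, so the factor \<open>powr 0\<close> becomes 1 only
    once the measure is known to be nonzero.\<close>
  ultimately have "measure lebesgue (ball x \<rho> \<union> ball y \<rho>) \<noteq> 0" by linarith
  then show ?thesis using \<rho>0(2)[OF \<rho>] by simp
qed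

section \<open>Passing from Lebesgue to Borel functions\<close>

lemma lebesgue_ex_borel:
  fixes f :: "'a::euclidean_space \<Rightarrow> 'b::euclidean_space"
  assumes "f \<in> borel_measurable lebesgue"
  obtains g where "g \<in> borel_measurable borel" "AE x in lborel. f x = g x"
proof -
  have "\<exists>h\<in>borel_measurable lborel. AE x in lborel. f x \<bullet> b = h x" for b
    by (intro completion_ex_borel_measurable_real borel_measurable_inner assms borel_measurable_const)
  then have "\<forall>b. \<exists>h. h \<in> borel_measurable lborel \<and> (AE x in lborel. f x \<bullet> b = h x)" by blast
  then obtain h where h: "\<And>b. h b \<in> borel_measurable lborel" "\<And>b. AE x in lborel. f x \<bullet> b = h b x"
    by (auto dest!: choice)
  have [measurable]: "h b \<in> borel_measurable borel" for b using h(1)[of b] by simp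
  show ?thesis
  proof (rule that[of "\<lambda>x. \<Sum>b\<in>Basis. h b x *\<^sub>R b"])
    have "AE x in lborel. \<forall>b\<in>Basis. f x \<bullet> b = h b x"
      using h(2) by (intro AE_finite_allI) auto
    then show "AE x in lborel. f x = (\<Sum>b\<in>Basis. h b x *\<^sub>R b)"
    proof eventually_elim
      case (elim x)
      have "f x = (\<Sum>b\<in>Basis. (f x \<bullet> b) *\<^sub>R b)" by (simp add: euclidean_representation)
      also have "\<dots> = (\<Sum>b\<in>Basis. h b x *\<^sub>R b)" using elim by (intro sum.cong) auto
      finally show ?case .
    qed
  qed measurable
qed

text \<open>The data are Lebesgue measurable and meaningful on \<Omega> only, while the convolutions
  are integrals over the whole space of Borel functions. Extension by zero from a compact
  \<open>L\<close> also turns local integrability into integrability.\<close>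

lemma borel_representative:
  fixes f :: "'a::euclidean_space \<Rightarrow> 'b::euclidean_space"
  assumes f: "f \<in> borel_measurable (lebesgue_on \<Omega>)" and \<Omega>: "\<Omega> \<in> sets lebesgue"
    and L: "L \<in> sets borel" "L \<subseteq> \<Omega>"
  obtains g where "g \<in> borel_measurable borel" "\<And>x. x \<notin> L \<Longrightarrow> g x = 0"
    "AE x in lborel. x \<in> L \<longrightarrow> g x = f x"
proof -
  have "(\<lambda>x. indicator \<Omega> x *\<^sub>R f x) \<in> borel_measurable lebesgue"
    using f \<Omega> by (subst (asm) borel_measurable_restrict_space_iff) auto
  then obtain g where g[measurable]: "g \<in> borel_measurable borel"
    and ae: "AE x in lborel. indicator \<Omega> x *\<^sub>R f x = g x" by (rule lebesgue_ex_borel)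
  note [measurable] = L(1)
  show ?thesis
  proof (rule that[of "\<lambda>x. indicator L x *\<^sub>R g x"])
    show "AE x in lborel. x \<in> L \<longrightarrow> indicator L x *\<^sub>R g x = f x"
      using ae by eventually_elim (use L in auto)
  qed auto
qed

text \<open>Measurability of \<open>F\<close> on \<Omega> is not assumed but follows from that of
  \<open>F1\<close>, because Lebesgue measure is complete.\<close>

lemma lebesgue_on_transfer:
  fixes F F1 :: "'a::euclidean_space \<Rightarrow> 'b::euclidean_space"
  assumes \<Omega>: "\<Omega> \<in> sets lebesgue" and F1: "F1 \<in> borel_measurable borel"
    and ae: "AE x in lborel. indicator \<Omega> x *\<^sub>R F x = F1 x"
  shows "integral\<^sup>L (lebesgue_on \<Omega>) F = integral\<^sup>L lborel F1"
    "integrable (lebesgue_on \<Omega>) F \<longleftrightarrow> integrable lborel F1"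
proof -
  have ae': "AE x in lebesgue. F1 x = indicator \<Omega> x *\<^sub>R F x"
    using ae by (simp add: AE_completion_iff eq_commute)
  have m1: "F1 \<in> borel_measurable lebesgue" using F1 by (intro measurable_completion) simp
  have m2: "(\<lambda>x. indicator \<Omega> x *\<^sub>R F x) \<in> borel_measurable lebesgue"
    by (rule borel_measurable_AE[OF m1 ae'])
  have "integral\<^sup>L (lebesgue_on \<Omega>) F = integral\<^sup>L lebesgue (\<lambda>x. indicator \<Omega> x *\<^sub>R F x)"
    using \<Omega> by (intro integral_restrict_space) simp
  also have "\<dots> = integral\<^sup>L lebesgue F1"
    using ae' by (intro integral_cong_AE m1 m2) (auto simp: eq_commute)
  also have "\<dots> = integral\<^sup>L lborel F1" using F1 by (intro integral_completion) simp
  finally show "integral\<^sup>L (lebesgue_on \<Omega>) F = integral\<^sup>L lborel F1" .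
  have "integrable (lebesgue_on \<Omega>) F \<longleftrightarrow> integrable lebesgue (\<lambda>x. indicator \<Omega> x *\<^sub>R F x)"
    using \<Omega> by (intro integrable_restrict_space) simp
  also have "\<dots> \<longleftrightarrow> integrable lebesgue F1"
    using ae' by (intro integrable_cong_AE m1 m2) (auto simp: eq_commute)
  also have "\<dots> \<longleftrightarrow> integrable lborel F1" using F1 by (intro integrable_completion) simp
  finally show "integrable (lebesgue_on \<Omega>) F \<longleftrightarrow> integrable lborel F1" .
qed

lemma Lp_representative_integrable:
  fixes f g :: "'a::euclidean_space \<Rightarrow> 'b::euclidean_space"
  assumes f: "f \<in> Lp p L" and L: "compact L" and g: "g \<in> borel_measurable borel"
    "\<And>x. x \<notin> L \<Longrightarrow> g x = 0" "AE x in lborel. x \<in> L \<longrightarrow> g x = f x"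
  shows "integrable lborel (\<lambda>x. norm (g x) powr p)"
proof -
  note [measurable] = g(1)
  have "closed L" using L by (rule compact_imp_closed)
  then have Ls: "L \<in> sets lebesgue" by auto
  have ae: "AE x in lborel. indicator L x *\<^sub>R (norm (f x) powr p) = norm (g x) powr p"
    using g(3) by eventually_elim (use g(2) in \<open>auto simp: indicator_def\<close>)
  have "integrable (lebesgue_on L) (\<lambda>x. norm (f x) powr p)" using f by (simp add: Lp_def)
  then show ?thesis
    using lebesgue_on_transfer(2)[OF Ls _ ae] by simp
qed

lemma L1_representative_integrable:
  fixes f g :: "'a::euclidean_space \<Rightarrow> 'b::euclidean_space"
  assumes f: "f \<in> Lp 1 L" and L: "compact L" and g: "g \<in> borel_measurable borel"
    "\<And>x. x \<notin> L \<Longrightarrow> g x = 0" "AE x in lborel. x \<in> L \<longrightarrow> g x = f x"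
  shows "integrable lborel g"
proof -
  have "integrable lborel (\<lambda>x. norm (g x) powr 1)"
    by (rule Lp_representative_integrable[OF assms])
  moreover have "norm (g x) powr 1 = norm (g x)" for x by simp
  ultimately have "integrable lborel (\<lambda>x. norm (g x))" by (simp only:)
  then show ?thesis by (rule integrable_norm_cancel) (simp add: g(1))
qed

lemma Ck_reflect: "Ck n f \<Longrightarrow> Ck n (\<lambda>y. f (x - y))"
proof (induction n arbitrary: f)
  case 0
  then have "continuous_on UNIV f" by simp
  then have "continuous_on UNIV (\<lambda>y. f (x - y))"
    by (rule continuous_on_compose2) (auto intro!: continuous_intros)
  then show ?case by simp
next
  case (Suc n)
  have D: "((\<lambda>y. f (x - y)) has_derivative (\<lambda>h. frechet_derivative f (at (x - y)) (- h))) (at y)" for y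
    by (rule has_derivative_compose[where f="\<lambda>y. x - y" and g=f])
       (use Suc.prems in \<open>auto intro!: derivative_eq_intros differentiable_has_frechet_derivative\<close>)
  have fd: "frechet_derivative (\<lambda>y. f (x - y)) (at y) b = (-1) * frechet_derivative f (at (x - y)) b" for y b
  proof -
    have "frechet_derivative (\<lambda>y. f (x - y)) (at y) = (\<lambda>h. frechet_derivative f (at (x - y)) (- h))"
      using D by (rule frechet_derivative_at[symmetric])
    moreover have "linear (frechet_derivative f (at (x - y)))"
      using Suc.prems by (intro linear_frechet_derivative) auto
    ultimately show ?thesis by (simp add: linear_neg)
  qed
  have "Ck n (\<lambda>y. (-1) * frechet_derivative f (at (x - y)) b)" if "b \<in> Basis" for b
    using Suc.prems that by (intro Ck_mult Ck_const Suc.IH[of "\<lambda>z. frechet_derivative f (at z) b"]) auto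
  moreover have "(\<lambda>y. f (x - y)) differentiable at y" for y
    using D differentiable_def by blast
  ultimately show ?case by (simp add: fd)
qed

text \<open>The definition of the weak gradient is tested with \<open>y \<mapsto> k (x - y)\<close>,
  whose gradient is \<open>- grad k (x - y)\<close>; the two signs cancel. The kernel is supported
  in \<open>cball x \<delta> \<subseteq> L\<close>, so the values of the representatives off
  \<open>L\<close> do not enter.\<close>

lemma weak_grad_mollify:
  fixes w w1 :: "'a::euclidean_space \<Rightarrow> real"
  assumes wg: "is_weak_grad \<Omega> w G" and \<Omega>: "open \<Omega>" and L: "L \<subseteq> \<Omega>"
    and w1: "integrable lborel w1" "\<And>x. x \<notin> L \<Longrightarrow> w1 x = 0" "AE x in lborel. x \<in> L \<longrightarrow> w1 x = w x"
    and G1: "integrable lborel G1" "\<And>x. x \<notin> L \<Longrightarrow> G1 x = 0" "AE x in lborel. x \<in> L \<longrightarrow> G1 x = G x"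
    and k: "mollifier \<delta> k" and x: "cball x \<delta> \<subseteq> L"
  shows "conv w1 (grad k) x = conv k G1 x"
proof -
  define \<psi> where "\<psi> y = k (x - y)" for y
  have \<Omega>s: "\<Omega> \<in> sets lebesgue" using \<Omega> by auto
  have [measurable]: "w1 \<in> borel_measurable borel" "G1 \<in> borel_measurable borel" using w1 G1 by auto
  note [measurable] = mollifierD(8)[OF k] borel_measurable_continuous_onI[OF C1_grad_D(1)[OF mollifierD(10)[OF k]]]
  have \<psi>0: "\<psi> y = 0" and gk0: "grad k (x - y) = 0" if "y \<notin> cball x \<delta>" for y
    using that mollifierD(4,11)[OF k, of "x - y"] by (auto simp: \<psi>_def dist_norm)
  have test: "\<psi> \<in> test_functions \<Omega>"
  proof -
    have sub: "closure {x. \<psi> x \<noteq> 0} \<subseteq> cball x \<delta>"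
      by (rule closure_minimal) (use \<psi>0 in blast, simp)
    then have "bounded (closure {x. \<psi> x \<noteq> 0})" by (rule bounded_subset[OF bounded_cball])
    then have "compact (closure {x. \<psi> x \<noteq> 0})" by (simp add: compact_eq_bounded_closed)
    moreover have "Ck n \<psi>" for n unfolding \<psi>_def by (rule Ck_reflect[OF mollifierD(1)[OF k]])
    ultimately show ?thesis using sub x L by (auto simp: test_functions_def)
  qed
  have "C1_grad \<psi> (\<lambda>y. - grad k (x - y))"
    unfolding C1_grad_def
  proof (intro conjI allI)
    show "continuous_on UNIV (\<lambda>y. - grad k (x - y))"
      by (intro continuous_intros continuous_on_compose2[OF C1_grad_D(1)[OF mollifierD(10)[OF k]]]) auto
    fix y
    have "((\<lambda>y. k (x - y)) has_derivative (\<lambda>h. grad k (x - y) \<bullet> (- h))) (at y)"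
      by (rule has_derivative_compose[where f="\<lambda>y. x - y" and g=k])
         (auto intro!: derivative_eq_intros C1_grad_D(2)[OF mollifierD(10)[OF k]])
    then show "(\<psi> has_derivative (\<lambda>h. (- grad k (x - y)) \<bullet> h)) (at y)" by (simp add: \<psi>_def[abs_def])
  qed
  then have g\<psi>: "grad \<psi> = (\<lambda>y. - grad k (x - y))" by (rule C1_grad_grad)
  have L1: "AE y in lborel. (y \<in> L \<longrightarrow> w1 y = w y) \<and> (y \<in> L \<longrightarrow> G1 y = G y)" using w1(3) G1(3) by auto
  show ?thesis
  proof (rule euclidean_eqI)
    fix b :: 'a assume b: "b \<in> Basis"
    have wk: "(\<integral>x. w x * (grad \<psi> x \<bullet> b) \<partial>lebesgue_on \<Omega>) = - (\<integral>x. (G x \<bullet> b) * \<psi> x \<partial>lebesgue_on \<Omega>)"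
      using wg test b by (auto simp: is_weak_grad_def)
    have "(\<integral>x. w x * (grad \<psi> x \<bullet> b) \<partial>lebesgue_on \<Omega>) = (\<integral>y. - ((w1 y *\<^sub>R grad k (x - y)) \<bullet> b) \<partial>lborel)"
    proof (rule lebesgue_on_transfer(1)[OF \<Omega>s])
      show "AE y in lborel. indicator \<Omega> y *\<^sub>R (w y * (grad \<psi> y \<bullet> b)) = - ((w1 y *\<^sub>R grad k (x - y)) \<bullet> b)"
        using L1
      proof eventually_elim
        case (elim y)
        show ?case
        proof (cases "y \<in> L")
          case True
          then show ?thesis using elim L by (auto simp: g\<psi>)
        next
          case False
          then have "grad k (x - y) = 0" using x by (intro gk0) auto
          then show ?thesis by (simp add: g\<psi>)
        qed
      qed
    qed measurable
    also have "\<dots> = - (conv w1 (grad k) x \<bullet> b)"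
    proof -
      have "integrable lborel (\<lambda>y. w1 y *\<^sub>R grad k (x - y))"
        using integrable_conv[OF w1(1) C1_grad_D(1)[OF mollifierD(10)[OF k]], of \<delta>] mollifierD(11)[OF k] by auto
      then have "(\<integral>y. (w1 y *\<^sub>R grad k (x - y)) \<bullet> b \<partial>lborel) = conv w1 (grad k) x \<bullet> b"
        unfolding conv_def by (intro integral_inner_left) simp
      then show ?thesis by simp
    qed
    finally have 1: "(\<integral>x. w x * (grad \<psi> x \<bullet> b) \<partial>lebesgue_on \<Omega>) = - (conv w1 (grad k) x \<bullet> b)" .
    have "(\<integral>x. (G x \<bullet> b) * \<psi> x \<partial>lebesgue_on \<Omega>) = (\<integral>y. (k (x - y) *\<^sub>R G1 y) \<bullet> b \<partial>lborel)"
    proof (rule lebesgue_on_transfer(1)[OF \<Omega>s])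
      show "AE y in lborel. indicator \<Omega> y *\<^sub>R ((G y \<bullet> b) * \<psi> y) = (k (x - y) *\<^sub>R G1 y) \<bullet> b"
        using L1
      proof eventually_elim
        case (elim y)
        show ?case
        proof (cases "y \<in> L")
          case True
          then show ?thesis using elim L by (auto simp: \<psi>_def)
        next
          case False
          then have "\<psi> y = 0" using x by (intro \<psi>0) auto
          then show ?thesis using G1(2)[OF False] by simp
        qed
      qed
    qed measurable
    also have "\<dots> = (\<integral>y. (k y *\<^sub>R G1 (x - y)) \<bullet> b \<partial>lborel)"
      using integral_reflect[of "\<lambda>y. (k y *\<^sub>R G1 (x - y)) \<bullet> b" x] by simp
    also have "\<dots> = conv k G1 x \<bullet> b"
      unfolding conv_def using integrable_mollifier_scaleR[OF G1(1) k] by (intro integral_inner_left) simp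
    finally have 2: "(\<integral>x. (G x \<bullet> b) * \<psi> x \<partial>lebesgue_on \<Omega>) = conv k G1 x \<bullet> b" .
    show "conv w1 (grad k) x \<bullet> b = conv k G1 x \<bullet> b" using wk unfolding 1 2 by simp
  qed
qed

text \<open>\<open>L\<close> is covered by finitely many balls. For a ball \<open>\<omega>\<close>
  the supremum is evaluated at its centre and its radius: this radius is below the diameter, the
  region of integration is all of \<open>\<omega>\<close>, and the weight is a positive
  constant.\<close>

lemma Morrey_locally_integrable:
  fixes V :: "'a::euclidean_space \<Rightarrow> real"
  assumes V: "V \<in> Morrey_loc q \<Omega>" and \<Omega>: "open \<Omega>" and L: "compact L" "L \<subseteq> \<Omega>"
  shows "(\<integral>\<^sup>+x. ennreal \<bar>V x\<bar> * indicator L x \<partial>lebesgue) < \<infinity>"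
proof -
  have Vm: "(\<lambda>x. indicator \<Omega> x *\<^sub>R V x) \<in> borel_measurable lebesgue"
    using V \<Omega> by (subst borel_measurable_restrict_space_iff[symmetric]) (auto simp: Morrey_loc_def)
  have "\<exists>\<rho>>0. ball y \<rho> \<subseteq> \<Omega> \<and> (\<integral>\<^sup>+x. ennreal \<bar>V x\<bar> * indicator (ball y \<rho>) x \<partial>lebesgue) < \<infinity>" if y: "y \<in> L" for y
  proof -
    obtain \<rho> where \<rho>: "0 < \<rho>" "cball y \<rho> \<subseteq> \<Omega>" using \<Omega> L y open_contains_cball by (metis subsetD)
    let ?\<omega> = "ball y \<rho>"
    have c: "compactly_in ?\<omega> \<Omega>" using \<rho> by (simp add: compactly_in_def)
    let ?f = "\<lambda>z r. ennreal (r powr (- (real DIM('a) * recip (hoelder_conj q)))) *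
          (\<integral>\<^sup>+x. ennreal \<bar>V x\<bar> \<partial>lebesgue_on (?\<omega> \<inter> ball z r))"
    have "(SUP z\<in>?\<omega>. SUP r\<in>{0<..<diameter ?\<omega>}. ?f z r) < \<infinity>"
      using V c by (auto simp: Morrey_loc_def)
    moreover have "?f y \<rho> \<le> (SUP r\<in>{0<..<diameter ?\<omega>}. ?f y r)"
      using \<rho> by (intro SUP_upper) auto
    moreover have "(SUP r\<in>{0<..<diameter ?\<omega>}. ?f y r) \<le> (SUP z\<in>?\<omega>. SUP r\<in>{0<..<diameter ?\<omega>}. ?f z r)"
      using \<rho> by (intro SUP_upper) auto
    ultimately have f: "?f y \<rho> < \<infinity>" by (meson le_less_trans)
    have "ennreal (\<rho> powr (- (real DIM('a) * recip (hoelder_conj q)))) \<noteq> 0" using \<rho> by simp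
    then have "(\<integral>\<^sup>+x. ennreal \<bar>V x\<bar> \<partial>lebesgue_on ?\<omega>) < \<infinity>"
      using f by (auto simp: ennreal_mult_less_top)
    then have "(\<integral>\<^sup>+x. ennreal \<bar>V x\<bar> * indicator ?\<omega> x \<partial>lebesgue) < \<infinity>"
      by (subst (asm) nn_integral_restrict_space) auto
    then show ?thesis using \<rho> ball_subset_cball by blast
  qed
  then obtain \<rho> where \<rho>: "\<And>y. y \<in> L \<Longrightarrow> 0 < \<rho> y" "\<And>y. y \<in> L \<Longrightarrow> ball y (\<rho> y) \<subseteq> \<Omega>"
    "\<And>y. y \<in> L \<Longrightarrow> (\<integral>\<^sup>+x. ennreal \<bar>V x\<bar> * indicator (ball y (\<rho> y)) x \<partial>lebesgue) < \<infinity>"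
    by metis
  obtain T where T: "T \<subseteq> L" "finite T" "L \<subseteq> (\<Union>y\<in>T. ball y (\<rho> y))"
    using compactE_image[OF L(1), of L "\<lambda>y. ball y (\<rho> y)"] \<rho>(1) by force
  have "(\<integral>\<^sup>+x. ennreal \<bar>V x\<bar> * indicator L x \<partial>lebesgue)
    \<le> (\<integral>\<^sup>+x. (\<Sum>y\<in>T. ennreal \<bar>V x\<bar> * indicator (ball y (\<rho> y)) x) \<partial>lebesgue)"
  proof (rule nn_integral_mono)
    fix x
    show "ennreal \<bar>V x\<bar> * indicator L x \<le> (\<Sum>y\<in>T. ennreal \<bar>V x\<bar> * indicator (ball y (\<rho> y)) x)"
    proof (cases "x \<in> L")
      case True
      then obtain y where y: "y \<in> T" "x \<in> ball y (\<rho> y)" using T by auto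
      then have "ennreal \<bar>V x\<bar> * indicator L x = (\<Sum>y\<in>{y}. ennreal \<bar>V x\<bar> * indicator (ball y (\<rho> y)) x)"
        using True by simp
      also have "\<dots> \<le> (\<Sum>y\<in>T. ennreal \<bar>V x\<bar> * indicator (ball y (\<rho> y)) x)"
        using y T by (intro sum_mono2) auto
      finally show ?thesis .
    qed simp
  qed
  also have "\<dots> = (\<Sum>y\<in>T. \<integral>\<^sup>+x. ennreal \<bar>V x\<bar> * indicator (ball y (\<rho> y)) x \<partial>lebesgue)"
  proof (rule nn_integral_sum)
    fix y assume y: "y \<in> T"
    have "(\<lambda>x. ennreal \<bar>indicator \<Omega> x *\<^sub>R V x\<bar>) \<in> borel_measurable lebesgue"
      using Vm by measurable
    then have "(\<lambda>x. ennreal \<bar>indicator \<Omega> x *\<^sub>R V x\<bar> * indicator (ball y (\<rho> y)) x) \<in> borel_measurable lebesgue"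
      by (rule borel_measurable_times_ennreal) (rule borel_measurable_indicator, simp)
    also have "(\<lambda>x. ennreal \<bar>indicator \<Omega> x *\<^sub>R V x\<bar> * indicator (ball y (\<rho> y)) x) =
        (\<lambda>x. ennreal \<bar>V x\<bar> * indicator (ball y (\<rho> y)) x)"
    proof
      fix x
      have "ball y (\<rho> y) \<subseteq> \<Omega>" using \<rho>(2) y T(1) by blast
      then show "ennreal \<bar>indicator \<Omega> x *\<^sub>R V x\<bar> * indicator (ball y (\<rho> y)) x = ennreal \<bar>V x\<bar> * indicator (ball y (\<rho> y)) x"
        by (cases "x \<in> ball y (\<rho> y)") (simp_all add: subsetD)
    qed
    finally show "(\<lambda>x. ennreal \<bar>V x\<bar> * indicator (ball y (\<rho> y)) x) \<in> borel_measurable lebesgue" .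
  qed
  also have "\<dots> < \<infinity>" using \<rho>(3) T by (auto simp: subset_eq)
  finally show ?thesis .
qed

section \<open>The weighted Sobolev inequality in terms of the energy on \<Omega>\<close>

lemma powr_pred_le:
  fixes t p :: real
  assumes "0 \<le> t" "2 \<le> p"
  shows "t powr (p - 2) * t \<le> t + t powr p"
proof (cases "t \<le> 1")
  case True
  then have "t powr (p - 2) \<le> 1" using assms by (intro powr_le1) auto
  then have "t powr (p - 2) * t \<le> 1 * t" using assms by (intro mult_right_mono) auto
  then show ?thesis by (simp add: add_increasing2)
next
  case False
  then have "t powr (p - 2) * t = t powr (p - 2 + 1)" by (simp only: powr_add) simp
  also have "\<dots> \<le> t powr p" using False by (intro powr_mono) auto
  finally show ?thesis using assms by simp
qed

lemma compact_thicken: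
  fixes K :: "'a::euclidean_space set"
  assumes "compact K"
  obtains B where "compact B" "\<And>x. x \<in> K \<Longrightarrow> cball x d \<subseteq> B" "\<And>y. y \<in> B \<Longrightarrow> \<exists>x\<in>K. dist x y \<le> d"
proof (rule that[of "{x + y |x y. x \<in> K \<and> y \<in> cball 0 d}"])
  show "compact {x + y |x y. x \<in> K \<and> y \<in> cball 0 d}" by (intro compact_sums assms compact_cball)
  show "cball x d \<subseteq> {x + y |x y. x \<in> K \<and> y \<in> cball 0 d}" if x: "x \<in> K" for x
  proof
    fix z assume "z \<in> cball x d"
    then have "z = x + (z - x)" "z - x \<in> cball 0 d" by (auto simp: dist_norm norm_minus_commute)
    then show "z \<in> {x + y |x y. x \<in> K \<and> y \<in> cball 0 d}" using x by blast
  qed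
  fix y assume "y \<in> {x + y |x y. x \<in> K \<and> y \<in> cball 0 d}"
  then obtain x z where "x \<in> K" "y = x + z" "norm z \<le> d" by auto
  then show "\<exists>x\<in>K. dist x y \<le> d" by (intro bexI[of _ x]) (simp_all add: dist_norm)
qed

lemma weighted_sobolev_energy:
  fixes \<Omega> :: "'a::euclidean_space set"
  defines "N \<equiv> real DIM('a)"
  assumes \<Omega>: "open \<Omega>" and p: "2 \<le> p" "p < N"
    and V: "V \<in> borel_measurable (lebesgue_on \<Omega>)"
      "\<And>L. compact L \<Longrightarrow> L \<subseteq> \<Omega> \<Longrightarrow> (\<integral>\<^sup>+x. ennreal \<bar>V x\<bar> * indicator L x \<partial>lebesgue) < \<infinity>"
    and u: "continuous_on \<Omega> u" and m: "0 < m" "\<And>x. x \<in> \<Omega> \<Longrightarrow> m \<le> u x"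
    and sol: "weak_solution p V \<Omega> u" and phi: "\<phi> \<in> W1p p \<Omega>" "\<phi> \<in> Cc \<Omega>"
  shows "epow (\<integral>\<^sup>+x. ennreal (\<bar>\<phi> x / u x\<bar> powr (N * p / (N - p))) \<partial>lebesgue_on \<Omega>) (1 - p / N)
    \<le> ennreal ((p * (N - 1) / (N - p)) powr p * (1 / m) powr p * 2 powr (p - 1) * Q_energy p V \<Omega> \<phi>)"
proof -
  have \<Omega>s: "\<Omega> \<in> sets lebesgue" using \<Omega> by auto
  define G where "G = wgrad \<Omega> u"
  define H where "H = wgrad \<Omega> \<phi>"
  have uW: "u \<in> W1p_loc p \<Omega>" using sol by (simp add: weak_solution_def)
  have wgu: "is_weak_grad \<Omega> u G"
  proof -
    have "\<exists>G. is_weak_grad \<Omega> u G" using uW by (simp add: W1p_loc_def)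
    then show ?thesis unfolding G_def wgrad_def by (rule someI_ex)
  qed
  have wgp: "is_weak_grad \<Omega> \<phi> H"
  proof -
    have "\<exists>G. is_weak_grad \<Omega> \<phi> G" using phi(1) by (simp add: W1p_def)
    then show ?thesis unfolding H_def wgrad_def by (rule someI_ex)
  qed
  have GLp: "G \<in> Lp_loc p \<Omega>" using uW by (simp add: W1p_loc_def G_def)
  have HLp: "H \<in> Lp p \<Omega>" using phi(1) by (simp add: W1p_def H_def)
  have GL1: "G \<in> Lp_loc 1 \<Omega>" and HL1: "H \<in> Lp_loc 1 \<Omega>"
    using wgu wgp by (auto simp: is_weak_grad_def)
  obtain K where K: "compact K" "K \<subseteq> \<Omega>" "\<And>x. x \<in> \<Omega> - K \<Longrightarrow> \<phi> x = 0"
    and phic: "continuous_on \<Omega> \<phi>" using phi(2) by (auto simp: Cc_def)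
  obtain e where e: "0 < e" "(\<Union>x\<in>K. cball x e) \<subseteq> \<Omega>"
    using compact_subset_open_imp_cball_epsilon_subset[OF K(1) \<Omega> K(2)] by metis
  \<comment> \<open>Half of \<open>e\<close> for each of the two thickenings, from \<open>K\<close>
    to \<open>B\<close> and from \<open>B\<close> to \<open>L\<close>, so that \<open>L\<close>
    stays inside \<Omega>.\<close>
  define d where "d = e / 2"
  have d: "0 < d" using e by (simp add: d_def)
  obtain B where B: "compact B" "\<And>x. x \<in> K \<Longrightarrow> cball x d \<subseteq> B" "\<And>y. y \<in> B \<Longrightarrow> \<exists>x\<in>K. dist x y \<le> d"
    using compact_thicken[OF K(1)] by metis
  obtain L where L: "compact L" "\<And>x. x \<in> B \<Longrightarrow> cball x d \<subseteq> L" "\<And>y. y \<in> L \<Longrightarrow> \<exists>x\<in>B. dist x y \<le> d"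
    using compact_thicken[OF B(1)] by metis
  have L\<Omega>: "L \<subseteq> \<Omega>"
  proof
    fix z assume "z \<in> L"
    then obtain y x where "x \<in> K" "dist x y \<le> d" "dist y z \<le> d" using L(3) B(3) by meson
    moreover have "dist x z \<le> dist x y + dist y z" by (rule dist_triangle)
    ultimately have "z \<in> cball x e" "x \<in> K" by (auto simp: d_def)
    then show "z \<in> \<Omega>" using e(2) by blast
  qed
  have BL: "B \<subseteq> L" using L(2) d by (meson centre_in_cball less_imp_le subset_eq)
  have KB: "K \<subseteq> B" using B(2) d by (meson centre_in_cball less_imp_le subset_eq)
  have clL: "closed L" and clB: "closed B" and clK: "closed K" using L(1) B(1) K(1) by (auto simp: compact_imp_closed)
  have [measurable]: "L \<in> sets borel" "B \<in> sets borel" "K \<in> sets borel" using clL clB clK by auto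
  \<comment> \<open>\<open>u1\<close> may jump at the boundary of \<open>L\<close>, which
    mollification at points of \<open>B\<close> with radius at most \<open>d\<close> does not
    notice; \<open>\<phi>1\<close> stays continuous, because \<open>\<phi>\<close> vanishes on
    \<Omega> outside \<open>K\<close>.\<close>
  define u1 where "u1 x = (if x \<in> L then u x else 0)" for x
  define \<phi>1 where "\<phi>1 x = (if x \<in> K then \<phi> x else 0)" for x
  have u1: "integrable lborel u1"
  proof -
    have "integrable lborel (\<lambda>x. indicator L x *\<^sub>R u x)"
      by (rule borel_integrable_compact[OF L(1) continuous_on_subset[OF u L\<Omega>]])
    also have "(\<lambda>x. indicator L x *\<^sub>R u x) = u1" by (auto simp: u1_def fun_eq_iff)
    finally show ?thesis .
  qed
  have u1m[measurable]: "u1 \<in> borel_measurable borel" using u1 by simp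
  have \<phi>1eq: "\<phi>1 x = \<phi> x" if "x \<in> \<Omega>" for x using K(3)[of x] that by (auto simp: \<phi>1_def)
  have \<phi>1c: "continuous_on UNIV \<phi>1"
  proof -
    have 1: "continuous_on \<Omega> \<phi>1" using phic by (subst continuous_on_cong[OF refl \<phi>1eq]) auto
    have 2: "continuous_on (- K) \<phi>1"
      using continuous_on_const[of "- K" "0::real"] by (subst continuous_on_cong[OF refl]) (auto simp: \<phi>1_def)
    have "continuous_on (\<Omega> \<union> - K) \<phi>1" using 1 2 \<Omega> clK by (intro continuous_on_open_Un) auto
    moreover have "\<Omega> \<union> - K = UNIV" using K(2) by auto
    ultimately show ?thesis by simp
  qed
  have \<phi>1int: "integrable lborel \<phi>1"
  proof -
    have "integrable lborel (\<lambda>x. indicator K x *\<^sub>R \<phi>1 x)"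
      by (rule borel_integrable_compact[OF K(1) continuous_on_subset[OF \<phi>1c]]) simp
    also have "(\<lambda>x. indicator K x *\<^sub>R \<phi>1 x) = \<phi>1" by (auto simp: \<phi>1_def fun_eq_iff)
    finally show ?thesis .
  qed
  have \<phi>1m[measurable]: "\<phi>1 \<in> borel_measurable borel" using \<phi>1int by simp
  have Gm: "G \<in> borel_measurable (lebesgue_on \<Omega>)" and Hm: "H \<in> borel_measurable (lebesgue_on \<Omega>)"
    using GLp HLp by (auto simp: Lp_loc_def Lp_def)
  have Lb: "L \<in> sets borel" by measurable
  obtain G1 where G1[measurable]: "G1 \<in> borel_measurable borel" and G1z: "\<And>x. x \<notin> L \<Longrightarrow> G1 x = 0"
    and G1ae: "AE x in lborel. x \<in> L \<longrightarrow> G1 x = G x" by (rule borel_representative[OF Gm \<Omega>s Lb L\<Omega>]) blast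
  obtain H1 where H1[measurable]: "H1 \<in> borel_measurable borel" and H1z: "\<And>x. x \<notin> L \<Longrightarrow> H1 x = 0"
    and H1ae: "AE x in lborel. x \<in> L \<longrightarrow> H1 x = H x" by (rule borel_representative[OF Hm \<Omega>s Lb L\<Omega>]) blast
  obtain V1 where V1[measurable]: "V1 \<in> borel_measurable borel" and V1z: "\<And>x. x \<notin> L \<Longrightarrow> V1 x = 0"
    and V1ae: "AE x in lborel. x \<in> L \<longrightarrow> V1 x = V x" by (rule borel_representative[OF V(1) \<Omega>s Lb L\<Omega>]) blast
  have GL: "G \<in> Lp p L" "G \<in> Lp 1 L" using GLp GL1 L(1) L\<Omega> by (auto simp: Lp_loc_def)
  have HL: "H \<in> Lp 1 L" using HL1 L(1) L\<Omega> by (auto simp: Lp_loc_def)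
  have iG: "integrable lborel G1" by (rule L1_representative_integrable[OF GL(2) L(1) G1 G1z G1ae])
  have iH: "integrable lborel H1" by (rule L1_representative_integrable[OF HL L(1) H1 H1z H1ae])
  have iGp: "integrable lborel (\<lambda>x. norm (G1 x) powr p)"
    by (rule Lp_representative_integrable[OF GL(1) L(1) G1 G1z G1ae])
  have HLpL: "H \<in> Lp p L"
  proof -
    have "integrable (lebesgue_on \<Omega>) (\<lambda>x. norm (H x) powr p)" using HLp by (simp add: Lp_def)
    then have "integrable lebesgue (\<lambda>x. indicator \<Omega> x *\<^sub>R (norm (H x) powr p))"
      using \<Omega>s by (subst (asm) integrable_restrict_space) auto
    then have "integrable lebesgue (\<lambda>x. indicator L x *\<^sub>R (indicator \<Omega> x *\<^sub>R (norm (H x) powr p)))"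
      by (rule integrable_mult_indicator[rotated]) (use clL in auto)
    also have "(\<lambda>x. indicator L x *\<^sub>R (indicator \<Omega> x *\<^sub>R (norm (H x) powr p))) = (\<lambda>x. indicator L x *\<^sub>R (norm (H x) powr p))"
      using L\<Omega> by (auto simp: fun_eq_iff indicator_def)
    finally have "integrable (lebesgue_on L) (\<lambda>x. norm (H x) powr p)"
      using clL by (subst integrable_restrict_space) auto
    moreover have "H \<in> borel_measurable (lebesgue_on L)"
      using HL by (simp add: Lp_def)
    ultimately show ?thesis by (simp add: Lp_def)
  qed
  have iHp: "integrable lborel (\<lambda>x. norm (H1 x) powr p)"
    by (rule Lp_representative_integrable[OF HLpL L(1) H1 H1z H1ae])
  have iV: "integrable lborel V1"
  proof (rule integrableI_bounded)
    have "(\<integral>\<^sup>+x. ennreal (norm (V1 x)) \<partial>lborel) = (\<integral>\<^sup>+x. ennreal \<bar>V x\<bar> * indicator L x \<partial>lborel)"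
    proof (rule nn_integral_cong_AE)
      show "AE x in lborel. ennreal (norm (V1 x)) = ennreal \<bar>V x\<bar> * indicator L x"
        using V1ae by eventually_elim (use V1z in \<open>auto simp: indicator_def\<close>)
    qed
    also have "\<dots> < \<infinity>" using V(2)[OF L(1) L\<Omega>] by (simp add: nn_integral_completion)
    finally show "(\<integral>\<^sup>+x. ennreal (norm (V1 x)) \<partial>lborel) < \<infinity>" .
  qed simp
  define F where "F x = norm (G1 x) powr (p - 2) *\<^sub>R G1 x" for x
  define S where "S x = V1 x * u1 x powr (p - 1)" for x
  have Fm[measurable]: "F \<in> borel_measurable borel" unfolding F_def[abs_def] by measurable
  have Sm[measurable]: "S \<in> borel_measurable borel" unfolding S_def[abs_def] by measurable
  \<comment> \<open>The norm of \<open>F\<close> is the power \<open>p - 1\<close> of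
    \<open>norm G1\<close>, hence at most the sum of the powers 1 and \<open>p\<close>, both
    integrable.\<close>
  have iF: "integrable lborel F"
  proof (rule Bochner_Integration.integrable_bound[where f="\<lambda>x. norm (G1 x) + norm (G1 x) powr p"])
    show "AE x in lborel. norm (F x) \<le> norm (norm (G1 x) + norm (G1 x) powr p)"
      using powr_pred_le[OF norm_ge_zero p(1)] by (auto simp: F_def)
  qed (use iG iGp in auto)
  have iS: "integrable lborel S"
  proof -
    have "bounded (u ` L)" using u L\<Omega> L(1) by (intro compact_imp_bounded compact_continuous_image continuous_on_subset[OF u]) auto
    then obtain M where M: "M > 0" "\<And>x. x \<in> L \<Longrightarrow> norm (u x) \<le> M" unfolding bounded_pos by auto
    show ?thesis
    proof (rule Bochner_Integration.integrable_bound[where f="\<lambda>x. M powr (p - 1) * V1 x"])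
      show "AE x in lborel. norm (S x) \<le> norm (M powr (p - 1) * V1 x)"
      proof (rule AE_I2)
        fix x
        have "0 \<le> u1 x" "u1 x \<le> M"
          using M m L\<Omega> less_imp_le[OF m(1)] by (fastforce simp: u1_def abs_le_iff)+
        then have "u1 x powr (p - 1) \<le> M powr (p - 1)" using p by (intro powr_mono2) auto
        then show "norm (S x) \<le> norm (M powr (p - 1) * V1 x)"
          by (auto simp: S_def abs_mult mult.commute intro!: mult_left_mono)
      qed
    qed (use iV in auto)
  qed
  have testF: "(\<integral>x. F x \<bullet> grad \<psi> x + S x * \<psi> x \<partial>lborel) = 0"
    if C: "\<And>n. Ck n \<psi>" and z: "\<And>x. x \<notin> L \<Longrightarrow> \<psi> x = 0" for \<psi>
  proof -
    have Cg: "C1_grad \<psi> (grad \<psi>)" using C by (intro Ck_C1_grad[of 0])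
    note [measurable] = borel_measurable_continuous_onI[OF C1_grad_D(1)[OF Cg]] borel_measurable_continuous_onI[OF C1_grad_D(3)[OF Cg]]
    \<comment> \<open>From the quotient lemma with denominator 1 only the second part is taken: a
      C^1 function that vanishes off a closed set has zero gradient there.\<close>
    have gz: "grad \<psi> x = 0" if "x \<notin> L" for x
      using C1_grad_quotient(2)[OF Cg, of "\<lambda>_. 1" "\<lambda>_. 0" L] z clL that by (auto simp: C1_grad_def)
    have sub: "closure {x. \<psi> x \<noteq> 0} \<subseteq> L" using z clL by (intro closure_minimal) auto
    then have "bounded (closure {x. \<psi> x \<noteq> 0})" using L(1) compact_imp_bounded bounded_subset by blast
    then have "compact (closure {x. \<psi> x \<noteq> 0})" by (simp add: compact_eq_bounded_closed)
    then have "\<psi> \<in> test_functions \<Omega>" using C sub L\<Omega> by (auto simp: test_functions_def)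
    then have "(\<integral>x. norm (G x) powr (p - 2) * (G x \<bullet> grad \<psi> x)
             + V x * \<bar>u x\<bar> powr (p - 2) * u x * \<psi> x \<partial>lebesgue_on \<Omega>) = 0"
      using sol by (auto simp: weak_solution_def G_def)
    moreover have "(\<integral>x. norm (G x) powr (p - 2) * (G x \<bullet> grad \<psi> x)
             + V x * \<bar>u x\<bar> powr (p - 2) * u x * \<psi> x \<partial>lebesgue_on \<Omega>) = (\<integral>x. F x \<bullet> grad \<psi> x + S x * \<psi> x \<partial>lborel)"
    proof (rule lebesgue_on_transfer(1)[OF \<Omega>s])
      show "AE x in lborel. indicator \<Omega> x *\<^sub>R (norm (G x) powr (p - 2) * (G x \<bullet> grad \<psi> x)
             + V x * \<bar>u x\<bar> powr (p - 2) * u x * \<psi> x) = F x \<bullet> grad \<psi> x + S x * \<psi> x"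
        using G1ae V1ae
      proof eventually_elim
        case (elim x)
        show ?case
        proof (cases "x \<in> L")
          case True
          then have x: "x \<in> \<Omega>" using L\<Omega> by auto
          then have ux: "0 < u x" using m(2)[of x] m(1) by linarith
          have "\<bar>u x\<bar> powr (p - 2) * u x = u x powr (p - 2 + 1)"
            using ux by (simp only: powr_add) simp
          then have "V x * \<bar>u x\<bar> powr (p - 2) * u x = V x * u x powr (p - 1)"
            by (simp add: mult.assoc)
          then show ?thesis using elim True x by (simp add: F_def S_def u1_def)
        next
          case False
          then show ?thesis using z[OF False] gz[OF False] by simp
        qed
      qed
    qed measurable
    ultimately show ?thesis by simp
  qed
  have main: "epow (\<integral>\<^sup>+x. ennreal (\<bar>\<phi>1 x / u1 x\<bar> powr (N * p / (N - p))) \<partial>lborel) (1 - p / N)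
    \<le> ennreal ((p * (N - 1) / (N - p)) powr p * (1 / m) powr p * 2 powr (p - 1) *
        (\<integral>x. indicator B x * (norm (H1 x) powr p + V1 x * \<bar>\<phi>1 x\<bar> powr p) \<partial>lborel))"
    unfolding N_def
  proof (rule ground_state_sobolev[where A=K and L=L and d=d and G=G1])
    show "p < real DIM('a)" using p(2) by (simp add: N_def)
    show "continuous_on L u1"
      using continuous_on_subset[OF u L\<Omega>] by (subst continuous_on_cong[OF refl]) (auto simp: u1_def)
    show "m \<le> u1 x" if "x \<in> L" for x using that L\<Omega> m(2) by (auto simp: u1_def)
    fix \<delta> and k :: "'a \<Rightarrow> real" and x assume k: "mollifier \<delta> k" "\<delta> \<le> d" and x: "x \<in> B"
    have c: "cball x \<delta> \<subseteq> L" using L(2)[OF x] subset_cball[OF k(2)] by blast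
    show "conv u1 (grad k) x = conv k G1 x"
      by (rule weak_grad_mollify[OF wgu \<Omega> L\<Omega> u1 _ _ iG G1z G1ae k(1) c]) (auto simp: u1_def)
    show "conv \<phi>1 (grad k) x = conv k H1 x"
    proof (rule weak_grad_mollify[OF wgp \<Omega> L\<Omega> \<phi>1int _ _ iH H1z H1ae k(1) c])
      show "AE x in lborel. x \<in> L \<longrightarrow> \<phi>1 x = \<phi> x" using L\<Omega> \<phi>1eq by (intro AE_I2) blast
    qed (use KB BL in \<open>auto simp: \<phi>1_def\<close>)
  next
    fix \<psi> :: "'a \<Rightarrow> real" and \<psi>' assume psi: "C1_grad \<psi> \<psi>'" "\<And>x. x \<notin> B \<Longrightarrow> \<psi> x = 0" "\<And>x. x \<notin> B \<Longrightarrow> \<psi>' x = 0"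
    have "(\<integral>x. F x \<bullet> \<psi>' x + S x * \<psi> x \<partial>lborel) = 0"
      by (rule weak_form_C1[OF iF iS compact_imp_bounded[OF B(1)] d L(2) testF psi])
    then show "(\<integral>x. norm (G1 x) powr (p - 2) * (G1 x \<bullet> \<psi>' x) + V1 x * u1 x powr (p - 1) * \<psi> x \<partial>lborel) = 0"
      by (simp add: F_def S_def)
  next
    show "u1 x = 0" if "x \<notin> L" for x using that by (simp add: u1_def)
    show "\<phi>1 x = 0" if "x \<notin> K" for x using that by (simp add: \<phi>1_def)
  qed (fact p(1) K(1) B(1,2) L(1,2) d u1 \<phi>1c iG iGp iH iHp iV m(1))+
  \<comment> \<open>An inequality is enough: off \<open>B\<close> the function \<open>\<phi>\<close>
    is zero, and what remains of the energy density is the nonnegative term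
    \<open>norm (H x) powr p\<close>.\<close>
  have "(\<integral>x. indicator B x * (norm (H1 x) powr p + V1 x * \<bar>\<phi>1 x\<bar> powr p) \<partial>lborel) \<le> Q_energy p V \<Omega> \<phi>"
  proof -
    define f where "f x = norm (H x) powr p + V x * \<bar>\<phi> x\<bar> powr p" for x
    have tr: "AE x in lborel. indicator \<Omega> x *\<^sub>R (indicator B x * f x) = indicator B x * (norm (H1 x) powr p + V1 x * \<bar>\<phi>1 x\<bar> powr p)"
      using H1ae V1ae by eventually_elim (use BL L\<Omega> \<phi>1eq in \<open>auto simp: f_def indicator_def\<close>)
    have m1: "(\<lambda>x. indicator B x * (norm (H1 x) powr p + V1 x * \<bar>\<phi>1 x\<bar> powr p)) \<in> borel_measurable borel" by measurable
    have trV: "AE x in lborel. indicator \<Omega> x *\<^sub>R (V x * \<bar>\<phi> x\<bar> powr p) = V1 x * \<bar>\<phi>1 x\<bar> powr p"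
      using V1ae
    proof eventually_elim
      case (elim x)
      then show ?case
        using KB BL L\<Omega> \<phi>1eq[of x] K(3)[of x] V1z[of x] by (cases "x \<in> L"; cases "x \<in> \<Omega>") (auto simp: \<phi>1_def)
    qed
    have iVphi: "integrable lborel (\<lambda>x. V1 x * \<bar>\<phi>1 x\<bar> powr p)"
    proof -
      obtain M where M: "M > 0" "\<And>x. norm (\<phi>1 x) \<le> M"
      proof -
        have "bounded (\<phi>1 ` K)" using \<phi>1c K(1) by (intro compact_imp_bounded compact_continuous_image) (auto intro: continuous_on_subset)
        then obtain M where "M > 0" "\<And>x. x \<in> K \<Longrightarrow> norm (\<phi>1 x) \<le> M" unfolding bounded_pos by auto
        then have "norm (\<phi>1 x) \<le> M" for x by (cases "x \<in> K") (auto simp: \<phi>1_def)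
        then show ?thesis using that \<open>M > 0\<close> by blast
      qed
      show ?thesis
      proof (rule Bochner_Integration.integrable_bound[where f="\<lambda>x. M powr p * V1 x"])
        show "AE x in lborel. norm (V1 x * \<bar>\<phi>1 x\<bar> powr p) \<le> norm (M powr p * V1 x)"
        proof (rule AE_I2)
          fix x
          have "\<bar>\<phi>1 x\<bar> powr p \<le> M powr p" using M(2)[of x] p by (intro powr_mono2) auto
          then show "norm (V1 x * \<bar>\<phi>1 x\<bar> powr p) \<le> norm (M powr p * V1 x)"
            by (auto simp: abs_mult mult.commute intro!: mult_left_mono)
        qed
      qed (use iV in auto)
    qed
    have "integrable (lebesgue_on \<Omega>) (\<lambda>x. V x * \<bar>\<phi> x\<bar> powr p)"
      using iVphi lebesgue_on_transfer(2)[OF \<Omega>s _ trV] by simp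
    moreover have "integrable (lebesgue_on \<Omega>) (\<lambda>x. norm (H x) powr p)" using HLp by (simp add: Lp_def)
    ultimately have fint: "integrable (lebesgue_on \<Omega>) f" unfolding f_def by (rule Bochner_Integration.integrable_add[rotated])
    have ib: "integrable lborel (\<lambda>x. indicator B x * (norm (H1 x) powr p + V1 x * \<bar>\<phi>1 x\<bar> powr p))"
      using integrable_real_mult_indicator[of B lborel "\<lambda>x. norm (H1 x) powr p + V1 x * \<bar>\<phi>1 x\<bar> powr p"] iHp iVphi
      by (simp add: mult.commute)
    have fBint: "integrable (lebesgue_on \<Omega>) (\<lambda>x. indicator B x * f x)"
      using ib lebesgue_on_transfer(2)[OF \<Omega>s m1 tr] by simp
    have "(\<integral>x. indicator B x * (norm (H1 x) powr p + V1 x * \<bar>\<phi>1 x\<bar> powr p) \<partial>lborel) = (\<integral>x. indicator B x * f x \<partial>lebesgue_on \<Omega>)"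
      using lebesgue_on_transfer(1)[OF \<Omega>s m1 tr] by simp
    also have "\<dots> \<le> (\<integral>x. f x \<partial>lebesgue_on \<Omega>)"
    proof (rule Bochner_Integration.integral_mono[OF fBint fint])
      fix x assume "x \<in> space (lebesgue_on \<Omega>)"
      then have "x \<in> \<Omega>" by simp
      show "indicator B x * f x \<le> f x"
      proof (cases "x \<in> B")
        case False
        then have "\<phi> x = 0" using K(3)[of x] KB \<open>x \<in> \<Omega>\<close> by blast
        then show ?thesis using False by (simp add: f_def)
      qed simp
    qed
    finally show ?thesis by (simp add: Q_energy_def f_def H_def)
  qed
  then have "ennreal ((p * (N - 1) / (N - p)) powr p * (1 / m) powr p * 2 powr (p - 1) *
        (\<integral>x. indicator B x * (norm (H1 x) powr p + V1 x * \<bar>\<phi>1 x\<bar> powr p) \<partial>lborel))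
      \<le> ennreal ((p * (N - 1) / (N - p)) powr p * (1 / m) powr p * 2 powr (p - 1) * Q_energy p V \<Omega> \<phi>)"
    by (intro ennreal_leI mult_left_mono) auto
  moreover have "(\<integral>\<^sup>+x. ennreal (\<bar>\<phi> x / u x\<bar> powr (N * p / (N - p))) \<partial>lebesgue_on \<Omega>) =
      (\<integral>\<^sup>+x. ennreal (\<bar>\<phi>1 x / u1 x\<bar> powr (N * p / (N - p))) \<partial>lborel)"
  proof -
    have "(\<integral>\<^sup>+x. ennreal (\<bar>\<phi> x / u x\<bar> powr (N * p / (N - p))) \<partial>lebesgue_on \<Omega>) =
        (\<integral>\<^sup>+x. ennreal (\<bar>\<phi> x / u x\<bar> powr (N * p / (N - p))) * indicator \<Omega> x \<partial>lborel)"
      using \<Omega>s by (simp add: nn_integral_restrict_space nn_integral_completion)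
    also have "\<dots> = (\<integral>\<^sup>+x. ennreal (\<bar>\<phi>1 x / u1 x\<bar> powr (N * p / (N - p))) \<partial>lborel)"
    proof (rule nn_integral_cong)
      fix x
      show "ennreal (\<bar>\<phi> x / u x\<bar> powr (N * p / (N - p))) * indicator \<Omega> x = ennreal (\<bar>\<phi>1 x / u1 x\<bar> powr (N * p / (N - p)))"
      proof (cases "x \<in> K")
        case True
        then have "x \<in> L" "x \<in> \<Omega>" using KB BL L\<Omega> by auto
        then show ?thesis using True by (simp add: \<phi>1_def u1_def)
      next
        case False
        then show ?thesis using K(3)[of x] by (cases "x \<in> \<Omega>") (auto simp: \<phi>1_def)
      qed
    qed
    finally show ?thesis .
  qed
  ultimately show ?thesis using main by simp
qed

section \<open>Hardy-weights from the weighted Sobolev inequality\<close>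

lemma weighted_Lp_locally_integrable:
  fixes g :: "'a::euclidean_space \<Rightarrow> real"
  assumes g: "g \<in> weighted_Lp \<alpha> \<Omega> w" and \<Omega>: "\<Omega> \<in> sets lebesgue" and \<alpha>: "1 \<le> \<alpha>"
    and w: "0 < w0" "\<And>x. x \<in> \<Omega> \<Longrightarrow> w0 \<le> w x"
  shows "g \<in> Lp_loc 1 \<Omega>"
  unfolding Lp_loc_def
proof (intro CollectI conjI allI impI)
  show gm: "g \<in> borel_measurable (lebesgue_on \<Omega>)" using g by (simp add: weighted_Lp_def)
  fix K assume K: "compact K \<and> K \<subseteq> \<Omega>"
  then have Ks: "K \<in> sets lebesgue" by (auto dest: compact_imp_closed)
  have gK: "g \<in> borel_measurable (lebesgue_on K)"
    using gm K by (auto intro: measurable_restrict_mono)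
  have "ennreal w0 * (\<integral>\<^sup>+x. ennreal (\<bar>g x\<bar> powr \<alpha>) \<partial>lebesgue_on K) =
      (\<integral>\<^sup>+x. ennreal w0 * ennreal (\<bar>g x\<bar> powr \<alpha>) \<partial>lebesgue_on K)"
    using gK by (intro nn_integral_cmult[symmetric]) measurable
  also have "\<dots> = (\<integral>\<^sup>+x. ennreal w0 * ennreal (\<bar>g x\<bar> powr \<alpha>) * indicator K x \<partial>lebesgue)"
    using Ks by (intro nn_integral_restrict_space) simp
  also have "\<dots> \<le> (\<integral>\<^sup>+x. ennreal (\<bar>g x\<bar> powr \<alpha> * w x) * indicator \<Omega> x \<partial>lebesgue)"
  proof (rule nn_integral_mono)
    fix x
    show "ennreal w0 * ennreal (\<bar>g x\<bar> powr \<alpha>) * indicator K x \<le> ennreal (\<bar>g x\<bar> powr \<alpha> * w x) * indicator \<Omega> x"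
    proof (cases "x \<in> K")
      case True
      then have x: "x \<in> \<Omega>" using K by auto
      have "w0 * \<bar>g x\<bar> powr \<alpha> \<le> \<bar>g x\<bar> powr \<alpha> * w x"
        using mult_right_mono[OF w(2)[OF x], of "\<bar>g x\<bar> powr \<alpha>"] by (simp add: mult.commute)
      then show ?thesis using True x w(1) by (simp add: ennreal_mult[symmetric] ennreal_leI)
    qed simp
  qed
  also have "\<dots> = (\<integral>\<^sup>+x. ennreal (\<bar>g x\<bar> powr \<alpha> * w x) \<partial>lebesgue_on \<Omega>)"
    using \<Omega> by (intro nn_integral_restrict_space[symmetric]) simp
  also have "\<dots> < \<infinity>" using g by (simp add: weighted_Lp_def)
  finally have fin: "(\<integral>\<^sup>+x. ennreal (\<bar>g x\<bar> powr \<alpha>) \<partial>lebesgue_on K) < \<infinity>"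
    using w(1) by (auto simp: ennreal_mult_less_top)
  have "(\<integral>\<^sup>+x. ennreal (norm (norm (g x) powr 1)) \<partial>lebesgue_on K) \<le>
      (\<integral>\<^sup>+x. 1 + ennreal (\<bar>g x\<bar> powr \<alpha>) \<partial>lebesgue_on K)"
  proof (rule nn_integral_mono)
    fix x
    \<comment> \<open>\<open>K\<close> has finite measure, so the constant 1 is integrable; this
      covers all \<open>\<alpha> \<ge> 1\<close> at once.\<close>
    have "\<bar>g x\<bar> \<le> 1 + \<bar>g x\<bar> powr \<alpha>"
    proof (cases "\<bar>g x\<bar> \<le> 1")
      case False
      then have "\<bar>g x\<bar> powr 1 \<le> \<bar>g x\<bar> powr \<alpha>" using \<alpha> by (intro powr_mono) auto
      then show ?thesis by simp
    qed (simp add: add_increasing2)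
    then have "ennreal \<bar>g x\<bar> \<le> ennreal (1 + \<bar>g x\<bar> powr \<alpha>)" by (rule ennreal_leI)
    then show "ennreal (norm (norm (g x) powr 1)) \<le> 1 + ennreal (\<bar>g x\<bar> powr \<alpha>)" by simp
  qed
  also have "\<dots> = emeasure lebesgue K + (\<integral>\<^sup>+x. ennreal (\<bar>g x\<bar> powr \<alpha>) \<partial>lebesgue_on K)"
    using gK Ks by (subst nn_integral_add) (simp_all add: emeasure_restrict_space)
  also have "\<dots> < \<infinity>"
    using fin K lmeasurable_compact[of K] by (auto simp: fmeasurable_def)
  finally have "(\<integral>\<^sup>+x. ennreal (norm (norm (g x) powr 1)) \<partial>lebesgue_on K) < \<infinity>" .
  then have "integrable (lebesgue_on K) (\<lambda>x. norm (g x) powr 1)"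
    using gK by (intro integrableI_bounded) auto
  then show "g \<in> Lp 1 K" using gK by (simp add: Lp_def)
qed

theorem theorem3p5:
  fixes \<Omega> :: "'a::euclidean_space set"
    and V u :: "'a \<Rightarrow> real"
    and p \<alpha> r :: real
    and q \<beta> :: ereal
  assumes domain: "open \<Omega>" "connected \<Omega>" "\<Omega> \<noteq> {}"
    and p: "2 \<le> p" "p < real DIM('a)"
    and V: "V \<in> Morrey_p_loc q p \<Omega>"
    and Q_nonneg: "\<And>\<phi>. \<phi> \<in> W1p p \<Omega> \<inter> Cc \<Omega> \<Longrightarrow> 0 \<le> Q_energy p V \<Omega> \<phi>"
    and u_cont: "continuous_on \<Omega> u"
    and u_pos: "\<And>x. x \<in> \<Omega> \<Longrightarrow> 0 < u x"
    and u_sol: "weak_solution p V \<Omega> u"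
    and \<alpha>: "1 \<le> \<alpha>" "\<alpha> \<le> real DIM('a) / p"
    and \<beta>: "1 \<le> \<beta>"
    and r: "1 < r"
    and mean_bound: "\<exists>C>0. \<forall>A\<in>sets lebesgue.
       A \<subseteq> \<Omega> \<and> 0 < emeasure lebesgue A \<and> emeasure lebesgue A < \<infinity> \<longrightarrow>
         ennreal (measure lebesgue A powr
            (1 / real DIM('a) + recip (hoelder_conj (ereal \<alpha>)) / p - 1 / p)) *
         upper_mean \<alpha> \<beta> p r u A * lower_mean p r u A < ennreal C"
  shows "weighted_Lp \<alpha> \<Omega> (\<lambda>x. u x powr (\<alpha> * recip \<beta> * p)) \<subseteq> Hardy_weights p \<Omega> V"
proof
  fix g assume g: "g \<in> weighted_Lp \<alpha> \<Omega> (\<lambda>x. u x powr (\<alpha> * recip \<beta> * p))"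
  define N where "N = real DIM('a)"
  define \<theta> where "\<theta> = 1 / N + recip (hoelder_conj (ereal \<alpha>)) / p - 1 / p"
  define t where "t = recip \<beta>"
  define s where "s = recip (hoelder_conj \<beta>)"
  have p1: "1 < p" and N0: "0 < N" and pN: "p < N" using p by (auto simp: N_def)
  have st: "s = 1 - t" "0 \<le> t" "t \<le> 1" using recip_hoelder_conj[OF \<beta>] recip_bounds[OF \<beta>] by (auto simp: s_def t_def)
  have \<Omega>s: "\<Omega> \<in> sets lebesgue" using domain(1) by auto
  obtain C where C: "0 < C" and bound: "\<And>A. A \<in> sets lebesgue \<Longrightarrow> A \<subseteq> \<Omega> \<Longrightarrow> 0 < emeasure lebesgue A \<Longrightarrow>
      emeasure lebesgue A < \<infinity> \<Longrightarrow>
      ennreal (measure lebesgue A powr \<theta>) * upper_mean \<alpha> \<beta> p r u A * lower_mean p r u A < ennreal C"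
    using mean_bound unfolding \<theta>_def N_def by blast
  have "0 \<le> \<theta>"
    by (rule mean_bound_exponent[OF domain(1,3) u_cont u_pos \<alpha>(1) \<beta> p1 r C bound])
  \<comment> \<open>\<open>\<theta>\<close> has the sign of \<open>\<alpha> * p - N\<close>;
    together with the assumed upper bound on \<open>\<alpha>\<close> this leaves only
    \<open>\<alpha> * p = N\<close>.\<close>
  moreover have "\<theta> = 1 / N - 1 / (\<alpha> * p)"
  proof -
    have "recip (hoelder_conj (ereal \<alpha>)) = 1 - 1 / \<alpha>"
      using recip_hoelder_conj[of "ereal \<alpha>"] \<alpha>(1) by (simp add: recip_ereal one_ereal_def)
    then show ?thesis by (simp add: \<theta>_def diff_divide_distrib)
  qed
  ultimately have "1 / (\<alpha> * p) \<le> 1 / N" by simp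
  then have "N \<le> \<alpha> * p" using N0 p1 \<alpha>(1) by (simp add: field_simps)
  moreover have "\<alpha> * p \<le> N" using \<alpha>(2) p1 by (simp add: N_def field_simps)
  ultimately have \<alpha>p: "\<alpha> * p = N" by simp
  then have \<theta>0: "\<theta> = 0" using \<open>\<theta> = 1 / N - 1 / (\<alpha> * p)\<close> by simp
  have \<alpha>N: "1 / \<alpha> = p / N" using \<alpha>p \<alpha>(1) p1 by (auto simp: field_simps)
  have harnack: "u x powr s \<le> 16 * C * u y" if "x \<in> \<Omega>" "y \<in> \<Omega>" for x y
    unfolding s_def
    by (rule mean_bound_harnack[OF domain(1) u_cont u_pos \<alpha>(1) \<beta> p1 r C bound[unfolded \<theta>0] that])
  define m where "m = (INF x\<in>\<Omega>. u x)"
  have bdd: "bdd_below (u ` \<Omega>)" using u_pos by (intro bdd_belowI[of _ 0]) (auto intro: less_imp_le)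
  have m: "m \<le> u x" if "x \<in> \<Omega>" for x unfolding m_def by (rule cINF_lower[OF bdd that])
  have um: "u x powr s \<le> 16 * C * m" if x: "x \<in> \<Omega>" for x
  proof -
    have "u x powr s / (16 * C) \<le> m"
      unfolding m_def using harnack[OF x] C by (intro cINF_greatest[OF domain(3)]) (simp add: field_simps)
    then show ?thesis using C by (simp add: field_simps)
  qed
  have m0: "0 < m"
  proof -
    obtain x where x: "x \<in> \<Omega>" using domain(3) by auto
    have "0 < u x powr s" using u_pos[OF x] by simp
    then have "0 < 16 * C * m" using um[OF x] by linarith
    then show ?thesis using C by (simp add: zero_less_mult_iff)
  qed
  \<comment> \<open>\<open>p < N\<close> selects the first branch of
    \<open>Morrey_p_loc\<close>.\<close>
  have VM: "V \<in> Morrey_loc q \<Omega>" using V p by (simp add: Morrey_p_loc_def)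
  have Vm: "V \<in> borel_measurable (lebesgue_on \<Omega>)" using VM by (simp add: Morrey_loc_def)
  have gm[measurable]: "g \<in> borel_measurable (lebesgue_on \<Omega>)" using g by (simp add: weighted_Lp_def)
  have um'[measurable]: "u \<in> borel_measurable (lebesgue_on \<Omega>)"
    using u_cont \<Omega>s by (rule continuous_imp_measurable_on_sets_lebesgue)
  define W where "W = (\<integral>\<^sup>+x. ennreal (\<bar>g x\<bar> powr \<alpha> * u x powr (\<alpha> * t * p)) \<partial>lebesgue_on \<Omega>)"
  have Wfin: "W < \<infinity>" using g by (simp add: weighted_Lp_def W_def t_def)
  define Q where "Q = N * p / (N - p)"
  define c where "c = (p * (N - 1) / (N - p)) powr p * (1 / m) powr p * 2 powr (p - 1)"
  \<comment> \<open>The constants of three estimates multiplied: \<open>16 * C * m\<close> from the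
    bound on \<open>u powr s\<close>, the power of \<open>W\<close> from Hoelder's inequality, and
    \<open>c\<close> from the weighted Sobolev inequality.\<close>
  define c' where "c' = (16 * C * m) powr p * (enn2real W powr (1 / \<alpha>) * c)"
  have c0: "0 \<le> c" "0 \<le> c'" by (simp_all add: c_def c'_def)
  have gL1: "g \<in> Lp_loc 1 \<Omega>"
  proof (rule weighted_Lp_locally_integrable[OF g \<Omega>s \<alpha>(1)])
    show "0 < m powr (\<alpha> * recip \<beta> * p)" using m0 by simp
    show "m powr (\<alpha> * recip \<beta> * p) \<le> u x powr (\<alpha> * recip \<beta> * p)" if "x \<in> \<Omega>" for x
      using m[OF that] m0 st \<alpha> p1 by (intro powr_mono2) (auto simp: t_def)
  qed
  \<comment> \<open>The 1 is added because a Hardy constant has to be positive, whereas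
    \<open>c'\<close> is 0 for \<open>g = 0\<close>.\<close>
  have hardy: "(\<integral>x. \<bar>g x\<bar> * \<bar>\<phi> x\<bar> powr p \<partial>lebesgue_on \<Omega>) \<le> (c' + 1) * Q_energy p V \<Omega> \<phi>"
    if phi: "\<phi> \<in> W1p p \<Omega> \<inter> Cc \<Omega>" for \<phi>
  proof -
    have [measurable]: "\<phi> \<in> borel_measurable (lebesgue_on \<Omega>)" using phi by (simp add: W1p_def Lp_def)
    have Q0: "0 \<le> Q_energy p V \<Omega> \<phi>" by (rule Q_nonneg[OF phi])
    define X where "X = (\<integral>\<^sup>+x. ennreal (\<bar>\<phi> x / u x\<bar> powr Q) \<partial>lebesgue_on \<Omega>)"
    have sob: "epow X (1 - p / N) \<le> ennreal (c * Q_energy p V \<Omega> \<phi>)"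
      unfolding X_def Q_def c_def N_def
      by (rule weighted_sobolev_energy[OF domain(1) p Vm _ u_cont m0 m u_sol])
         (use phi Morrey_locally_integrable[OF VM domain(1)] in auto)
    have "(\<integral>\<^sup>+x. ennreal (\<bar>g x\<bar> * \<bar>\<phi> x\<bar> powr p) \<partial>lebesgue_on \<Omega>) \<le>
      (\<integral>\<^sup>+x. ennreal ((16 * C * m) powr p) * (epow (ennreal (\<bar>g x\<bar> powr \<alpha> * u x powr (\<alpha> * t * p))) (1 / \<alpha>) *
        epow (ennreal (\<bar>\<phi> x / u x\<bar> powr Q)) (1 - p / N)) \<partial>lebesgue_on \<Omega>)"
    proof (rule nn_integral_mono)
      fix x assume "x \<in> space (lebesgue_on \<Omega>)"
      then have x: "x \<in> \<Omega>" by simp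
      have ux: "0 < u x" by (rule u_pos[OF x])
      have "Q * (1 - p / N) = p" using N0 pN by (simp add: Q_def field_simps)
      moreover have "1 - p / N \<noteq> 0" using N0 pN by simp
      ultimately have e2: "epow (ennreal (\<bar>\<phi> x / u x\<bar> powr Q)) (1 - p / N) = ennreal (\<bar>\<phi> x / u x\<bar> powr p)"
        by (metis epow_ennreal powr_ge_zero powr_powr)
      have "(\<bar>g x\<bar> powr \<alpha> * u x powr (\<alpha> * t * p)) powr (1 / \<alpha>) = \<bar>g x\<bar> * u x powr (t * p)"
        using \<alpha>(1) by (simp add: powr_mult powr_powr)
      then have e1: "epow (ennreal (\<bar>g x\<bar> powr \<alpha> * u x powr (\<alpha> * t * p))) (1 / \<alpha>) = ennreal (\<bar>g x\<bar> * u x powr (t * p))"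
        using \<alpha>(1) by (simp add: epow_ennreal)
      \<comment> \<open>Here \<open>s + t = 1\<close>: of the power \<open>p\<close> of
        \<open>u\<close>, the part \<open>s * p\<close> is bounded by a constant and the part
        \<open>t * p\<close> becomes the weight of \<open>g\<close>.\<close>
      have "\<bar>\<phi> x\<bar> powr p = (u x powr s) powr p * u x powr (t * p) * \<bar>\<phi> x / u x\<bar> powr p"
      proof -
        have "(u x powr s) powr p * u x powr (t * p) = u x powr p"
          using ux by (simp add: powr_powr powr_add[symmetric] st(1) algebra_simps)
        then show ?thesis using ux by (simp add: powr_divide)
      qed
      also have "\<dots> \<le> (16 * C * m) powr p * u x powr (t * p) * \<bar>\<phi> x / u x\<bar> powr p"
        using um[OF x] p1 by (intro mult_right_mono powr_mono2) auto
      finally have "\<bar>g x\<bar> * \<bar>\<phi> x\<bar> powr p \<le> \<bar>g x\<bar> * ((16 * C * m) powr p * u x powr (t * p) * \<bar>\<phi> x / u x\<bar> powr p)"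
        by (intro mult_left_mono) auto
      also have "\<dots> = (16 * C * m) powr p * ((\<bar>g x\<bar> * u x powr (t * p)) * \<bar>\<phi> x / u x\<bar> powr p)"
        by (simp only: mult_ac)
      finally have "ennreal (\<bar>g x\<bar> * \<bar>\<phi> x\<bar> powr p) \<le>
          ennreal ((16 * C * m) powr p * ((\<bar>g x\<bar> * u x powr (t * p)) * \<bar>\<phi> x / u x\<bar> powr p))"
        by (rule ennreal_leI)
      also have "\<dots> = ennreal ((16 * C * m) powr p) * (ennreal (\<bar>g x\<bar> * u x powr (t * p)) * ennreal (\<bar>\<phi> x / u x\<bar> powr p))"
        by (subst ennreal_mult; (subst ennreal_mult)?; simp)
      finally show "ennreal (\<bar>g x\<bar> * \<bar>\<phi> x\<bar> powr p) \<le> ennreal ((16 * C * m) powr p) * (epow (ennreal (\<bar>g x\<bar> powr \<alpha> * u x powr (\<alpha> * t * p))) (1 / \<alpha>) *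
        epow (ennreal (\<bar>\<phi> x / u x\<bar> powr Q)) (1 - p / N))" unfolding e1 e2 .
    qed
    also have "\<dots> = ennreal ((16 * C * m) powr p) * (\<integral>\<^sup>+x. epow (ennreal (\<bar>g x\<bar> powr \<alpha> * u x powr (\<alpha> * t * p))) (1 / \<alpha>) *
        epow (ennreal (\<bar>\<phi> x / u x\<bar> powr Q)) (1 - p / N) \<partial>lebesgue_on \<Omega>)"
      by (rule nn_integral_cmult) measurable
    also have "\<dots> \<le> ennreal ((16 * C * m) powr p) * (epow W (1 / \<alpha>) * epow X (1 - p / N))"
      unfolding W_def X_def
    proof (intro mult_left_mono nn_integral_Hoelder)
      show "(\<lambda>x. ennreal (\<bar>g x\<bar> powr \<alpha> * u x powr (\<alpha> * t * p))) \<in> borel_measurable (lebesgue_on \<Omega>)"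
        by measurable
      show "(\<lambda>x. ennreal (\<bar>\<phi> x / u x\<bar> powr Q)) \<in> borel_measurable (lebesgue_on \<Omega>)"
        by measurable
      \<comment> \<open>Here \<open>\<alpha> = N / p\<close> is used: the Sobolev inequality
        supplies exactly the power conjugate to \<open>\<alpha>\<close>.\<close>
      show "1 / \<alpha> + (1 - p / N) = 1" by (simp add: \<alpha>N)
      show "0 \<le> 1 / \<alpha>" using \<alpha>(1) by simp
      show "0 \<le> 1 - p / N" using N0 pN by simp
    qed simp
    also have "\<dots> \<le> ennreal ((16 * C * m) powr p) * (ennreal (enn2real W powr (1 / \<alpha>)) * ennreal (c * Q_energy p V \<Omega> \<phi>))"
    proof (intro mult_left_mono mult_mono sob)
      have "W = ennreal (enn2real W)" using Wfin by (simp add: less_top)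
      then have "epow W (1 / \<alpha>) = ennreal (enn2real W powr (1 / \<alpha>))"
        using \<alpha>(1) epow_ennreal[of "enn2real W" "1 / \<alpha>"] by simp
      then show "epow W (1 / \<alpha>) \<le> ennreal (enn2real W powr (1 / \<alpha>))" by simp
    qed auto
    also have "\<dots> = ennreal (c' * Q_energy p V \<Omega> \<phi>)"
      using c0 Q0 by (simp add: c'_def ennreal_mult[symmetric] mult.assoc)
    also have "\<dots> \<le> ennreal ((c' + 1) * Q_energy p V \<Omega> \<phi>)"
      using Q0 by (intro ennreal_leI mult_right_mono) auto
    finally show ?thesis
      using c0 Q0 by (intro integral_real_bounded) auto
  qed
  show "g \<in> Hardy_weights p \<Omega> V"
    unfolding Hardy_weights_def using gL1 hardy c0(2)
    by (intro CollectI conjI exI[of _ "c' + 1"]) auto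
qed

end
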